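(* Let $\phi=\sum_{i=1}^n F_i\,dz^i$ be a conic regular holomorphic $1$-form on an open subset $U\subset\mathbb{C}^n$. Then the corresponding (totally complex) holomorphic immersion $\phi:U\to V=T^*\mathbb{C}^n$ defines on $U$ the structure of a conic symplectic manifold $(U,J,\nabla,\omega)$ of complex dimension $n$, where $J$ is the complex structure of $U$ and $\nabla,\omega$ are the connection and symplectic form induced by $\phi$. Conversely, any conic symplectic manifold of complex dimension $n$ can be locally obtained in this way, i.e. every point has an open neighbourhood which is isomorphic, as a conic symplectic manifold, to one defined by a conic regular holomorphic $1$-form on an open subset of $\mathbb{C}^n$.
   Context: A local holomorphic $\mathbb{C}^*$-action on a complex manifold $M$ is a holomorphic map $(\lambda,p)\mapsto\varphi_\lambda(p)\in M$ defined on an open neighbourhood $W$ of $\{1\}\times M$ in $\mathbb{C}^*\times M$ such that $\varphi_1(p)=p$ for all $p$ and $\varphi_\lambda(\varphi_\mu(p))=\varphi_{\lambda\mu}(p)$ whenever both sides are defined. Equations involving $\varphi_\lambda$ are meant to hold locally, i.e. on any open set on which $\varphi_\lambda$ is defined and is a diffeomorphism onto its image. A conic complex manifold $(M,J,\nabla)$ is a complex manifold $(M,J)$ with a flat torsionfree connection $\nabla$ (on the real tangent bundle) admitting a local holomorphic $\mathbb{C}^*$-action $\varphi_\lambda$ such that locally $d\varphi_\lambda X=re^{\theta J}X=r(\cos\theta)X+r(\sin\theta)JX$ for all (local) $\nabla$-parallel vector fields $X$, where $\lambda=re^{i\theta}$, $r>0$. A conic symplectic manifold is a conic complex manifold with a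 $\nabla$-parallel symplectic form $\omega$. A holomorphic $1$-form $\sum F_i\,dz^i$ on an open set $U\subset\mathbb{C}^n$ is called regular if the real matrix $\left(\mathrm{Im}\,\partial F_i/\partial z^j\right)$ is invertible (at every point of $U$), and conic if the functions $F_i$ are locally homogeneous of degree one, i.e. $F_i(\lambda z)=\lambda F_i(z)$ for all $z\in U$ and all $\lambda$ near $1\in\mathbb{C}^*$. A holomorphic $1$-form is considered as a holomorphic immersion $U\to V=T^*\mathbb{C}^n$: in the canonical coordinates $(z^1,\dots,z^n,w_1,\dots,w_n)$ of $V$ it is $z\mapsto(z,F_1(z),\dots,F_n(z))$. An immersion $\phi$ into $V$ is totally complex if $T^*\mathbb{R}^n\cap d\phi(T_pU)=0$ for all $p$, where $T^*\mathbb{R}^n=\mathbb{R}^{2n}\subset\mathbb{C}^{2n}=V$. Put $x^i=\mathrm{Re}\,z^i$, $y_i=\mathrm{Re}\,w_i$. For a totally complex holomorphic immersion $\phi$, the functions $x^i\circ\phi,\ y_j\circ\phi$ are local coordinates around each point; the induced connection $\nabla$ is the flat torsionfree connection for which these functions are affine, and the induced symplectic form is $\omega=2\phi^*(\sum dx^i\wedge dy_i)$. *)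

theory Defs
  imports "HOL-Analysis.Analysis"
begin

section \<open>Smooth and holomorphic maps between vector spaces\<close>

text \<open>The sets \<open>S\<close> below are always open.\<close>

primrec Ck_on :: "nat \<Rightarrow> 'a::real_normed_vector set \<Rightarrow> ('a \<Rightarrow> 'b::real_normed_vector) \<Rightarrow> bool" where
  "Ck_on 0 S f \<longleftrightarrow> continuous_on S f"
| "Ck_on (Suc k) S f \<longleftrightarrow>
     (\<forall>x\<in>S. f differentiable (at x)) \<and> (\<forall>v. Ck_on k S (\<lambda>x. frechet_derivative f (at x) v))"

definition smooth_on :: "'a::real_normed_vector set \<Rightarrow> ('a \<Rightarrow> 'b::real_normed_vector) \<Rightarrow> bool" where
  "smooth_on S f \<longleftrightarrow> (\<forall>k. Ck_on k S f)"

text \<open>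
  The complex structures of the source and the target are passed as the real linear maps
  \<open>I\<close> and \<open>I'\<close> (multiplication by the imaginary unit).
\<close>

definition holo :: "('a::real_normed_vector \<Rightarrow> 'a) \<Rightarrow> ('b::real_normed_vector \<Rightarrow> 'b)
    \<Rightarrow> ('a \<Rightarrow> 'b) \<Rightarrow> 'a set \<Rightarrow> bool" where
  "holo I I' f S \<longleftrightarrow> (\<forall>x\<in>S. \<exists>D. (f has_derivative D) (at x) \<and> (\<forall>v. D (I v) = I' (D v)))"

definition imul :: "complex^'n \<Rightarrow> complex^'n" where
  "imul v = \<i> *s v"

definition imul_V :: "(complex^'n) \<times> (complex^'n) \<Rightarrow> (complex^'n) \<times> (complex^'n)" where
  "imul_V = (\<lambda>(a, b). (imul a, imul b))"

definition imul_C :: "complex \<times> (complex^'n) \<Rightarrow> complex \<times> (complex^'n)" where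
  "imul_C = (\<lambda>(a, b). (\<i> * a, imul b))"


section \<open>Complex manifolds\<close>

text \<open>
  A chart is its domain together with its coordinate map. A complex manifold is given by a
  holomorphic atlas; its underlying set is the union of the chart domains, an open subset of
  the ambient topological space.
\<close>

type_synonym ('m, 'n) chart = "'m set \<times> ('m \<Rightarrow> (complex, 'n) vec)"

definition mfd_carrier :: "('m, 'n::finite) chart set \<Rightarrow> 'm set" where
  "mfd_carrier A = (\<Union>c\<in>A. fst c)"

definition chart_inv :: "('m, 'n::finite) chart \<Rightarrow> complex^'n \<Rightarrow> 'm" where
  "chart_inv c = inv_into (fst c) (snd c)"

definition complex_manifold ::
    "('m::{t2_space, second_countable_topology}, 'n::finite) chart set \<Rightarrow> bool" where
  "complex_manifold A \<longleftrightarrow>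
     (\<forall>c\<in>A. open (fst c) \<and> open (snd c ` fst c) \<and>
        homeomorphism (fst c) (snd c ` fst c) (snd c) (chart_inv c)) \<and>
     (\<forall>c\<in>A. \<forall>d\<in>A. holo imul imul (snd d \<circ> chart_inv c) (snd c ` (fst c \<inter> fst d)))"

definition holo_map :: "('m::topological_space, 'n::finite) chart set
    \<Rightarrow> ('k::topological_space, 'n) chart set \<Rightarrow> 'm set \<Rightarrow> ('m \<Rightarrow> 'k) \<Rightarrow> bool" where
  "holo_map A B N f \<longleftrightarrow> continuous_on N f \<and> f ` N \<subseteq> mfd_carrier B \<and>
     (\<forall>c\<in>A. \<forall>d\<in>B. holo imul imul (snd d \<circ> f \<circ> chart_inv c)
        (snd c ` {q \<in> fst c \<inter> N. f q \<in> fst d}))"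


section \<open>Real tangent vectors and vector fields\<close>

text \<open>
  A real tangent vector is the family of its components in all charts around the point,
  transforming by the real derivative of the coordinate changes. The entries at charts that
  do not contain the point are set to zero, so that tangent vectors at a point are equal iff
  they are equal as functions.
\<close>

type_synonym ('m, 'n) tvec = "('m, 'n) chart \<Rightarrow> (complex, 'n) vec"

type_synonym ('m, 'n) vfield = "'m \<Rightarrow> ('m, 'n) tvec"

definition tangent_space :: "('m, 'n::finite) chart set \<Rightarrow> 'm \<Rightarrow> ('m, 'n) tvec set" where
  "tangent_space A p = {v.
     (\<forall>c\<in>A. \<forall>d\<in>A. p \<in> fst c \<longrightarrow> p \<in> fst d \<longrightarrow>
        v d = frechet_derivative (snd d \<circ> chart_inv c) (at (snd c p)) (v c)) \<and>
     (\<forall>c. \<not> (c \<in> A \<and> p \<in> fst c) \<longrightarrow> v c = 0)}"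

definition J_op :: "('m, 'n::finite) tvec \<Rightarrow> ('m, 'n) tvec" where
  "J_op v = (\<lambda>c. imul (v c))"

text \<open>
  The derivative \<open>v f\<close> of a vector valued function at \<open>p\<close>; on tangent vectors it does not
  depend on the chosen chart.
\<close>

definition chart_at :: "('m, 'n::finite) chart set \<Rightarrow> 'm \<Rightarrow> ('m, 'n) chart" where
  "chart_at A p = (SOME c. c \<in> A \<and> p \<in> fst c)"

definition deriv_at :: "('m, 'n::finite) chart set \<Rightarrow> 'm \<Rightarrow> ('m, 'n) tvec
    \<Rightarrow> ('m \<Rightarrow> 'b::real_normed_vector) \<Rightarrow> 'b" where
  "deriv_at A p v f =
     (let c = chart_at A p in frechet_derivative (f \<circ> chart_inv c) (at (snd c p)) (v c))"

definition tangent_map :: "('m, 'n::finite) chart set \<Rightarrow> ('k, 'n) chart set \<Rightarrow> ('m \<Rightarrow> 'k)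
    \<Rightarrow> 'm \<Rightarrow> ('m, 'n) tvec \<Rightarrow> ('k, 'n) tvec" where
  "tangent_map A B f p v =
     (\<lambda>d. if d \<in> B \<and> f p \<in> fst d then deriv_at A p v (snd d \<circ> f) else 0)"

definition smooth_fun :: "('m, 'n::finite) chart set \<Rightarrow> 'm set \<Rightarrow> ('m \<Rightarrow> real) \<Rightarrow> bool" where
  "smooth_fun A S f \<longleftrightarrow> (\<forall>c\<in>A. smooth_on (snd c ` (fst c \<inter> S)) (f \<circ> chart_inv c))"

definition smooth_vfield :: "('m, 'n::finite) chart set \<Rightarrow> 'm set \<Rightarrow> ('m, 'n) vfield \<Rightarrow> bool" where
  "smooth_vfield A S X \<longleftrightarrow> (\<forall>q\<in>S. X q \<in> tangent_space A q) \<and>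
     (\<forall>c\<in>A. smooth_on (snd c ` (fst c \<inter> S)) (\<lambda>z. X (chart_inv c z) c))"

definition lie_bracket :: "('m, 'n::finite) chart set \<Rightarrow> ('m, 'n) vfield \<Rightarrow> ('m, 'n) vfield
    \<Rightarrow> ('m, 'n) vfield" where
  "lie_bracket A X Y p = (\<lambda>c. if c \<in> A \<and> p \<in> fst c
     then frechet_derivative (\<lambda>z. Y (chart_inv c z) c) (at (snd c p)) (X p c)
        - frechet_derivative (\<lambda>z. X (chart_inv c z) c) (at (snd c p)) (Y p c)
     else 0)"


section \<open>Connections and symplectic forms\<close>

text \<open>
  A connection on the real tangent bundle assigns to a point \<open>p\<close>, a tangent vector \<open>v\<close> at \<open>p\<close>
  and a local vector field \<open>X\<close> around \<open>p\<close> the covariant derivative \<open>\<nabla>\<^sub>v X\<close>. Fields are total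
  functions with arbitrary values outside \<open>S\<close>; since \<open>S\<close> ranges over all open sets, the condition
  on fields with \<open>X = Y\<close> on \<open>S\<close> says that \<open>\<nabla>\<^sub>v X\<close> depends only on the germ of \<open>X\<close> at \<open>p\<close>.
\<close>

type_synonym ('m, 'n) conn = "'m \<Rightarrow> ('m, 'n) tvec \<Rightarrow> ('m, 'n) vfield \<Rightarrow> ('m, 'n) tvec"

definition connection ::
    "('m::topological_space, 'n::finite) chart set \<Rightarrow> ('m, 'n) conn \<Rightarrow> bool" where
  "connection A nabla \<longleftrightarrow> (\<forall>S. open S \<and> S \<subseteq> mfd_carrier A \<longrightarrow>
     (\<forall>X Y f. smooth_vfield A S X \<and> smooth_vfield A S Y \<and> smooth_fun A S f \<longrightarrow>
        smooth_vfield A S (\<lambda>q. nabla q (Y q) X) \<and>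
        (\<forall>p\<in>S. \<forall>v\<in>tangent_space A p. \<forall>w\<in>tangent_space A p. \<forall>a b.
           ((\<forall>q\<in>S. X q = Y q) \<longrightarrow> nabla p v X = nabla p v Y) \<and>
           nabla p v X \<in> tangent_space A p \<and>
           nabla p (\<lambda>c. a *\<^sub>R v c + b *\<^sub>R w c) X
             = (\<lambda>c. a *\<^sub>R nabla p v X c + b *\<^sub>R nabla p w X c) \<and>
           nabla p v (\<lambda>q c. X q c + Y q c) = (\<lambda>c. nabla p v X c + nabla p v Y c) \<and>
           nabla p v (\<lambda>q c. f q *\<^sub>R X q c)
             = (\<lambda>c. deriv_at A p v f *\<^sub>R X p c + f p *\<^sub>R nabla p v X c))))"

definition torsionfree ::
    "('m::topological_space, 'n::finite) chart set \<Rightarrow> ('m, 'n) conn \<Rightarrow> bool" where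
  "torsionfree A nabla \<longleftrightarrow> (\<forall>S X Y. open S \<and> S \<subseteq> mfd_carrier A \<and>
     smooth_vfield A S X \<and> smooth_vfield A S Y \<longrightarrow>
     (\<forall>p\<in>S. \<forall>c. nabla p (X p) Y c - nabla p (Y p) X c = lie_bracket A X Y p c))"

definition flat_connection ::
    "('m::topological_space, 'n::finite) chart set \<Rightarrow> ('m, 'n) conn \<Rightarrow> bool" where
  "flat_connection A nabla \<longleftrightarrow> (\<forall>S X Y Z. open S \<and> S \<subseteq> mfd_carrier A \<and>
     smooth_vfield A S X \<and> smooth_vfield A S Y \<and> smooth_vfield A S Z \<longrightarrow>
     (\<forall>p\<in>S. \<forall>c. nabla p (X p) (\<lambda>q. nabla q (Y q) Z) c
        - nabla p (Y p) (\<lambda>q. nabla q (X q) Z) c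
        - nabla p (lie_bracket A X Y p) Z c = 0))"

definition flat_torsionfree_connection ::
    "('m::topological_space, 'n::finite) chart set \<Rightarrow> ('m, 'n) conn \<Rightarrow> bool" where
  "flat_torsionfree_connection A nabla \<longleftrightarrow>
     connection A nabla \<and> flat_connection A nabla \<and> torsionfree A nabla"

definition parallel_vfield :: "('m, 'n::finite) chart set \<Rightarrow> ('m, 'n) conn \<Rightarrow> 'm set
    \<Rightarrow> ('m, 'n) vfield \<Rightarrow> bool" where
  "parallel_vfield A nabla S X \<longleftrightarrow> smooth_vfield A S X \<and>
     (\<forall>p\<in>S. \<forall>v\<in>tangent_space A p. \<forall>c. nabla p v X c = 0)"

text \<open>A function is affine if its Hessian \<open>\<nabla>df\<close> vanishes: \<open>v (X f) = (\<nabla>\<^sub>v X) f\<close>.\<close>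

definition affine_fun :: "('m::topological_space, 'n::finite) chart set \<Rightarrow> ('m, 'n) conn
    \<Rightarrow> ('m \<Rightarrow> real) \<Rightarrow> bool" where
  "affine_fun A nabla f \<longleftrightarrow> smooth_fun A (mfd_carrier A) f \<and>
     (\<forall>S X. open S \<and> S \<subseteq> mfd_carrier A \<and> smooth_vfield A S X \<longrightarrow>
       (\<forall>p\<in>S. \<forall>v\<in>tangent_space A p.
          deriv_at A p v (\<lambda>q. deriv_at A q (X q) f) = deriv_at A p (nabla p v X) f))"

type_synonym ('m, 'n) form2 = "'m \<Rightarrow> ('m, 'n) tvec \<Rightarrow> ('m, 'n) tvec \<Rightarrow> real"

definition two_form ::
    "('m::topological_space, 'n::finite) chart set \<Rightarrow> ('m, 'n) form2 \<Rightarrow> bool" where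
  "two_form A w \<longleftrightarrow>
     (\<forall>p\<in>mfd_carrier A. \<forall>u\<in>tangent_space A p. \<forall>v\<in>tangent_space A p. \<forall>x\<in>tangent_space A p. \<forall>a b.
        w p u v = - w p v u \<and>
        w p (\<lambda>c. a *\<^sub>R u c + b *\<^sub>R v c) x = a * w p u x + b * w p v x) \<and>
     (\<forall>S X Y. open S \<and> S \<subseteq> mfd_carrier A \<and> smooth_vfield A S X \<and> smooth_vfield A S Y \<longrightarrow>
        smooth_fun A S (\<lambda>q. w q (X q) (Y q)))"

definition closed_form ::
    "('m::topological_space, 'n::finite) chart set \<Rightarrow> ('m, 'n) form2 \<Rightarrow> bool" where
  "closed_form A w \<longleftrightarrow> (\<forall>S X Y Z. open S \<and> S \<subseteq> mfd_carrier A \<and>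
     smooth_vfield A S X \<and> smooth_vfield A S Y \<and> smooth_vfield A S Z \<longrightarrow>
     (\<forall>p\<in>S. deriv_at A p (X p) (\<lambda>q. w q (Y q) (Z q))
          + deriv_at A p (Y p) (\<lambda>q. w q (Z q) (X q))
          + deriv_at A p (Z p) (\<lambda>q. w q (X q) (Y q))
          - w p (lie_bracket A X Y p) (Z p)
          - w p (lie_bracket A Y Z p) (X p)
          - w p (lie_bracket A Z X p) (Y p) = 0))"

definition symplectic_form ::
    "('m::topological_space, 'n::finite) chart set \<Rightarrow> ('m, 'n) form2 \<Rightarrow> bool" where
  "symplectic_form A w \<longleftrightarrow> two_form A w \<and> closed_form A w \<and>
     (\<forall>p\<in>mfd_carrier A. \<forall>v\<in>tangent_space A p.
        (\<forall>u\<in>tangent_space A p. w p v u = 0) \<longrightarrow> (\<forall>c. v c = 0))"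

definition parallel_form :: "('m::topological_space, 'n::finite) chart set \<Rightarrow> ('m, 'n) conn
    \<Rightarrow> ('m, 'n) form2 \<Rightarrow> bool" where
  "parallel_form A nabla w \<longleftrightarrow> (\<forall>S X Y. open S \<and> S \<subseteq> mfd_carrier A \<and>
     smooth_vfield A S X \<and> smooth_vfield A S Y \<longrightarrow>
     (\<forall>p\<in>S. \<forall>v\<in>tangent_space A p.
        deriv_at A p v (\<lambda>q. w q (X q) (Y q)) = w p (nabla p v X) (Y p) + w p (X p) (nabla p v Y)))"


section \<open>Conic complex and conic symplectic manifolds\<close>

definition local_Cstar_action :: "('m::topological_space, 'n::finite) chart set
    \<Rightarrow> (complex \<times> 'm) set \<Rightarrow> (complex \<Rightarrow> 'm \<Rightarrow> 'm) \<Rightarrow> bool" where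
  "local_Cstar_action A W \<phi> \<longleftrightarrow>
     open W \<and> {1} \<times> mfd_carrier A \<subseteq> W \<and> W \<subseteq> (- {0}) \<times> mfd_carrier A \<and>
     (\<forall>(\<mu>, p)\<in>W. \<phi> \<mu> p \<in> mfd_carrier A) \<and>
     continuous_on W (\<lambda>(\<mu>, p). \<phi> \<mu> p) \<and>
     (\<forall>c\<in>A. \<forall>d\<in>A. holo imul_C imul (\<lambda>(\<mu>, z). snd d (\<phi> \<mu> (chart_inv c z)))
        {(\<mu>, z). z \<in> snd c ` fst c \<and> (\<mu>, chart_inv c z) \<in> W \<and> \<phi> \<mu> (chart_inv c z) \<in> fst d}) \<and>
     (\<forall>p\<in>mfd_carrier A. \<phi> 1 p = p) \<and>
     (\<forall>\<mu> \<nu> p. (\<mu>, p) \<in> W \<and> (\<nu>, \<phi> \<mu> p) \<in> W \<and> (\<nu> * \<mu>, p) \<in> W \<longrightarrow>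
        \<phi> \<nu> (\<phi> \<mu> p) = \<phi> (\<nu> * \<mu>) p)"

text \<open>
  With \<open>\<mu> = r e\<^sup>i\<^sup>\<theta>\<close> one has \<open>r cos \<theta> = Re \<mu>\<close> and \<open>r sin \<theta> = Im \<mu>\<close>. For a parallel field \<open>X\<close> on an
  open set \<open>S\<close>, the equation \<open>d\<phi>\<^sub>\<mu> X = Re \<mu> X + Im \<mu> J X\<close> compares the values of \<open>X\<close> at \<open>q\<close> and at
  \<open>\<phi>\<^sub>\<mu>(q)\<close>. It is required whenever these two points are joined inside \<open>S\<close> by the local orbit
  of \<open>q\<close>; without such a restriction it would fail already for an \<open>S\<close> with two components,
  as \<open>X\<close> can be rescaled on one of them.
\<close>

definition conic_action :: "('m::topological_space, 'n::finite) chart set \<Rightarrow> ('m, 'n) conn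
    \<Rightarrow> (complex \<times> 'm) set \<Rightarrow> (complex \<Rightarrow> 'm \<Rightarrow> 'm) \<Rightarrow> bool" where
  "conic_action A nabla W \<phi> \<longleftrightarrow>
     (\<forall>S X. open S \<and> S \<subseteq> mfd_carrier A \<and> parallel_vfield A nabla S X \<longrightarrow>
        (\<forall>q\<in>S. \<forall>\<mu>. connected_component {\<nu>. (\<nu>, q) \<in> W \<and> \<phi> \<nu> q \<in> S} 1 \<mu> \<longrightarrow>
           tangent_map A A (\<phi> \<mu>) q (X q)
             = (\<lambda>c. Re \<mu> *\<^sub>R X (\<phi> \<mu> q) c + Im \<mu> *\<^sub>R J_op (X (\<phi> \<mu> q)) c)))"

definition conic_complex_manifold ::
    "('m::{t2_space, second_countable_topology}, 'n::finite) chart set \<Rightarrow> ('m, 'n) conn \<Rightarrow> bool" where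
  "conic_complex_manifold A nabla \<longleftrightarrow>
     complex_manifold A \<and> flat_torsionfree_connection A nabla \<and>
     (\<exists>W \<phi>. local_Cstar_action A W \<phi> \<and> conic_action A nabla W \<phi>)"

definition conic_symplectic_manifold ::
    "('m::{t2_space, second_countable_topology}, 'n::finite) chart set \<Rightarrow> ('m, 'n) conn
      \<Rightarrow> ('m, 'n) form2 \<Rightarrow> bool" where
  "conic_symplectic_manifold A nabla w \<longleftrightarrow>
     conic_complex_manifold A nabla \<and> symplectic_form A w \<and> parallel_form A nabla w"

text \<open>
  Isomorphism of the open subset \<open>N\<close> of the manifold \<open>A\<close>, with the restricted structure, with
  the manifold \<open>B\<close>: a biholomorphic map (which therefore respects the complex structures)
  carrying connection to connection and form to form. Tangent vectors of \<open>N\<close> are tangent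
  vectors of \<open>A\<close> at points of \<open>N\<close>.
\<close>

definition conic_symplectic_iso ::
    "('m::topological_space, 'n::finite) chart set \<Rightarrow> ('m, 'n) conn \<Rightarrow> ('m, 'n) form2 \<Rightarrow> 'm set
      \<Rightarrow> ('k::topological_space, 'n) chart set \<Rightarrow> ('k, 'n) conn \<Rightarrow> ('k, 'n) form2
      \<Rightarrow> ('m \<Rightarrow> 'k) \<Rightarrow> bool" where
  "conic_symplectic_iso A nabla w N B nabla' w' f \<longleftrightarrow>
     bij_betw f N (mfd_carrier B) \<and>
     holo_map A B N f \<and> holo_map B A (mfd_carrier B) (inv_into N f) \<and>
     (\<forall>S X. open S \<and> S \<subseteq> N \<and> smooth_vfield A S X \<longrightarrow>
        (\<forall>p\<in>S. \<forall>v\<in>tangent_space A p.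
           tangent_map A B f p (nabla p v X)
             = nabla' (f p) (tangent_map A B f p v)
                 (\<lambda>y. tangent_map A B f (inv_into N f y) (X (inv_into N f y))))) \<and>
     (\<forall>p\<in>N. \<forall>u\<in>tangent_space A p. \<forall>v\<in>tangent_space A p.
        w' (f p) (tangent_map A B f p u) (tangent_map A B f p v) = w p u v)"


section \<open>Immersions into the cotangent bundle of complex n-space\<close>

definition open_atlas :: "(complex^'n) set \<Rightarrow> (complex^'n, 'n::finite) chart set" where
  "open_atlas U = {(U, id)}"

text \<open>A one-form \<open>\<Sum>\<^sub>i F\<^sub>i dz\<^sup>i\<close> is encoded by its coefficient map \<open>F\<close>.\<close>

definition holomorphic_1form :: "(complex^'n) set \<Rightarrow> (complex^'n \<Rightarrow> complex^'n) \<Rightarrow> bool" where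
  "holomorphic_1form U F \<longleftrightarrow> open U \<and> holo imul imul F U"

definition regular_1form :: "(complex^'n) set \<Rightarrow> (complex^'n \<Rightarrow> complex^'n) \<Rightarrow> bool" where
  "regular_1form U F \<longleftrightarrow>
     (\<forall>z\<in>U. invertible (\<chi> i j. Im (deriv (\<lambda>t. F (z + axis j t) $ i) 0)))"

definition conic_1form :: "(complex^'n) set \<Rightarrow> (complex^'n \<Rightarrow> complex^'n) \<Rightarrow> bool" where
  "conic_1form U F \<longleftrightarrow> (\<forall>z\<in>U. \<forall>\<^sub>F \<mu> in nhds 1. F (\<mu> *s z) = \<mu> *s F z)"

definition section_of :: "(complex^'n \<Rightarrow> complex^'n) \<Rightarrow> complex^'n \<Rightarrow> (complex^'n) \<times> (complex^'n)" where
  "section_of F z = (z, F z)"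

definition holomorphic_immersion ::
    "(complex^'n) set \<Rightarrow> (complex^'n \<Rightarrow> (complex^'n) \<times> (complex^'n)) \<Rightarrow> bool" where
  "holomorphic_immersion U \<phi> \<longleftrightarrow> holo imul imul_V \<phi> U \<and>
     (\<forall>p\<in>U. inj (frechet_derivative \<phi> (at p)))"

definition real_points :: "((complex^'n) \<times> (complex^'n)) set" where
  "real_points = {(a, b). \<forall>i. Im (a $ i) = 0 \<and> Im (b $ i) = 0}"

definition totally_complex ::
    "(complex^'n) set \<Rightarrow> (complex^'n \<Rightarrow> (complex^'n) \<times> (complex^'n)) \<Rightarrow> bool" where
  "totally_complex U \<phi> \<longleftrightarrow>
     (\<forall>p\<in>U. real_points \<inter> range (frechet_derivative \<phi> (at p)) = {0})"

definition induced_connection :: "(complex^'n::finite) set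
    \<Rightarrow> (complex^'n \<Rightarrow> (complex^'n) \<times> (complex^'n)) \<Rightarrow> (complex^'n, 'n) conn \<Rightarrow> bool" where
  "induced_connection U \<phi> nabla \<longleftrightarrow>
     flat_torsionfree_connection (open_atlas U) nabla \<and>
     (\<forall>i. affine_fun (open_atlas U) nabla (\<lambda>z. Re (fst (\<phi> z) $ i)) \<and>
          affine_fun (open_atlas U) nabla (\<lambda>z. Re (snd (\<phi> z) $ i)))"

text \<open>The constant form \<open>\<Sum>\<^sub>i dx\<^sup>i \<and> dy\<^sub>i\<close> on \<open>V\<close>, with \<open>(\<alpha> \<and> \<beta>)(u, v) = \<alpha>(u) \<beta>(v) - \<alpha>(v) \<beta>(u)\<close>.\<close>

definition form_V ::
    "(complex^'n) \<times> (complex^'n) \<Rightarrow> (complex^'n) \<times> (complex^'n) \<Rightarrow> real" where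
  "form_V u v = (\<Sum>i\<in>UNIV. Re (fst u $ i) * Re (snd v $ i) - Re (fst v $ i) * Re (snd u $ i))"

definition induced_form :: "(complex^'n::finite) set
    \<Rightarrow> (complex^'n \<Rightarrow> (complex^'n) \<times> (complex^'n)) \<Rightarrow> (complex^'n, 'n) form2" where
  "induced_form U \<phi> p u v =
     2 * form_V (deriv_at (open_atlas U) p u \<phi>) (deriv_at (open_atlas U) p v \<phi>)"

end

theory Submission
  imports Defs "HOL-Complex_Analysis.Complex_Analysis"
begin

text \<open>
  For the direct statement, \<open>z \<mapsto> Re z + i Re F(z)\<close> is a local diffeomorphism exactly when \<open>F\<close> is
  regular, so it pulls back the flat connection and the standard symplectic form; Euler's equation
  \<open>DF(z) z = F(z)\<close> makes \<open>DF\<close> constant along complex rays, hence scaling satisfies the conic equation.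

  For the converse, take a frame of parallel fields near the point and differentiate
  \<open>d\<phi>\<^sub>\<mu> X = \<mu> X\<close> at \<open>\<mu> = 1\<close>: the generator \<open>\<xi>\<close> of the action satisfies \<open>\<nabla>\<xi> = id\<close> and \<open>\<nabla>(J\<xi>) = J\<close>.
  So the components \<open>x\<close> of \<open>\<xi>\<close> in the frame are affine coordinates, those of \<open>J\<xi>\<close> have differential
  \<open>dx \<circ> J\<close>, and \<open>x - i x(J\<xi>)\<close> is a holomorphic map with real part \<open>x\<close>, homogeneous under the action. Choosing a Darboux
  basis whose Lagrangian subspace is totally real at the point, half of these functions are local
  holomorphic coordinates \<open>z\<close>, and the other half, as functions of \<open>z\<close>, are the coefficients \<open>F\<close>.
\<close>

section \<open>Calculus of continuously differentiable maps\<close>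

text \<open>Nothing ties J to \<omega>: \<omega>(u, J v) has neither a symmetry nor a sign, and F is
  not assumed to be symmetric. Hence a Lagrangian subspace may contain complex lines, and one
  without them has to be constructed. Its total reality is exactly the invertibility of dz at the
  point; it is known at that point only, which is where the domain shrinks to what the inverse
  function theorem gives. The connection is an abstract operator on local fields, so parallel fields
  have to be produced from vanishing curvature. Christoffel symbols turn this into an overdetermined
  linear system, solved on a ball whose radius does not depend on the initial value, so that a whole
  frame lives on it. J need not be parallel, so \<nabla>(J\<xi>) = J does not follow from
  \<nabla>\<xi> = id; it is read off from the imaginary direction of \<mu>. Holomorphic means once
  real differentiable with complex linear derivative, so all smoothness has to come from Cauchy's
  formula on complex lines.\<close>

lemma frechet_derivative_eq: "(f has_derivative D) (at x) \<Longrightarrow> frechet_derivative f (at x) = D"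
  by (rule frechet_derivative_at[symmetric])

lemma Ck_on_subset: "Ck_on k S f \<Longrightarrow> T \<subseteq> S \<Longrightarrow> Ck_on k T f"
  by (induction k arbitrary: f) (auto intro: continuous_on_subset)

lemma Ck_on_cong:
  assumes "open S" "\<And>x. x \<in> S \<Longrightarrow> f x = g x" "Ck_on k S f"
  shows "Ck_on k S g"
  using assms(2,3)
proof (induction k arbitrary: f g)
  case 0
  then show ?case by (simp cong: continuous_on_cong)
next
  case (Suc k)
  have d: "(g has_derivative frechet_derivative f (at x)) (at x)" if "x \<in> S" for x
  proof -
    have "(f has_derivative frechet_derivative f (at x)) (at x)"
      using Suc.prems(2) that frechet_derivative_works by auto
    then show ?thesis
      by (rule has_derivative_transform_within_open[OF _ assms(1) that]) (rule Suc.prems(1))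
  qed
  have "Ck_on k S (\<lambda>x. frechet_derivative g (at x) v)" for v
  proof (rule Suc.IH)
    show "frechet_derivative f (at x) v = frechet_derivative g (at x) v" if "x \<in> S" for x
      by (simp add: frechet_derivative_eq[OF d[OF that]])
    show "Ck_on k S (\<lambda>x. frechet_derivative f (at x) v)" using Suc.prems(2) by simp
  qed
  then show ?case using d by (auto simp: differentiable_def)
qed

text \<open>\<open>Ck_on\<close> speaks of \<open>frechet_derivative\<close>; this rule lets an
  explicit formula for the derivative take its place.\<close>

lemma Ck_on_SucI:
  assumes "open S" "\<And>x. x \<in> S \<Longrightarrow> (f has_derivative D x) (at x)"
    and "\<And>v. Ck_on k S (\<lambda>x. D x v)"
  shows "Ck_on (Suc k) S f"
proof -
  have "frechet_derivative f (at x) = D x" if "x \<in> S" for x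
    by (rule frechet_derivative_eq[OF assms(2)[OF that]])
  then have "Ck_on k S (\<lambda>x. frechet_derivative f (at x) v)" for v
    using Ck_on_cong[OF assms(1) _ assms(3)[of v], of "\<lambda>x. frechet_derivative f (at x) v"] by simp
  then show ?thesis using assms(2) by (auto simp: differentiable_def)
qed

lemma Ck_on_imp_has_derivative:
  "Ck_on (Suc k) S f \<Longrightarrow> x \<in> S \<Longrightarrow> (f has_derivative frechet_derivative f (at x)) (at x)"
  using frechet_derivative_works by auto

lemma Ck_on_frechet_derivative:
  "Ck_on (Suc k) S f \<Longrightarrow> Ck_on k S (\<lambda>x. frechet_derivative f (at x) v)"
  by simp

lemma Ck_on_SucD: "Ck_on (Suc k) S f \<Longrightarrow> Ck_on k S f"
proof (induction k arbitrary: f)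
  case 0
  then show ?case
    by (auto intro!: continuous_at_imp_continuous_on differentiable_imp_continuous_within)
next
  case (Suc k)
  show ?case
    using Suc.prems Suc.IH[OF Ck_on_frechet_derivative[OF Suc.prems]] unfolding Ck_on.simps(2) by blast
qed

lemma Ck_on_mono: "Ck_on k S f \<Longrightarrow> j \<le> k \<Longrightarrow> Ck_on j S f"
  by (induction k) (auto simp: le_Suc_eq simp del: Ck_on.simps dest: Ck_on_SucD)

lemma Ck_on_imp_continuous: "Ck_on k S f \<Longrightarrow> continuous_on S f"
  using Ck_on_mono[of k S f 0] by simp

lemma Ck_on_const: "Ck_on k S (\<lambda>x. c)"
  by (induction k arbitrary: c) auto

lemma Ck_on_bounded_linear: "bounded_linear L \<Longrightarrow> Ck_on k S L"
proof (cases k)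
  case (Suc j)
  assume L: "bounded_linear L"
  then have "frechet_derivative L (at x) = L" for x
    by (intro frechet_derivative_eq bounded_linear_imp_has_derivative)
  with L show ?thesis
    by (auto simp: Suc Ck_on_const intro: bounded_linear_imp_differentiable)
qed (auto intro: linear_continuous_on)

lemma Ck_on_bounded_linear_compose:
  assumes "open S" "bounded_linear L" "Ck_on k S f"
  shows "Ck_on k S (\<lambda>x. L (f x))"
  using assms(3)
proof (induction k arbitrary: f)
  case 0
  then show ?case by (auto intro: bounded_linear.continuous_on[OF assms(2)])
next
  case (Suc k)
  show ?case
  proof (rule Ck_on_SucI[OF assms(1)])
    show "((\<lambda>x. L (f x)) has_derivative (\<lambda>v. L (frechet_derivative f (at x) v))) (at x)" if "x \<in> S" for x
      using Ck_on_imp_has_derivative[OF Suc.prems that] assms(2)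
      by (rule bounded_linear.has_derivative[rotated])
    show "Ck_on k S (\<lambda>x. L (frechet_derivative f (at x) v))" for v
      using Suc by auto
  qed
qed

lemma Ck_on_add:
  assumes "open S" "Ck_on k S f" "Ck_on k S g"
  shows "Ck_on k S (\<lambda>x. f x + g x)"
  using assms(2,3)
proof (induction k arbitrary: f g)
  case 0
  then show ?case by (auto intro: continuous_on_add)
next
  case (Suc k)
  show ?case
  proof (rule Ck_on_SucI[OF assms(1)])
    show "((\<lambda>x. f x + g x) has_derivative
        (\<lambda>v. frechet_derivative f (at x) v + frechet_derivative g (at x) v)) (at x)" if "x \<in> S" for x
      using Suc.prems that by (intro has_derivative_add Ck_on_imp_has_derivative)
    show "Ck_on k S (\<lambda>x. frechet_derivative f (at x) v + frechet_derivative g (at x) v)" for v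
      using Suc by auto
  qed
qed

lemma Ck_on_bilinear:
  assumes "open S" "bounded_bilinear B" "Ck_on k S f" "Ck_on k S g"
  shows "Ck_on k S (\<lambda>x. B (f x) (g x))"
  using assms(3,4)
proof (induction k arbitrary: f g)
  case 0
  then show ?case by (auto intro: bounded_bilinear.continuous_on[OF assms(2)])
next
  case (Suc k)
  show ?case
  proof (rule Ck_on_SucI[OF assms(1)])
    show "((\<lambda>x. B (f x) (g x)) has_derivative
        (\<lambda>v. B (f x) (frechet_derivative g (at x) v) + B (frechet_derivative f (at x) v) (g x))) (at x)"
      if "x \<in> S" for x
      using Suc.prems that by (intro bounded_bilinear.FDERIV[OF assms(2)] Ck_on_imp_has_derivative)
    show "Ck_on k S (\<lambda>x. B (f x) (frechet_derivative g (at x) v) + B (frechet_derivative f (at x) v) (g x))"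
      for v
      by (intro Ck_on_add[OF assms(1)] Suc.IH Suc.prems[THEN Ck_on_SucD] Suc.prems[THEN Ck_on_frechet_derivative])
  qed
qed

lemma Ck_on_sum:
  assumes "open S" "\<And>i. i \<in> I \<Longrightarrow> Ck_on k S (f i)"
  shows "Ck_on k S (\<lambda>x. \<Sum>i\<in>I. f i x)"
  using assms(2) by (induction I rule: infinite_finite_induct) (auto simp: Ck_on_const intro!: Ck_on_add[OF assms(1)])

section \<open>Families of linear maps: product rule and composition\<close>

lemma linear_sum_Basis:
  fixes L :: "'a::euclidean_space \<Rightarrow> 'b::real_vector"
  assumes "linear L"
  shows "L v = (\<Sum>b\<in>Basis. (v \<bullet> b) *\<^sub>R L b)"
  using linear_sum[OF assms, of "\<lambda>b. (v \<bullet> b) *\<^sub>R b" Basis]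
  by (simp add: euclidean_representation linear_cmul[OF assms])

text \<open>Linearity holds for all parameters in the open set S, hence near x, so the identities of
  linearity may themselves be differentiated at x.\<close>

lemma linear_frechet_derivative_family:
  assumes S: "open S" and x: "x \<in> S" and lin: "\<And>x. x \<in> S \<Longrightarrow> linear (A x)"
    and d: "\<And>w. (\<lambda>x. A x w) differentiable (at x)"
  shows "linear (\<lambda>w. frechet_derivative (\<lambda>x. A x w) (at x) v)"
proof (rule linearI)
  note dA = d[unfolded frechet_derivative_works]
  show "frechet_derivative (\<lambda>x. A x (w + w')) (at x) v
      = frechet_derivative (\<lambda>x. A x w) (at x) v + frechet_derivative (\<lambda>x. A x w') (at x) v" for w w'
    using has_derivative_transform_within_open[OF has_derivative_add[OF dA[of w] dA[of w']] S x,
        of "\<lambda>x. A x (w + w')"]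
    by (simp add: lin linear_add frechet_derivative_eq)
  show "frechet_derivative (\<lambda>x. A x (c *\<^sub>R w)) (at x) v = c *\<^sub>R frechet_derivative (\<lambda>x. A x w) (at x) v" for c w
    using has_derivative_transform_within_open[OF has_derivative_scaleR_right[OF dA[of w], of c] S x,
        of "\<lambda>x. A x (c *\<^sub>R w)"]
    by (simp add: lin linear_cmul frechet_derivative_eq)
qed

lemma continuous_on_linear_family:
  fixes A :: "'x::topological_space \<Rightarrow> 'a::euclidean_space \<Rightarrow> 'b::real_normed_vector"
  assumes lin: "\<And>x. x \<in> S \<Longrightarrow> linear (A x)"
    and A: "\<And>b. b \<in> Basis \<Longrightarrow> continuous_on S (\<lambda>x. A x b)" and h: "continuous_on S h"
  shows "continuous_on S (\<lambda>x. A x (h x))"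
proof (rule continuous_on_eq)
  show "(\<Sum>b\<in>Basis. (h x \<bullet> b) *\<^sub>R A x b) = A x (h x)" if "x \<in> S" for x
    using linear_sum_Basis[OF lin[OF that], of "h x"] by simp
  show "continuous_on S (\<lambda>x. \<Sum>b\<in>Basis. (h x \<bullet> b) *\<^sub>R A x b)"
    by (intro continuous_on_sum continuous_on_scaleR A continuous_on_inner h continuous_on_const)
qed

text \<open>Product rule for the evaluation \<open>A x (h x)\<close>. Expansion in the basis reduces
  it to scalars times vectors, so no norm on operators enters. The name \<open>x0\<close> is a
  second one for the point, since the bound \<open>x\<close> hides it.\<close>

lemma has_derivative_linear_family:
  fixes A :: "'x::real_normed_vector \<Rightarrow> 'a::euclidean_space \<Rightarrow> 'b::real_normed_vector"
  assumes S: "open S" and x: "x \<in> S" and lin: "\<And>x. x \<in> S \<Longrightarrow> linear (A x)"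
    and d: "\<And>w. (\<lambda>x. A x w) differentiable (at x)" and h: "(h has_derivative h') (at x)"
    and that: "x0 = x"
  shows "((\<lambda>x. A x (h x)) has_derivative
    (\<lambda>v. frechet_derivative (\<lambda>x. A x (h x0)) (at x) v + A x (h' v))) (at x)"
proof (rule has_derivative_transform_within_open[OF _ S x])
  show "(\<Sum>b\<in>Basis. (h x \<bullet> b) *\<^sub>R A x b) = A x (h x)" if "x \<in> S" for x
    using linear_sum_Basis[OF lin[OF that], of "h x"] by simp
  note dA = d[unfolded frechet_derivative_works]
  have "((\<lambda>x. \<Sum>b\<in>Basis. (h x \<bullet> b) *\<^sub>R A x b) has_derivative
      (\<lambda>v. \<Sum>b\<in>Basis. (h x \<bullet> b) *\<^sub>R frechet_derivative (\<lambda>x. A x b) (at x) v + (h' v \<bullet> b) *\<^sub>R A x b)) (at x)"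
    by (intro has_derivative_sum has_derivative_scaleR dA
        bounded_linear.has_derivative[OF bounded_linear_inner_left h])
  also have "(\<lambda>v. \<Sum>b\<in>Basis. (h x \<bullet> b) *\<^sub>R frechet_derivative (\<lambda>x. A x b) (at x) v + (h' v \<bullet> b) *\<^sub>R A x b)
     = (\<lambda>v. frechet_derivative (\<lambda>x. A x (h x0)) (at x) v + A x (h' v))"
    using linear_sum_Basis[OF lin[OF x], of "h' v" for v]
      linear_sum_Basis[OF linear_frechet_derivative_family[OF S x lin d], of "h x" v for v]
    by (simp add: sum.distrib that)
  finally show "((\<lambda>x. \<Sum>b\<in>Basis. (h x \<bullet> b) *\<^sub>R A x b) has_derivative
      (\<lambda>v. frechet_derivative (\<lambda>x. A x (h x0)) (at x) v + A x (h' v))) (at x)" .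
qed

lemma Ck_on_linear_family:
  fixes A :: "'x::real_normed_vector \<Rightarrow> 'a::euclidean_space \<Rightarrow> 'b::real_normed_vector"
  assumes S: "open S" and lin: "\<And>x. x \<in> S \<Longrightarrow> linear (A x)"
    and A: "\<And>b. b \<in> Basis \<Longrightarrow> Ck_on k S (\<lambda>x. A x b)" and h: "Ck_on k S h"
  shows "Ck_on k S (\<lambda>x. A x (h x))"
proof (rule Ck_on_cong[OF S])
  show "(\<Sum>b\<in>Basis. (h x \<bullet> b) *\<^sub>R A x b) = A x (h x)" if "x \<in> S" for x
    using linear_sum_Basis[OF lin[OF that], of "h x"] by simp
  show "Ck_on k S (\<lambda>x. \<Sum>b\<in>Basis. (h x \<bullet> b) *\<^sub>R A x b)"
    by (intro Ck_on_sum[OF S] Ck_on_bilinear[OF S bounded_bilinear_scaleR] A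
        Ck_on_bounded_linear_compose[OF S bounded_linear_inner_left] h)
qed

text \<open>Induction on the order with f arbitrary: the chain rule writes the derivative as a
  linear family composed with g and evaluated on the derivative of g, and both have one order
  less.\<close>

lemma Ck_on_compose:
  fixes f :: "'b::euclidean_space \<Rightarrow> 'c::real_normed_vector"
  assumes "open S" "open T" "g ` S \<subseteq> T" "Ck_on k S g" "Ck_on k T f"
  shows "Ck_on k S (\<lambda>x. f (g x))"
  using assms(4,5)
proof (induction k arbitrary: f)
  case 0
  then show ?case using continuous_on_compose2 assms(3) by auto
next
  case (Suc k)
  have gT: "g x \<in> T" if "x \<in> S" for x using assms(3) that by auto
  show ?case
  proof (rule Ck_on_SucI[OF assms(1)])
    show "((\<lambda>x. f (g x)) has_derivative
        (\<lambda>v. frechet_derivative f (at (g x)) (frechet_derivative g (at x) v))) (at x)" if "x \<in> S" for x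
      using diff_chain_at[OF Ck_on_imp_has_derivative[OF Suc.prems(1) that]
          Ck_on_imp_has_derivative[OF Suc.prems(2) gT[OF that]]] by (simp add: o_def)
    show "Ck_on k S (\<lambda>x. frechet_derivative f (at (g x)) (frechet_derivative g (at x) v))" for v
    proof (rule Ck_on_linear_family[OF assms(1)])
      show "linear (frechet_derivative f (at (g x)))" if "x \<in> S" for x
        using Suc.prems(2) gT[OF that] by (auto intro: linear_frechet_derivative)
      show "Ck_on k S (\<lambda>x. frechet_derivative f (at (g x)) b)" for b
        by (rule Suc.IH[of "\<lambda>y. frechet_derivative f (at y) b"])
          (rule Suc.prems[THEN Ck_on_SucD] Suc.prems[THEN Ck_on_frechet_derivative])+
      show "Ck_on k S (\<lambda>x. frechet_derivative g (at x) v)" using Suc.prems by auto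
    qed
  qed
qed

section \<open>Inverses of families of linear maps\<close>

lemma linear_inverse_fun:
  assumes "linear A" "\<And>u. B (A u) = u" "\<And>u. A (B u) = u"
  shows "linear B"
proof (rule linearI)
  show "B (u + v) = B u + B v" for u v
    using assms(2)[of "B u + B v"] by (simp add: linear_add[OF assms(1)] assms(3))
  show "B (c *\<^sub>R u) = c *\<^sub>R B u" for c u
    using assms(2)[of "c *\<^sub>R B u"] by (simp add: linear_cmul[OF assms(1)] assms(3))
qed

text \<open>Perturbation argument: if c bounds the inverse \<open>B x\<close>, an invertible map
  within 1/(2c) of \<open>A x\<close> has an inverse bounded by 2c.\<close>

lemma linear_family_inverse_bound:
  fixes A B :: "'x::metric_space \<Rightarrow> 'a::euclidean_space \<Rightarrow> 'a"
  assumes S: "open S" and x: "x \<in> S" and lin: "\<And>x. x \<in> S \<Longrightarrow> linear (A x)"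
    and A: "\<And>b. b \<in> Basis \<Longrightarrow> continuous_on S (\<lambda>x. A x b)"
    and BA: "\<And>x u. x \<in> S \<Longrightarrow> B x (A x u) = u" and AB: "\<And>x u. x \<in> S \<Longrightarrow> A x (B x u) = u"
  obtains d C where "d > 0" "C > 0" "ball x d \<subseteq> S" "\<And>y u. y \<in> ball x d \<Longrightarrow> norm (B y u) \<le> C * norm u"
proof -
  have "linear (B x)"
    using lin[OF x] BA[OF x] AB[OF x] by (rule linear_inverse_fun)
  then obtain c where c: "c > 0" "\<And>u. norm (B x u) \<le> c * norm u"
    using linear_bounded_pos by blast
  \<comment> \<open>There are DIM basis vectors, the image of each may move by e, so
    \<open>A y - A x\<close> has norm at most 1/(2c).\<close>
  define e where "e = 1 / (2 * c * DIM('a))"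
  have e: "e > 0" using c by (simp add: e_def)
  have "\<forall>b\<in>Basis. \<forall>\<^sub>F y in at x. dist (A y b) (A x b) < e"
    using A x S e by (auto simp: continuous_on_eq_continuous_at[OF S] isCont_def tendsto_iff)
  then have "\<forall>\<^sub>F y in at x. \<forall>b\<in>Basis. dist (A y b) (A x b) < e"
    by (simp add: eventually_ball_finite_distrib)
  then have "\<forall>\<^sub>F y in nhds x. \<forall>b\<in>Basis. dist (A y b) (A x b) < e"
    using e by (simp add: eventually_nhds_conv_at)
  then obtain d1 where d1: "d1 > 0" "\<And>y b. dist y x < d1 \<Longrightarrow> b \<in> Basis \<Longrightarrow> dist (A y b) (A x b) < e"
    unfolding eventually_nhds_metric by blast
  obtain d2 where d2: "d2 > 0" "ball x d2 \<subseteq> S" using S x openE by blast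
  show ?thesis
  proof (rule that[of "min d1 d2" "2 * c"])
    fix y u assume y: "y \<in> ball x (min d1 d2)"
    then have yS: "y \<in> S" using d2 by auto
    define w where "w = B y u"
    have u: "u = A y w" using AB[OF yS] by (simp add: w_def)
    have l: "linear (\<lambda>w. A y w - A x w)" using lin[OF yS] lin[OF x] by (rule linear_compose_sub)
    have "norm (A y w - A x w) = norm (\<Sum>b\<in>Basis. (w \<bullet> b) *\<^sub>R (A y b - A x b))"
      using linear_sum_Basis[OF l, of w] by simp
    also have "\<dots> \<le> (\<Sum>b\<in>(Basis::'a set). norm w * e)"
    proof (rule sum_norm_le)
      fix b :: 'a assume b: "b \<in> Basis"
      show "norm ((w \<bullet> b) *\<^sub>R (A y b - A x b)) \<le> norm w * e"
        using d1(2)[of y b] y b by (auto simp: dist_commute dist_norm[symmetric] Basis_le_norm intro!: mult_mono)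
    qed
    also have "\<dots> = norm w / (2 * c)" using c by (simp add: e_def)
    finally have 1: "norm (A y w - A x w) \<le> norm w / (2 * c)" .
    have "norm w = norm (B x (A x w))" using BA[OF x] by simp
    also have "\<dots> \<le> c * norm (A x w)" by (rule c(2))
    also have "\<dots> \<le> c * (norm u + norm w / (2 * c))"
      using c(1) 1 norm_triangle_ineq2[of "A x w" "A y w"] unfolding u
      by (intro mult_left_mono) (auto simp: norm_minus_commute)
    also have "\<dots> = c * norm u + norm w / 2" using c by (simp add: field_simps)
    finally show "norm (B y u) \<le> 2 * c * norm u" by (simp add: w_def)
  qed (use c d1 d2 in auto)
qed

text \<open>Rests on \<open>B y w - B x w = B y (w - A y (B x w))\<close>, where the
  \<open>B y\<close> are uniformly bounded near x.\<close>

lemma tendsto_inverse_family: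
  fixes A B :: "'x::real_normed_vector \<Rightarrow> 'a::euclidean_space \<Rightarrow> 'a"
  assumes S: "open S" and x: "x \<in> S" and lin: "\<And>x. x \<in> S \<Longrightarrow> linear (A x)"
    and A: "\<And>b. b \<in> Basis \<Longrightarrow> continuous_on S (\<lambda>x. A x b)"
    and BA: "\<And>x u. x \<in> S \<Longrightarrow> B x (A x u) = u" and AB: "\<And>x u. x \<in> S \<Longrightarrow> A x (B x u) = u"
  shows "((\<lambda>y. B y w) \<longlongrightarrow> B x w) (at x)"
proof -
  obtain d C where d: "d > 0" "C > 0" "ball x d \<subseteq> S"
    "\<And>y u. y \<in> ball x d \<Longrightarrow> norm (B y u) \<le> C * norm u"
    by (rule linear_family_inverse_bound[where A=A and B=B, OF S x lin A BA AB]) blast+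
  have linB: "linear (B y)" if "y \<in> S" for y
    using lin[OF that] BA[OF that] AB[OF that] by (rule linear_inverse_fun)
  have "continuous_on S (\<lambda>y. A y (B x w))"
    using Ck_on_linear_family[where k=0 and A=A and h="\<lambda>_. B x w", OF S lin] A by (simp add: Ck_on_const)
  then have "((\<lambda>y. A y (B x w)) \<longlongrightarrow> A x (B x w)) (at x)"
    using S x by (simp add: continuous_on_eq_continuous_at isCont_def)
  then have t: "((\<lambda>y. C * norm (w - A y (B x w))) \<longlongrightarrow> C * norm (w - w)) (at x)"
    by (intro tendsto_intros) (simp add: AB[OF x])
  show ?thesis
  proof (rule LIM_zero_cancel, rule Lim_null_comparison)
    have "\<forall>\<^sub>F y in at x. y \<in> ball x d"
      using d by (intro eventually_at_in_open') auto
    then show "\<forall>\<^sub>F y in at x. norm (B y w - B x w) \<le> C * norm (w - A y (B x w))"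
    proof eventually_elim
      case (elim y)
      then have yS: "y \<in> S" using d by auto
      have "B y w - B x w = B y (w - A y (B x w))"
        using BA[OF yS] linB[OF yS] by (simp add: linear_diff)
      then show ?case using d(4)[OF elim] by simp
    qed
    show "((\<lambda>y. C * norm (w - A y (B x w))) \<longlongrightarrow> 0) (at x)" using t by simp
  qed
qed

text \<open>This is d(A^-1) = - A^-1 dA A^-1. The remainder splits into \<open>B y\<close> applied
  to the remainder of A, controlled by the uniform bound, and \<open>B y - B x\<close> applied to
  the increment \<open>D (y - x)\<close>, controlled by the continuity of B.\<close>

lemma has_derivative_inverse_family:
  fixes A B :: "'x::real_normed_vector \<Rightarrow> 'a::euclidean_space \<Rightarrow> 'a"
  assumes S: "open S" and x: "x \<in> S" and lin: "\<And>x. x \<in> S \<Longrightarrow> linear (A x)"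
    and A: "\<And>b. b \<in> Basis \<Longrightarrow> continuous_on S (\<lambda>x. A x b)"
    and BA: "\<And>x u. x \<in> S \<Longrightarrow> B x (A x u) = u" and AB: "\<And>x u. x \<in> S \<Longrightarrow> A x (B x u) = u"
    and D: "((\<lambda>x. A x (B x0 u)) has_derivative D) (at x)" and x0: "x0 = x"
  shows "((\<lambda>x. B x u) has_derivative (\<lambda>v. - B x (D v))) (at x)"
proof -
  obtain d C where d: "d > 0" "C > 0" "ball x d \<subseteq> S"
    "\<And>y u. y \<in> ball x d \<Longrightarrow> norm (B y u) \<le> C * norm u"
    by (rule linear_family_inverse_bound[where A=A and B=B, OF S x lin A BA AB]) blast+
  have linB: "linear (B y)" if "y \<in> S" for y
    using lin[OF that] BA[OF that] AB[OF that] by (rule linear_inverse_fun)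
  have blB: "bounded_linear (B y)" if "y \<in> S" for y
    using linB[OF that] linear_conv_bounded_linear by blast
  note cB = tendsto_inverse_family[where A=A and B=B, OF S x lin A BA AB]
  have blD: "bounded_linear D" using D by (rule has_derivative_bounded_linear)
  show ?thesis
  proof (rule has_derivativeI)
    show "bounded_linear (\<lambda>v. - B x (D v))"
      using bounded_linear_compose[OF blB[OF x] blD] by (simp add: bounded_linear_minus)
    define R where "R y = inverse (norm (y - x)) *\<^sub>R (A y (B x u) - A x (B x u) - D (y - x))" for y
    have "(R \<longlongrightarrow> 0) (at x)"
      using D unfolding R_def x0 has_derivative_at_within by (simp add: inverse_eq_divide)
    then have 1: "((\<lambda>y. C * norm (R y)) \<longlongrightarrow> C * norm (0::'a)) (at x)" by (intro tendsto_intros)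
    define N where "N b = (\<lambda>y. norm (B y b - B x b))" for b
    have "((\<lambda>y. \<Sum>b\<in>Basis. onorm D * N b y) \<longlongrightarrow> (\<Sum>b\<in>(Basis::'a set). onorm D * norm (0::'a))) (at x)"
      unfolding N_def using cB by (intro tendsto_intros) (simp add: LIM_zero)
    from tendsto_add[OF 1 this] have lim: "((\<lambda>y. C * norm (R y) + (\<Sum>b\<in>Basis. onorm D * N b y)) \<longlongrightarrow> 0) (at x)"
      by simp
    have "\<forall>\<^sub>F y in at x. norm (inverse (norm (y - x)) *\<^sub>R (B y u - B x u - - B x (D (y - x))))
        \<le> C * norm (R y) + (\<Sum>b\<in>Basis. onorm D * N b y)"
    proof -
      have "\<forall>\<^sub>F y in at x. y \<in> ball x d"
        using d by (intro eventually_at_in_open') auto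
      then show ?thesis
        using eventually_neq_at_within[of x]
      proof eventually_elim
        case (elim y)
        then have yS: "y \<in> S" using d by auto
        define c where "c = inverse (norm (y - x))"
        have c: "c > 0" using elim by (simp add: c_def)
        have "B y (R y) = c *\<^sub>R (B x u - B y u - B y (D (y - x)))"
          using BA[OF yS] AB[OF x] linB[OF yS] by (simp add: R_def c_def linear_diff linear_cmul)
        then have eq: "c *\<^sub>R (B y u - B x u - - B x (D (y - x)))
            = - B y (R y) - c *\<^sub>R (B y (D (y - x)) - B x (D (y - x)))"
          by (simp add: algebra_simps)
        have l: "linear (\<lambda>w. B y w - B x w)" using linB[OF yS] linB[OF x] by (rule linear_compose_sub)
        have "norm (c *\<^sub>R (B y (D (y - x)) - B x (D (y - x))))
            = norm (\<Sum>b\<in>Basis. (c * (D (y - x) \<bullet> b)) *\<^sub>R (B y b - B x b))"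
          using linear_sum_Basis[OF l, of "D (y - x)"] by (simp add: scaleR_sum_right)
        also have "\<dots> \<le> (\<Sum>b\<in>Basis. onorm D * N b y)"
        proof (rule sum_norm_le)
          fix b :: 'a assume b: "b \<in> Basis"
          have "\<bar>D (y - x) \<bullet> b\<bar> \<le> norm (D (y - x))" by (rule Basis_le_norm[OF b])
          also have "\<dots> \<le> onorm D * norm (y - x)" by (rule onorm[OF blD])
          finally have "c * \<bar>D (y - x) \<bullet> b\<bar> \<le> onorm D"
            using elim by (simp add: c_def field_simps)
          then show "norm ((c * (D (y - x) \<bullet> b)) *\<^sub>R (B y b - B x b)) \<le> onorm D * N b y"
            using c by (simp add: abs_mult N_def mult_right_mono)
        qed
        finally show ?case
          using d(4)[OF elim(1), of "R y"] norm_triangle_ineq4[of "- B y (R y)" "c *\<^sub>R (B y (D (y - x)) - B x (D (y - x)))"]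
          unfolding c_def[symmetric] eq by simp
      qed
    qed
    then have "((\<lambda>y. inverse (norm (y - x)) *\<^sub>R (B y u - B x u - - B x (D (y - x)))) \<longlongrightarrow> 0) (at x)"
      using lim by (rule Lim_null_comparison)
    then show "((\<lambda>y. (B y u - B x u - - B x (D (y - x))) /\<^sub>R norm (y - x)) \<longlongrightarrow> 0) (at x)"
      by simp
  qed
qed

text \<open>Bootstrapping: the derivative of B is again built from B and the derivative of A, so
  order k for B gives order k + 1.\<close>

lemma Ck_on_inverse_family:
  fixes A B :: "'x::real_normed_vector \<Rightarrow> 'a::euclidean_space \<Rightarrow> 'a"
  assumes S: "open S" and lin: "\<And>x. x \<in> S \<Longrightarrow> linear (A x)"
    and A: "\<And>b. Ck_on k S (\<lambda>x. A x b)"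
    and BA: "\<And>x u. x \<in> S \<Longrightarrow> B x (A x u) = u" and AB: "\<And>x u. x \<in> S \<Longrightarrow> A x (B x u) = u"
  shows "Ck_on k S (\<lambda>x. B x u)"
  using A
proof (induction k arbitrary: u)
  case 0
  have "isCont (\<lambda>x. B x u) x" if "x \<in> S" for x
    using tendsto_inverse_family[where A=A and B=B, OF S that lin _ BA AB] 0 by (simp add: isCont_def)
  then show ?case by (simp add: continuous_at_imp_continuous_on)
next
  case (Suc k)
  have Ak: "Ck_on k S (\<lambda>x. A x b)" for b using Suc.prems by (rule Ck_on_SucD)
  have linB: "linear (B y)" if "y \<in> S" for y
    using lin[OF that] BA[OF that] AB[OF that] by (rule linear_inverse_fun)
  have dA: "((\<lambda>x. A x w) has_derivative frechet_derivative (\<lambda>x. A x w) (at x)) (at x)" if "x \<in> S" for x w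
    using Suc.prems that by (rule Ck_on_imp_has_derivative)
  define DA where "DA x v w = frechet_derivative (\<lambda>x. A x w) (at x) v" for x v w
  have linDA: "linear (DA x v)" if x: "x \<in> S" for x v
    using linear_frechet_derivative_family[where A=A, OF S x lin differentiableI[OF dA[OF x]]]
    by (simp add: DA_def[abs_def])
  show ?case
  proof (rule Ck_on_SucI[OF S])
    show "((\<lambda>x. B x u) has_derivative (\<lambda>v. - B x (DA x v (B x u)))) (at x)" if x: "x \<in> S" for x
      unfolding DA_def
      by (rule has_derivative_inverse_family[OF S x lin _ BA AB dA[OF x] refl])
        (use Ak Ck_on_imp_continuous in auto)
    show "Ck_on k S (\<lambda>x. - B x (DA x v (B x u)))" for v
    proof (rule Ck_on_bounded_linear_compose[OF S bounded_linear_minus[OF bounded_linear_ident]])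
      have 1: "Ck_on k S (\<lambda>x. B x u)" for u by (rule Suc.IH[OF Ak])
      have "Ck_on k S (\<lambda>x. DA x v b)" for b
        unfolding DA_def by (rule Ck_on_frechet_derivative[OF Suc.prems])
      from Ck_on_linear_family[OF S linDA this 1]
      have 2: "Ck_on k S (\<lambda>x. DA x v (B x u))" .
      show "Ck_on k S (\<lambda>x. B x (DA x v (B x u)))"
        by (rule Ck_on_linear_family[where A=B, OF S linB 1 2])
    qed
  qed
qed

text \<open>Both sides are limits of the same second difference quotient.\<close>

lemma second_derivative_symmetric_real:
  fixes f :: "'a::real_normed_vector \<Rightarrow> real"
  assumes S: "open S" "x \<in> S" and C2: "Ck_on (Suc (Suc 0)) S f"
  shows "frechet_derivative (\<lambda>y. frechet_derivative f (at y) v) (at x) w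
       = frechet_derivative (\<lambda>y. frechet_derivative f (at y) w) (at x) v"
proof -
  define D where "D v y = frechet_derivative f (at y) v" for v y
  define H where "H v w y = frechet_derivative (D v) (at y) w" for v w y
  have df: "(f has_derivative (\<lambda>v. D v y)) (at y)" if "y \<in> S" for y
    using Ck_on_imp_has_derivative[OF C2 that] by (simp add: D_def)
  have dD: "(D v has_derivative (\<lambda>w. H v w y)) (at y)" if "y \<in> S" for v y
    unfolding H_def D_def by (rule Ck_on_imp_has_derivative[OF Ck_on_frechet_derivative[OF C2] that])
  have cH: "continuous_on S (H v w)" for v w
    using C2 unfolding H_def D_def by simp
  obtain r where r: "r > 0" "ball x r \<subseteq> S" using S openE by blast
  \<comment> \<open>Mean value theorem twice, first along v for the difference in the direction w,
    then along w: the second difference is h^2 times a mixed derivative at a nearby point.\<close>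
  have key: "\<exists>y. dist x y < e \<and> f (x + h *\<^sub>R v + h *\<^sub>R w) - f (x + h *\<^sub>R v) - f (x + h *\<^sub>R w) + f x = h * h * H v w y"
    if e: "0 < h" "h * (norm v + norm w) < e" "e \<le> r" for v w e h
  proof -
    have inS: "x + a *\<^sub>R v + b *\<^sub>R w \<in> S" "dist x (x + a *\<^sub>R v + b *\<^sub>R w) < e"
      if "0 \<le> a" "a \<le> h" "0 \<le> b" "b \<le> h" for a b
    proof -
      have "norm (a *\<^sub>R v + b *\<^sub>R w) \<le> \<bar>a\<bar> * norm v + \<bar>b\<bar> * norm w"
        using norm_triangle_ineq[of "a *\<^sub>R v" "b *\<^sub>R w"] by simp
      also have "\<dots> \<le> h * norm v + h * norm w"
        using that by (intro add_mono mult_right_mono) auto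
      finally show 2: "dist x (x + a *\<^sub>R v + b *\<^sub>R w) < e" using e by (simp add: dist_norm algebra_simps norm_minus_commute)
      show "x + a *\<^sub>R v + b *\<^sub>R w \<in> S" using 2 e r by auto
    qed
    have d1: "((\<lambda>s. f (x + s *\<^sub>R v + h *\<^sub>R w) - f (x + s *\<^sub>R v)) has_derivative
        (\<lambda>t. t * (D v (x + s *\<^sub>R v + h *\<^sub>R w) - D v (x + s *\<^sub>R v)))) (at s)" if "0 \<le> s" "s \<le> h" for s
    proof -
      have a: "((\<lambda>s. x + s *\<^sub>R v + h *\<^sub>R w) has_derivative (\<lambda>t. t *\<^sub>R v)) (at s)"
        "((\<lambda>s. x + s *\<^sub>R v) has_derivative (\<lambda>t. t *\<^sub>R v)) (at s)"
        by (auto intro!: derivative_eq_intros)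
      have lin: "linear (\<lambda>v. D v y)" if "y \<in> S" for y using df[OF that] has_derivative_linear by blast
      have "x + s *\<^sub>R v + h *\<^sub>R w \<in> S" "x + s *\<^sub>R v \<in> S" using inS(1)[of s h] inS(1)[of s 0] that e by auto
      note b = df[OF this(1)] df[OF this(2)] lin[OF this(1)] lin[OF this(2)]
      show ?thesis
        using has_derivative_diff[OF diff_chain_at[OF a(1) b(1)] diff_chain_at[OF a(2) b(2)]]
        by (simp only: o_def linear_cmul[OF b(3)] linear_cmul[OF b(4)] right_diff_distrib real_scaleR_def)
    qed
    have c1: "continuous_on {0..h} (\<lambda>s. f (x + s *\<^sub>R v + h *\<^sub>R w) - f (x + s *\<^sub>R v))"
      by (rule continuous_at_imp_continuous_on) (use has_derivative_continuous[OF d1] in auto)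
    obtain s where s: "s \<in> {0<..<h}" "(f (x + h *\<^sub>R v + h *\<^sub>R w) - f (x + h *\<^sub>R v)) - (f (x + 0 *\<^sub>R v + h *\<^sub>R w) - f (x + 0 *\<^sub>R v))
        = (h - 0) * (D v (x + s *\<^sub>R v + h *\<^sub>R w) - D v (x + s *\<^sub>R v))"
      using mvt[OF e(1) c1 d1] by auto
    then have s: "0 < s" "s < h" "f (x + h *\<^sub>R v + h *\<^sub>R w) - f (x + h *\<^sub>R v) - f (x + h *\<^sub>R w) + f x
        = h * (D v (x + s *\<^sub>R v + h *\<^sub>R w) - D v (x + s *\<^sub>R v))" by simp_all
    have d2: "((\<lambda>t. D v (x + s *\<^sub>R v + t *\<^sub>R w)) has_derivative (\<lambda>u. u * H v w (x + s *\<^sub>R v + t *\<^sub>R w))) (at t)"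
      if "0 \<le> t" "t \<le> h" for t
    proof -
      have a: "((\<lambda>t. x + s *\<^sub>R v + t *\<^sub>R w) has_derivative (\<lambda>u. u *\<^sub>R w)) (at t)"
        by (auto intro!: derivative_eq_intros)
      have y: "x + s *\<^sub>R v + t *\<^sub>R w \<in> S" using inS(1)[of s t] that s by auto
      show ?thesis
        using diff_chain_at[OF a dD[OF y, of v]]
        by (simp only: o_def linear_cmul[OF has_derivative_linear[OF dD[OF y]]] real_scaleR_def)
    qed
    have c2: "continuous_on {0..h} (\<lambda>t. D v (x + s *\<^sub>R v + t *\<^sub>R w))"
      by (rule continuous_at_imp_continuous_on) (use has_derivative_continuous[OF d2] in auto)
    obtain t where "t \<in> {0<..<h}"
      "D v (x + s *\<^sub>R v + h *\<^sub>R w) - D v (x + s *\<^sub>R v + 0 *\<^sub>R w) = (h - 0) * H v w (x + s *\<^sub>R v + t *\<^sub>R w)"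
      using mvt[OF e(1) c2 d2] by auto
    then have t: "0 < t" "t < h"
      "D v (x + s *\<^sub>R v + h *\<^sub>R w) - D v (x + s *\<^sub>R v) = h * H v w (x + s *\<^sub>R v + t *\<^sub>R w)" by simp_all
    show ?thesis
      using inS(2)[of s t] s t by (intro exI[of _ "x + s *\<^sub>R v + t *\<^sub>R w"]) auto
  qed
  have "\<bar>H v w x - H w v x\<bar> \<le> e" if "e > 0" for e
  proof -
    have "isCont (H v w) x" "isCont (H w v) x" using cH S continuous_on_eq_continuous_at by blast+
    then obtain d1 d2 where d: "d1 > 0" "\<And>y. dist y x < d1 \<Longrightarrow> dist (H v w y) (H v w x) < e/2"
      "d2 > 0" "\<And>y. dist y x < d2 \<Longrightarrow> dist (H w v y) (H w v x) < e/2"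
      using half_gt_zero[OF \<open>e > 0\<close>] unfolding continuous_at_eps_delta by blast
    define d' where "d' = min r (min d1 d2)"
    have d': "d' > 0" using d r by (simp add: d'_def)
    \<comment> \<open>The summand 1 keeps the denominator positive when v = w = 0; the factor 2
      leaves room for a strict inequality.\<close>
    define h where "h = d' / (2 * (norm v + norm w + 1))"
    have h0: "norm v + norm w + 1 > 0" by (simp add: add_nonneg_pos)
    have h: "h > 0" using d' h0 by (simp add: h_def)
    have "h * (norm v + norm w) \<le> h * (norm v + norm w + 1)" using h by simp
    also have "\<dots> = d' / 2" using h0 by (simp add: h_def field_simps)
    finally have h2: "h * (norm v + norm w) < d'" using d' by simp
    then have h3: "h * (norm w + norm v) < d'" by (simp add: algebra_simps)
    obtain y where y: "dist x y < d'" "f (x + h *\<^sub>R v + h *\<^sub>R w) - f (x + h *\<^sub>R v) - f (x + h *\<^sub>R w) + f x = h * h * H v w y"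
      using key[OF h h2] by (auto simp: d'_def)
    obtain z where z: "dist x z < d'" "f (x + h *\<^sub>R w + h *\<^sub>R v) - f (x + h *\<^sub>R w) - f (x + h *\<^sub>R v) + f x = h * h * H w v z"
      using key[OF h h3] by (auto simp: d'_def)
    have "h * h * H v w y = h * h * H w v z" using y(2) z(2) by (simp add: algebra_simps)
    then have "H v w y = H w v z" using h by simp
    then show ?thesis using d(2)[of y] d(4)[of z] y(1) z(1) by (auto simp: d'_def dist_commute dist_real_def abs_if split: if_splits)
  qed
  then have "\<bar>H v w x - H w v x\<bar> \<le> 0" using field_le_epsilon[of "\<bar>H v w x - H w v x\<bar>" 0] by simp
  then show ?thesis by (simp add: H_def D_def[abs_def])
qed

lemma second_derivative_symmetric:
  fixes f :: "'a::real_normed_vector \<Rightarrow> 'b::euclidean_space"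
  assumes S: "open S" "x \<in> S" and C2: "Ck_on (Suc (Suc 0)) S f"
  shows "frechet_derivative (\<lambda>y. frechet_derivative f (at y) v) (at x) w
       = frechet_derivative (\<lambda>y. frechet_derivative f (at y) w) (at x) v"
proof (rule euclidean_eqI)
  fix b :: 'b assume "b \<in> Basis"
  have 1: "frechet_derivative (\<lambda>z. f z \<bullet> b) (at y) v = frechet_derivative f (at y) v \<bullet> b" if "y \<in> S" for y v
    by (simp add: frechet_derivative_eq[OF
          bounded_linear.has_derivative[OF bounded_linear_inner_left Ck_on_imp_has_derivative[OF C2 that]]])
  have 2: "frechet_derivative (\<lambda>y. frechet_derivative (\<lambda>z. f z \<bullet> b) (at y) v) (at x) w
      = frechet_derivative (\<lambda>y. frechet_derivative f (at y) v) (at x) w \<bullet> b" for v w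
  proof -
    have "((\<lambda>y. frechet_derivative f (at y) v) has_derivative
        frechet_derivative (\<lambda>y. frechet_derivative f (at y) v) (at x)) (at x)"
      by (rule Ck_on_imp_has_derivative[OF Ck_on_frechet_derivative[OF C2] S(2)])
    then have "((\<lambda>y. frechet_derivative f (at y) v \<bullet> b) has_derivative
        (\<lambda>w. frechet_derivative (\<lambda>y. frechet_derivative f (at y) v) (at x) w \<bullet> b)) (at x)"
      by (rule bounded_linear.has_derivative[OF bounded_linear_inner_left])
    then have "((\<lambda>y. frechet_derivative (\<lambda>z. f z \<bullet> b) (at y) v) has_derivative
        (\<lambda>w. frechet_derivative (\<lambda>y. frechet_derivative f (at y) v) (at x) w \<bullet> b)) (at x)"
      by (rule has_derivative_transform_within_open[OF _ S]) (simp add: 1)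
    then show ?thesis by (simp add: frechet_derivative_eq)
  qed
  have "Ck_on (Suc (Suc 0)) S (\<lambda>z. f z \<bullet> b)"
    by (rule Ck_on_bounded_linear_compose[OF S(1) bounded_linear_inner_left C2])
  from second_derivative_symmetric_real[OF S this, of v w]
  show "frechet_derivative (\<lambda>y. frechet_derivative f (at y) v) (at x) w \<bullet> b
     = frechet_derivative (\<lambda>y. frechet_derivative f (at y) w) (at x) v \<bullet> b"
    by (simp only: 2)
qed

section \<open>Holomorphic maps are smooth\<close>

lemma holoD:
  assumes "holo I I' f S" "x \<in> S"
  shows "(f has_derivative frechet_derivative f (at x)) (at x)"
    and "frechet_derivative f (at x) (I v) = I' (frechet_derivative f (at x) v)"
proof -
  obtain D where D: "(f has_derivative D) (at x)" "\<And>v. D (I v) = I' (D v)"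
    using assms by (auto simp: holo_def)
  then show "(f has_derivative frechet_derivative f (at x)) (at x)"
    "frechet_derivative f (at x) (I v) = I' (frechet_derivative f (at x) v)"
    by (simp_all add: frechet_derivative_eq)
qed

lemma holoI:
  assumes "\<And>x. x \<in> S \<Longrightarrow> (f has_derivative D x) (at x)" "\<And>x v. x \<in> S \<Longrightarrow> D x (I v) = I' (D x v)"
  shows "holo I I' f S"
  using assms by (force simp: holo_def)

lemma holo_subset: "holo I I' f S \<Longrightarrow> T \<subseteq> S \<Longrightarrow> holo I I' f T"
  by (auto simp: holo_def)

lemma holo_cong:
  assumes "open S" "\<And>x. x \<in> S \<Longrightarrow> f x = g x" "holo I I' f S"
  shows "holo I I' g S"
proof (rule holoI)
  show "(g has_derivative frechet_derivative f (at x)) (at x)" if "x \<in> S" for x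
    using holoD(1)[OF assms(3) that] by (rule has_derivative_transform_within_open[OF _ assms(1) that]) (rule assms(2))
qed (rule holoD(2)[OF assms(3)])

lemma holo_continuous_on: "holo I I' f S \<Longrightarrow> continuous_on S f"
  by (rule continuous_at_imp_continuous_on) (auto intro: has_derivative_continuous holoD(1))

lemma holo_compose:
  assumes "holo I I' f S" "holo I' I'' g T" "f ` S \<subseteq> T"
  shows "holo I I'' (\<lambda>x. g (f x)) S"
proof (rule holoI)
  fix x assume x: "x \<in> S"
  then have fx: "f x \<in> T" using assms by auto
  show "((\<lambda>x. g (f x)) has_derivative
      (\<lambda>v. frechet_derivative g (at (f x)) (frechet_derivative f (at x) v))) (at x)"
    using diff_chain_at[OF holoD(1)[OF assms(1) x] holoD(1)[OF assms(2) fx]] by (simp add: o_def)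
  show "frechet_derivative g (at (f x)) (frechet_derivative f (at x) (I v))
      = I'' (frechet_derivative g (at (f x)) (frechet_derivative f (at x) v))" for v
    by (simp add: holoD(2)[OF assms(1) x] holoD(2)[OF assms(2) fx])
qed

text \<open>Restriction to the line x + \<zeta> v, with the imaginary unit acting through I, brings
  one-variable complex analysis to bear.\<close>

lemma holo_along_complex_line:
  fixes f :: "'a::real_normed_vector \<Rightarrow> complex"
  assumes f: "(f has_derivative D) (at (x + (Re \<zeta> *\<^sub>R v + Im \<zeta> *\<^sub>R I v)))" and D: "\<And>v. D (I v) = \<i> * D v"
  shows "((\<lambda>\<zeta>. f (x + (Re \<zeta> *\<^sub>R v + Im \<zeta> *\<^sub>R I v))) has_field_derivative D v) (at \<zeta>)"
proof -
  have lin: "linear D" using f by (rule has_derivative_linear)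
  have "((\<lambda>\<zeta>. x + (Re \<zeta> *\<^sub>R v + Im \<zeta> *\<^sub>R I v)) has_derivative (\<lambda>h. Re h *\<^sub>R v + Im h *\<^sub>R I v)) (at \<zeta>)"
    by (auto intro!: derivative_eq_intros)
  from diff_chain_at[OF this f]
  have "((\<lambda>\<zeta>. f (x + (Re \<zeta> *\<^sub>R v + Im \<zeta> *\<^sub>R I v))) has_derivative (\<lambda>h. D (Re h *\<^sub>R v + Im h *\<^sub>R I v))) (at \<zeta>)"
    by (simp add: o_def)
  moreover have "D (Re h *\<^sub>R v + Im h *\<^sub>R I v) = D v * h" for h
    by (simp add: linear_add[OF lin] linear_cmul[OF lin] D complex_eq_iff)
  ultimately show ?thesis by (simp add: has_field_derivative_def)
qed

text \<open>The kernel comes from the parametrization of the circle of radius \<open>r\<close> in Cauchy's formula.\<close>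

lemma Cauchy_directional_derivative:
  fixes f :: "'a::real_normed_vector \<Rightarrow> complex"
  assumes r: "r > 0" and hol: "\<And>\<zeta>. norm \<zeta> \<le> r \<Longrightarrow> x + (Re \<zeta> *\<^sub>R v + Im \<zeta> *\<^sub>R I v) \<in> S"
    and f: "holo I ((*) \<i>) f S"
  fixes c :: "real \<Rightarrow> complex"
  defines "c \<equiv> circlepath 0 r"
  shows "frechet_derivative f (at x) v = integral {0..1} (\<lambda>t. f (x + (Re (c t) *\<^sub>R v + Im (c t) *\<^sub>R I v))
           * (2 * pi * \<i> * r * exp (2 * pi * \<i> * t) / (c t)\<^sup>2 / (2 * pi * \<i>)))"
proof -
  define g where "g \<zeta> = f (x + (Re \<zeta> *\<^sub>R v + Im \<zeta> *\<^sub>R I v))" for \<zeta>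
  have g: "(g has_field_derivative frechet_derivative f (at (x + (Re \<zeta> *\<^sub>R v + Im \<zeta> *\<^sub>R I v))) v) (at \<zeta>)"
    if "norm \<zeta> \<le> r" for \<zeta>
    unfolding g_def using holoD[OF f hol[OF that]] by (rule holo_along_complex_line)
  have "continuous_on (cball 0 r) g"
    using g by (intro continuous_at_imp_continuous_on ballI DERIV_isCont) (auto simp: dist_norm)
  moreover have "g holomorphic_on ball 0 r"
    unfolding holomorphic_on_open[OF open_ball] using g by (force intro: less_imp_le)
  ultimately have "(g has_field_derivative (1 / (2 * of_real pi * \<i>)
      * contour_integral (circlepath 0 r) (\<lambda>u. g u / (u - 0)\<^sup>2))) (at 0)"
    using r by (intro Cauchy_derivative_integral_circlepath(2)) auto
  with g[of 0] r have "frechet_derivative f (at x) v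
      = 1 / (2 * of_real pi * \<i>) * contour_integral (circlepath 0 r) (\<lambda>u. g u / (u - 0)\<^sup>2)"
    by (auto dest: DERIV_unique)
  also have "\<dots> = 1 / (2 * of_real pi * \<i>)
      * integral {0..1} (\<lambda>t. g (c t) / (c t)\<^sup>2 * vector_derivative (circlepath 0 r) (at t))"
    by (simp add: contour_integral_integral c_def)
  also have "integral {0..1} (\<lambda>t. g (c t) / (c t)\<^sup>2 * vector_derivative (circlepath 0 r) (at t))
      = integral {0..1} (\<lambda>t. g (c t) / (c t)\<^sup>2 * (2 * pi * \<i> * r * exp (2 * pi * \<i> * t)))"
    by (intro integral_cong) (simp add: vector_derivative_circlepath)
  finally show ?thesis
    by (simp add: g_def integral_mult_right[symmetric] field_simps del: integral_mult_right)
qed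

text \<open>Near a point, the derivative in direction v is a Cauchy integral of f over translates of
  one fixed circle. Differentiation under the integral sign makes it differentiable again, with a
  complex linear derivative because every integrand has one.\<close>

lemma holo_frechet_derivative_complex:
  fixes f :: "'a::euclidean_space \<Rightarrow> complex"
  assumes S: "open S" and I: "linear I" and f: "holo I ((*) \<i>) f S"
  shows "holo I ((*) \<i>) (\<lambda>x. frechet_derivative f (at x) v) S"
proof -
  define K :: "real \<Rightarrow> real \<Rightarrow> complex"
    where "K r t = 2 * pi * \<i> * r * exp (2 * pi * \<i> * t) / (circlepath 0 r t)\<^sup>2 / (2 * pi * \<i>)" for r t
  define c where "c r v t = Re (circlepath 0 r t) *\<^sub>R v + Im (circlepath 0 r t) *\<^sub>R I v" for r v t
  define D where "D x v = frechet_derivative f (at x) v" for x v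
  note contf = holo_continuous_on[OF f]
  have cK: "continuous_on U (\<lambda>x. K r (g x))" if "r > 0" "continuous_on U g" for U :: "('a \<times> real) set" and r g
    using that unfolding K_def circlepath by (auto intro!: continuous_intros)
  have cc: "continuous_on U (\<lambda>x. c r v (g x))" if "continuous_on U g" for U :: "('a \<times> real) set" and r g v
    using that unfolding c_def circlepath by (auto intro!: continuous_intros)
  \<comment> \<open>One radius r has to serve all x near x0, so that the integral representation can
    be differentiated in x.\<close>
  have loc: "\<exists>r>0. \<exists>d>0. (\<forall>x\<in>ball x0 d. \<forall>\<zeta>. norm \<zeta> \<le> r \<longrightarrow> x + (Re \<zeta> *\<^sub>R v + Im \<zeta> *\<^sub>R I v) \<in> S) \<and> ball x0 d \<subseteq> S"
    if x0: "x0 \<in> S" for x0 v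
  proof -
    obtain e where e: "e > 0" "ball x0 e \<subseteq> S" by (rule openE[OF S x0])
    define m where "m = norm v + norm (I v) + 1"
    define r where "r = e / 2 / m"
    have p: "m > 0" by (simp add: m_def add_nonneg_pos)
    have r: "r > 0" using e p by (simp add: r_def)
    have "x + (Re \<zeta> *\<^sub>R v + Im \<zeta> *\<^sub>R I v) \<in> S" if x: "x \<in> ball x0 (e/2)" and z: "norm \<zeta> \<le> r" for x \<zeta>
    proof -
      have "norm (Re \<zeta> *\<^sub>R v + Im \<zeta> *\<^sub>R I v) \<le> \<bar>Re \<zeta>\<bar> * norm v + \<bar>Im \<zeta>\<bar> * norm (I v)"
        using norm_triangle_ineq[of "Re \<zeta> *\<^sub>R v" "Im \<zeta> *\<^sub>R I v"] by simp
      also have "\<dots> \<le> r * norm v + r * norm (I v)"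
        using abs_Re_le_cmod[of \<zeta>] abs_Im_le_cmod[of \<zeta>] z by (intro add_mono mult_right_mono) auto
      also have "\<dots> \<le> r * m" using r by (simp add: m_def algebra_simps)
      also have "\<dots> = e / 2" using p by (simp add: r_def)
      finally have "dist x0 (x + (Re \<zeta> *\<^sub>R v + Im \<zeta> *\<^sub>R I v)) < e"
        using x norm_triangle_ineq4[of "x0 - x" "Re \<zeta> *\<^sub>R v + Im \<zeta> *\<^sub>R I v"] by (simp add: dist_norm diff_diff_eq)
      then show ?thesis using e by auto
    qed
    then show ?thesis using r e by (intro exI[of _ r] conjI exI[of _ "e/2"]) auto
  qed
  have circ: "norm (circlepath 0 r t) = r" if "r > 0" for r t
    using that by (simp add: circlepath norm_mult norm_exp_eq_Re)
  have eq: "D x v = integral (cbox 0 1) (\<lambda>t. f (x + c r v t) * K r t)"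
    if "r > 0" "\<And>\<zeta>. norm \<zeta> \<le> r \<Longrightarrow> x + (Re \<zeta> *\<^sub>R v + Im \<zeta> *\<^sub>R I v) \<in> S" for x v r
    using Cauchy_directional_derivative[OF that f] by (simp add: D_def c_def K_def cbox_interval)
  \<comment> \<open>Continuity of the derivative comes first, since the Leibniz rule below asks for
    a continuous derivative of the integrand.\<close>
  have contD: "continuous_on S (\<lambda>x. D x v)" for v
  proof (rule continuous_at_imp_continuous_on, rule ballI)
    fix x0 assume "x0 \<in> S"
    then obtain r d where r: "r > 0" and d: "d > 0" "ball x0 d \<subseteq> S"
      and in_S: "\<And>x \<zeta>. x \<in> ball x0 d \<Longrightarrow> norm \<zeta> \<le> r \<Longrightarrow> x + (Re \<zeta> *\<^sub>R v + Im \<zeta> *\<^sub>R I v) \<in> S"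
      using loc[of x0 v] by blast
    have "continuous_on (ball x0 d) (\<lambda>x. integral (cbox 0 1) (\<lambda>t. f (x + c r v t) * K r t))"
    proof (rule integral_continuous_on_param)
      have "(\<lambda>p. fst p + c r v (snd p)) ` (ball x0 d \<times> cbox 0 1) \<subseteq> S"
        using in_S circ[OF r] by (force simp: c_def)
      then show "continuous_on (ball x0 d \<times> cbox 0 1) (\<lambda>(x, t). f (x + c r v t) * K r t)"
        unfolding split_beta
        by (intro continuous_on_mult cK[OF r] continuous_on_compose2[OF contf] continuous_on_add cc continuous_on_fst
            continuous_on_snd continuous_on_id)
    qed
    then have "continuous_on (ball x0 d) (\<lambda>x. D x v)"
      by (rule continuous_on_eq) (simp add: eq[OF r in_S])
    then show "isCont (\<lambda>x. D x v) x0" using d by (simp add: continuous_on_eq_continuous_at)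
  qed
  show ?thesis
    unfolding holo_def
  proof
    fix x0 assume x0: "x0 \<in> S"
    then obtain r d where r: "r > 0" and d: "d > 0" "ball x0 d \<subseteq> S"
      and in_S: "\<And>x \<zeta>. x \<in> ball x0 d \<Longrightarrow> norm \<zeta> \<le> r \<Longrightarrow> x + (Re \<zeta> *\<^sub>R v + Im \<zeta> *\<^sub>R I v) \<in> S"
      using loc[of x0 v] by blast
    have in_S': "x + c r v t \<in> S" if "x \<in> ball x0 d" for x t
      using in_S[OF that, of "circlepath 0 r t"] circ[OF r] by (simp add: c_def)
    then have im: "(\<lambda>p. fst p + c r v (snd p)) ` (ball x0 d \<times> cbox 0 1) \<subseteq> S" by auto
    define F where "F x t = Blinfun (\<lambda>w. D (x + c r v t) w * K r t)" for x t
    have F: "blinfun_apply (F x t) = (\<lambda>w. D (x + c r v t) w * K r t)" if "x \<in> ball x0 d" for x t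
      unfolding F_def D_def
      by (intro bounded_linear_Blinfun_apply bounded_linear_mult_const
          has_derivative_bounded_linear[OF holoD(1)[OF f in_S'[OF that]]])
    have "((\<lambda>x. integral (cbox 0 1) (\<lambda>t. f (x + c r v t) * K r t)) has_derivative
        integral (cbox 0 1) (F x0)) (at x0 within ball x0 d)"
    proof (rule leibniz_rule)
      show "((\<lambda>x. f (x + c r v t) * K r t) has_derivative blinfun_apply (F x t)) (at x within ball x0 d)"
        if "x \<in> ball x0 d" for x t
      proof -
        have a: "((\<lambda>x. x + c r v t) has_derivative (\<lambda>w. w)) (at x)"
          by (auto intro!: derivative_eq_intros)
        have "((\<lambda>x. f (x + c r v t)) has_derivative D (x + c r v t)) (at x)"
          using diff_chain_at[OF a holoD(1)[OF f in_S'[OF that]]] by (simp add: o_def D_def[abs_def])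
        then show ?thesis
          unfolding F[OF that] by (rule has_derivative_at_withinI[OF has_derivative_mult_left])
      qed
      show "(\<lambda>t. f (x + c r v t) * K r t) integrable_on cbox 0 1" if "x \<in> ball x0 d" for x
      proof (rule integrable_continuous)
        have "continuous_on ((Pair x) ` cbox 0 1) (\<lambda>p. f (fst p + c r v (snd p)) * K r (snd p))"
          using in_S'[OF that]
          by (intro continuous_on_mult cK[OF r] continuous_on_compose2[OF contf] continuous_on_add cc continuous_on_fst
            continuous_on_snd continuous_on_id) auto
        from continuous_on_compose[OF _ this]
        show "continuous_on (cbox 0 1) (\<lambda>t. f (x + c r v t) * K r t)"
          by (simp add: o_def continuous_on_Pair)
      qed
      show "continuous_on (ball x0 d \<times> cbox 0 1) (\<lambda>(x, t). F x t)"
      proof (rule continuous_on_blinfun_componentwise)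
        fix b :: 'a
        have "continuous_on (ball x0 d \<times> cbox 0 1) (\<lambda>p. D (fst p + c r v (snd p)) b * K r (snd p))"
          using im by (intro continuous_on_mult cK[OF r] continuous_on_compose2[OF contD] continuous_on_add cc continuous_on_fst
            continuous_on_snd continuous_on_id)
        then show "continuous_on (ball x0 d \<times> cbox 0 1) (\<lambda>x. blinfun_apply (case x of (x, t) \<Rightarrow> F x t) b)"
          by (rule continuous_on_eq) (auto simp: F)
      qed
    qed (use d in auto)
    then have "((\<lambda>x. integral (cbox 0 1) (\<lambda>t. f (x + c r v t) * K r t)) has_derivative
        integral (cbox 0 1) (F x0)) (at x0)"
      using d by (simp add: at_within_open[OF _ open_ball])
    then have der: "((\<lambda>x. D x v) has_derivative integral (cbox 0 1) (F x0)) (at x0)"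
      by (rule has_derivative_transform_within_open[OF _ open_ball, of _ _ _ _ x0 d])
        (use d in \<open>auto simp: eq[OF r in_S]\<close>)
    have intF: "F x0 integrable_on cbox 0 1"
    proof (rule integrable_continuous, rule continuous_on_blinfun_componentwise)
      fix b :: 'a
      have "continuous_on ((Pair x0) ` cbox 0 1) (\<lambda>p. D (fst p + c r v (snd p)) b * K r (snd p))"
        using in_S'[of x0] d
        by (intro continuous_on_mult cK[OF r] continuous_on_compose2[OF contD] continuous_on_add cc continuous_on_fst
            continuous_on_snd continuous_on_id) auto
      from continuous_on_compose[OF _ this]
      show "continuous_on (cbox 0 1) (\<lambda>t. F x0 t b)"
        using d by (simp add: o_def continuous_on_Pair F)
    qed
    have ap: "integral (cbox 0 1) (F x0) w = integral (cbox 0 1) (\<lambda>t. F x0 t w)" for w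
      by (rule blinfun_apply_integral[OF intF])
    have FI: "F x0 t (I w) = \<i> * F x0 t w" for t w
      using d by (simp add: F D_def holoD(2)[OF f in_S'] mult.assoc)
    have "integral (cbox 0 1) (F x0) (I w) = \<i> * integral (cbox 0 1) (F x0) w" for w
      unfolding ap FI by simp
    with der show "\<exists>D. ((\<lambda>x. frechet_derivative f (at x) v) has_derivative D) (at x0) \<and> (\<forall>w. D (I w) = \<i> * D w)"
      unfolding D_def by blast
  qed
qed

lemma holo_imp_Ck_on_complex:
  fixes f :: "'a::euclidean_space \<Rightarrow> complex"
  assumes "open S" "linear I" "holo I ((*) \<i>) f S"
  shows "Ck_on k S f"
  using assms(3)
proof (induction k arbitrary: f)
  case (Suc k)
  show ?case
    by (rule Ck_on_SucI[OF assms(1) holoD(1)[OF Suc.prems]])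
      (auto intro: Suc holo_frechet_derivative_complex[OF assms(1,2)])
qed (simp add: holo_continuous_on)

section \<open>Reduction of complex vectors to their components\<close>

lemma vec_eq_sum_axis: "x = (\<Sum>i\<in>UNIV. axis i (x $ i))" for x :: "complex^'n"
  by (simp add: vec_eq_iff axis_def if_distrib cong: if_cong)

lemma bounded_linear_axis: "bounded_linear (axis i :: complex \<Rightarrow> complex^'n)"
  by (rule linear_conv_bounded_linear[THEN iffD1], rule linearI) (simp_all add: vec_eq_iff axis_def)

lemma has_derivative_vec_iff:
  fixes f :: "'a::real_normed_vector \<Rightarrow> complex^'n"
  shows "(f has_derivative D) F \<longleftrightarrow> (\<forall>i. ((\<lambda>x. f x $ i) has_derivative (\<lambda>v. D v $ i)) F)"
proof (intro iffI allI)
  show "((\<lambda>x. f x $ i) has_derivative (\<lambda>v. D v $ i)) F" if "(f has_derivative D) F" for i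
    using that by (rule bounded_linear.has_derivative[OF bounded_linear_vec_nth])
  assume *: "\<forall>i. ((\<lambda>x. f x $ i) has_derivative (\<lambda>v. D v $ i)) F"
  have "((\<lambda>x. \<Sum>i\<in>UNIV. axis i (f x $ i)) has_derivative (\<lambda>v. \<Sum>i\<in>UNIV. axis i (D v $ i))) F"
    using * by (intro has_derivative_sum bounded_linear.has_derivative[OF bounded_linear_axis]) auto
  then show "(f has_derivative D) F" by (simp flip: vec_eq_sum_axis)
qed

lemma holo_vec_iff:
  fixes f :: "'a::real_normed_vector \<Rightarrow> complex^'n"
  shows "holo I imul f S \<longleftrightarrow> (\<forall>i. holo I ((*) \<i>) (\<lambda>x. f x $ i) S)"
proof (intro iffI allI)
  show "holo I ((*) \<i>) (\<lambda>x. f x $ i) S" if f: "holo I imul f S" for i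
  proof (rule holoI)
    show "((\<lambda>x. f x $ i) has_derivative (\<lambda>v. frechet_derivative f (at x) v $ i)) (at x)" if "x \<in> S" for x
      by (rule bounded_linear.has_derivative[OF bounded_linear_vec_nth holoD(1)[OF f that]])
  qed (simp add: holoD(2)[OF f] imul_def)
  assume *: "\<forall>i. holo I ((*) \<i>) (\<lambda>x. f x $ i) S"
  show "holo I imul f S"
  proof (rule holoI)
    show "(f has_derivative (\<lambda>v. \<chi> i. frechet_derivative (\<lambda>x. f x $ i) (at x) v)) (at x)" if "x \<in> S" for x
      unfolding has_derivative_vec_iff using holoD(1)[OF *[rule_format] that] by simp
    show "(\<chi> i. frechet_derivative (\<lambda>x. f x $ i) (at x) (I v)) = imul (\<chi> i. frechet_derivative (\<lambda>x. f x $ i) (at x) v)"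
      if "x \<in> S" for x v
      using holoD(2)[OF *[rule_format] that] by (simp add: imul_def vec_eq_iff)
  qed
qed

lemma Ck_on_vec:
  fixes f :: "'a::real_normed_vector \<Rightarrow> complex^'n"
  assumes "open S" "\<And>i. Ck_on k S (\<lambda>x. f x $ i)"
  shows "Ck_on k S f"
proof -
  have "Ck_on k S (\<lambda>x. \<Sum>i\<in>UNIV. axis i (f x $ i))"
    by (intro Ck_on_sum[OF assms(1)] Ck_on_bounded_linear_compose[OF assms(1) bounded_linear_axis] assms(2))
  then show ?thesis by (simp flip: vec_eq_sum_axis)
qed

lemma holo_imp_Ck_on:
  fixes f :: "'a::euclidean_space \<Rightarrow> complex^'n"
  assumes "open S" "linear I" "holo I imul f S"
  shows "Ck_on k S f"
  using assms by (intro Ck_on_vec holo_imp_Ck_on_complex) (auto simp: holo_vec_iff)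

lemma holo_frechet_derivative:
  fixes f :: "'a::euclidean_space \<Rightarrow> complex^'n"
  assumes S: "open S" and I: "linear I" and f: "holo I imul f S"
  shows "holo I imul (\<lambda>x. frechet_derivative f (at x) v) S"
  unfolding holo_vec_iff
proof
  fix i
  have fi: "holo I ((*) \<i>) (\<lambda>x. f x $ i) S" using f by (simp add: holo_vec_iff)
  show "holo I ((*) \<i>) (\<lambda>x. frechet_derivative f (at x) v $ i) S"
  proof (rule holo_cong[OF S])
    show "frechet_derivative (\<lambda>x. f x $ i) (at x) v = frechet_derivative f (at x) v $ i" if "x \<in> S" for x
      by (simp add: frechet_derivative_eq[OF bounded_linear.has_derivative[OF bounded_linear_vec_nth holoD(1)[OF f that]]])
  qed (rule holo_frechet_derivative_complex[OF S I fi])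
qed


section \<open>Parallel sections of flat connections\<close>

lemma norm_integral_le:
  fixes f :: "real \<Rightarrow> 'a::euclidean_space"
  assumes "\<And>t. t \<in> {0..1} \<Longrightarrow> norm (f t) \<le> B"
  shows "norm (integral {0..1} f) \<le> B"
proof -
  have B: "B \<ge> 0" using order_trans[OF norm_ge_zero assms[of 0]] by simp
  show ?thesis
  proof (cases "f integrable_on {0..1}")
    case True
    then show ?thesis
      using integral_norm_bound_integral[OF True integrable_const_ivl, of B] assms by simp
  \<comment> \<open>A function that is not integrable has integral 0 by convention, which lies
    within any nonnegative bound.\<close>
  qed (simp add: not_integrable_integral B)
qed

text \<open>Poincare's homotopy operator for a vector-valued one-form \<alpha>: the radial primitive
  has \<alpha> as derivative up to an integral of the exterior derivative of \<alpha>. This error is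
  kept because the forms met in the iteration need not be closed. Continuity of the derivative keeps
  the iterates continuously differentiable.\<close>

lemma homotopy_formula:
  fixes \<alpha> :: "'a::euclidean_space \<Rightarrow> 'a \<Rightarrow> 'b::euclidean_space"
  assumes lin: "\<And>x. x \<in> ball x0 r \<Longrightarrow> linear (\<alpha> x)"
    and C1: "\<And>v. Ck_on (Suc 0) (ball x0 r) (\<lambda>x. \<alpha> x v)"
    and x: "x \<in> ball x0 r"
  shows "((\<lambda>x. integral {0..1} (\<lambda>t. \<alpha> (x0 + t *\<^sub>R (x - x0)) (x - x0))) has_derivative
    (\<lambda>v. \<alpha> x v + integral {0..1} (\<lambda>t. t *\<^sub>R
        (frechet_derivative (\<lambda>y. \<alpha> y (x - x0)) (at (x0 + t *\<^sub>R (x - x0))) v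
       - frechet_derivative (\<lambda>y. \<alpha> y v) (at (x0 + t *\<^sub>R (x - x0))) (x - x0))))) (at x)"
    and "continuous_on (ball x0 r) (\<lambda>x. frechet_derivative
      (\<lambda>x. integral {0..1} (\<lambda>t. \<alpha> (x0 + t *\<^sub>R (x - x0)) (x - x0))) (at x) v)"
proof -
  let ?B = "ball x0 r"
  define \<gamma> where "\<gamma> x t = x0 + t *\<^sub>R (x - x0)" for x and t :: real
  define d where "d y u w = frechet_derivative (\<lambda>y. \<alpha> y w) (at y) u" for y u w
  have \<gamma>: "\<gamma> x t \<in> ?B" if "x \<in> ?B" "t \<in> {0..1}" for x t
  proof -
    have "\<bar>t\<bar> * norm (x - x0) \<le> 1 * norm (x - x0)" using that by (intro mult_right_mono) auto
    then show ?thesis using that by (simp add: \<gamma>_def dist_norm norm_minus_commute)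
  qed
  have der: "((\<lambda>y. \<alpha> y w) has_derivative (\<lambda>u. d y u w)) (at y)" if "y \<in> ?B" for y w
    unfolding d_def using Ck_on_imp_has_derivative[OF C1 that] .
  then have diff: "(\<lambda>y. \<alpha> y w) differentiable (at y)" if "y \<in> ?B" for y w
    using that differentiableI by blast
  have dlin: "linear (d y u)" if "y \<in> ?B" for y u
    using linear_frechet_derivative_family[where A=\<alpha>, OF open_ball that lin diff[OF that], of u]
    by (simp add: d_def[abs_def])
  have dlin': "linear (\<lambda>u. d y u w)" if "y \<in> ?B" for y w
    using der[OF that] by (rule has_derivative_linear)
  have dcont: "continuous_on ?B (\<lambda>y. d y u w)" for u w
    using C1[of w] by (simp add: d_def)
  have \<alpha>cont: "continuous_on ?B (\<lambda>y. \<alpha> y w)" for w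
    using Ck_on_imp_continuous[OF C1] .
  \<comment> \<open>The derivative of the integrand in x: one term from the moving base point of
    \<alpha>, one from its linear argument.\<close>
  define F where "F x t v = t *\<^sub>R d (\<gamma> x t) v (x - x0) + \<alpha> (\<gamma> x t) v" for x t v
  have derF: "((\<lambda>x. \<alpha> (\<gamma> x t) (x - x0)) has_derivative F x t) (at x)" if x: "x \<in> ?B" and t: "t \<in> {0..1}" for x t
  proof -
    have g: "((\<lambda>x. \<gamma> x t) has_derivative (\<lambda>v. t *\<^sub>R v)) (at x)"
      unfolding \<gamma>_def by (auto intro!: derivative_eq_intros)
    have o: "open {x. \<gamma> x t \<in> ?B}"
      unfolding \<gamma>_def using open_vimage[OF open_ball, of "\<lambda>x. x0 + t *\<^sub>R (x - x0)" x0 r]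
      by (simp add: vimage_def continuous_intros)
    have dd: "((\<lambda>x. \<alpha> (\<gamma> x t) w) has_derivative (\<lambda>v. d (\<gamma> x t) (t *\<^sub>R v) w)) (at x)" for w
      using diff_chain_at[OF g der[OF \<gamma>[OF x t]]] by (simp add: o_def)
    have "((\<lambda>x. \<alpha> (\<gamma> x t) (x - x0)) has_derivative
       (\<lambda>v. frechet_derivative (\<lambda>y. \<alpha> (\<gamma> y t) (x - x0)) (at x) v + \<alpha> (\<gamma> x t) v)) (at x)"
      using dd \<gamma>[OF x t]
      by (intro has_derivative_linear_family[where A="\<lambda>x. \<alpha> (\<gamma> x t)" and h="\<lambda>x. x - x0", OF o])
        (auto intro!: lin derivative_eq_intros differentiableI)
    then show ?thesis
      by (simp add: frechet_derivative_eq[OF dd] linear_cmul[OF dlin'[OF \<gamma>[OF x t]]] F_def[abs_def])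
  qed
  have Fbl: "bounded_linear (F x t)" if "x \<in> ?B" "t \<in> {0..1}" for x t
    using derF[OF that] by (rule has_derivative_bounded_linear)
  have c\<gamma>: "continuous_on (?B \<times> {0..1}) (\<lambda>p. \<gamma> (fst p) (snd p))"
    unfolding \<gamma>_def by (intro continuous_intros)
  have \<gamma>im: "(\<lambda>p. \<gamma> (fst p) (snd p)) ` (?B \<times> {0..1}) \<subseteq> ?B" using \<gamma> by auto
  have c\<alpha>\<gamma>: "continuous_on (?B \<times> {0..1}) (\<lambda>p. \<alpha> (\<gamma> (fst p) (snd p)) w)" for w
    by (rule continuous_on_compose2[OF \<alpha>cont c\<gamma> \<gamma>im])
  have cd\<gamma>: "continuous_on (?B \<times> {0..1}) (\<lambda>p. d (\<gamma> (fst p) (snd p)) u (h p))"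
    if "continuous_on (?B \<times> {0..1}) h" for u h
    by (rule continuous_on_linear_family[where A="\<lambda>p. d (\<gamma> (fst p) (snd p)) u"])
      (use that \<gamma>im continuous_on_compose2[OF dcont c\<gamma> \<gamma>im] in \<open>auto intro!: dlin \<gamma>\<close>)
  have cF: "continuous_on (?B \<times> {0..1}) (\<lambda>p. F (fst p) (snd p) v)" for v
    unfolding F_def by (intro continuous_intros cd\<gamma> c\<alpha>\<gamma>)
  have sec: "continuous_on {0..1} (\<lambda>t. f x t)" if "x \<in> ?B" "continuous_on (?B \<times> {0..1}) (\<lambda>p. f (fst p) (snd p))"
    for x and f :: "'a \<Rightarrow> real \<Rightarrow> 'c::topological_space"
  proof -
    have "continuous_on {0..1} (\<lambda>t. (x, t))" by (intro continuous_on_Pair continuous_on_const continuous_on_id)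
    moreover have "(\<lambda>t. (x, t)) ` {0..1} \<subseteq> ?B \<times> {0..1}" using that(1) by auto
    ultimately show ?thesis using continuous_on_compose2[OF that(2)] by fastforce
  qed
  have cbl: "continuous_on (?B \<times> {0..1}) (\<lambda>p. Blinfun (F (fst p) (snd p)))"
  proof (rule continuous_on_blinfun_componentwise)
    fix b :: 'a
    show "continuous_on (?B \<times> {0..1}) (\<lambda>p. blinfun_apply (Blinfun (F (fst p) (snd p))) b)"
      by (rule continuous_on_eq[OF cF]) (auto simp: bounded_linear_Blinfun_apply Fbl)
  qed
  define P where "P x = integral {0..1} (\<lambda>t. \<alpha> (\<gamma> x t) (x - x0))" for x
  have derP: "(P has_derivative (\<lambda>v. integral {0..1} (\<lambda>t. F x t v))) (at x)" if x: "x \<in> ?B" for x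
  proof -
    have "((\<lambda>x. integral (cbox 0 1) (\<lambda>t. \<alpha> (\<gamma> x t) (x - x0))) has_derivative
        integral (cbox 0 1) (\<lambda>t. Blinfun (F x t))) (at x within ?B)"
    proof (rule leibniz_rule)
      show "((\<lambda>x. \<alpha> (\<gamma> x t) (x - x0)) has_derivative Blinfun (F x t)) (at x within ?B)"
        if "x \<in> ?B" "t \<in> cbox 0 1" for x t
        using derF[OF that[unfolded cbox_interval]] Fbl[OF that[unfolded cbox_interval]]
        by (simp add: bounded_linear_Blinfun_apply has_derivative_at_withinI)
      show "(\<lambda>t. \<alpha> (\<gamma> x t) (x - x0)) integrable_on cbox 0 1" if "x \<in> ?B" for x
      proof -
        have "continuous_on (?B \<times> {0..1}) (\<lambda>p. \<alpha> (\<gamma> (fst p) (snd p)) (fst p - x0))"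
          by (rule continuous_on_linear_family[where A="\<lambda>p. \<alpha> (\<gamma> (fst p) (snd p))"])
            (use \<gamma> c\<alpha>\<gamma> in \<open>auto intro!: lin continuous_intros\<close>)
        from sec[OF that this] show ?thesis by (simp add: cbox_interval integrable_continuous_real)
      qed
      show "continuous_on (?B \<times> cbox 0 1) (\<lambda>(x, t). Blinfun (F x t))"
        using cbl by (simp add: split_beta cbox_interval)
    qed (use x in auto)
    then have D: "(P has_derivative integral {0..1} (\<lambda>t. Blinfun (F x t))) (at x)"
      using x by (simp add: at_within_open[OF _ open_ball] P_def[abs_def] cbox_interval)
    have "(\<lambda>t. Blinfun (F x t)) integrable_on {0..1}"
      by (intro integrable_continuous_real sec[OF x cbl])
    then have "integral {0..1} (\<lambda>t. Blinfun (F x t)) v = integral {0..1} (\<lambda>t. Blinfun (F x t) v)" for v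
      by (rule blinfun_apply_integral)
    also have "integral {0..1} (\<lambda>t. Blinfun (F x t) v) = integral {0..1} (\<lambda>t. F x t v)" for v
      using Fbl[OF x] by (intro integral_cong) (simp add: bounded_linear_Blinfun_apply)
    finally show ?thesis using D by presburger
  qed
  \<comment> \<open>This integrates the derivative of
    \<open>t *\<^sub>R \<alpha> (\<gamma> x t) v\<close> along the ray. Subtracting it from the
    integral of F leaves the antisymmetrized derivative of \<alpha>.\<close>
  have ftc: "((\<lambda>t. \<alpha> (\<gamma> x t) v + t *\<^sub>R d (\<gamma> x t) (x - x0) v) has_integral \<alpha> x v) {0..1}" if x: "x \<in> ?B" for x v
  proof -
    have "((\<lambda>t. t *\<^sub>R \<alpha> (\<gamma> x t) v) has_vector_derivative (\<alpha> (\<gamma> x t) v + t *\<^sub>R d (\<gamma> x t) (x - x0) v)) (at t within {0..1})"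
      if t: "t \<in> {0..1}" for t
    proof -
      have g: "((\<lambda>t. \<gamma> x t) has_derivative (\<lambda>h. h *\<^sub>R (x - x0))) (at t)"
        unfolding \<gamma>_def by (auto intro!: derivative_eq_intros)
      have "((\<lambda>t. \<alpha> (\<gamma> x t) v) has_derivative (\<lambda>h. h *\<^sub>R d (\<gamma> x t) (x - x0) v)) (at t)"
        using diff_chain_at[OF g der[OF \<gamma>[OF x t]]] by (simp add: o_def linear_cmul[OF dlin'[OF \<gamma>[OF x t]]])
      from has_derivative_scaleR[OF has_derivative_ident this]
      have "((\<lambda>t. t *\<^sub>R \<alpha> (\<gamma> x t) v) has_derivative
          (\<lambda>h. t *\<^sub>R (h *\<^sub>R d (\<gamma> x t) (x - x0) v) + h *\<^sub>R \<alpha> (\<gamma> x t) v)) (at t)" .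
      moreover have "(\<lambda>h. t *\<^sub>R (h *\<^sub>R d (\<gamma> x t) (x - x0) v) + h *\<^sub>R \<alpha> (\<gamma> x t) v)
          = (\<lambda>h. h *\<^sub>R (\<alpha> (\<gamma> x t) v + t *\<^sub>R d (\<gamma> x t) (x - x0) v))"
        by (simp add: scaleR_add_right mult.commute add.commute)
      ultimately show ?thesis
        unfolding has_vector_derivative_def by (metis has_derivative_at_withinI)
    qed
    then have "((\<lambda>t. \<alpha> (\<gamma> x t) v + t *\<^sub>R d (\<gamma> x t) (x - x0) v) has_integral
        (1 *\<^sub>R \<alpha> (\<gamma> x 1) v - 0 *\<^sub>R \<alpha> (\<gamma> x 0) v)) {0..1}"
      by (intro fundamental_theorem_of_calculus) auto
    then show ?thesis by (simp add: \<gamma>_def)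
  qed
  show "((\<lambda>x. integral {0..1} (\<lambda>t. \<alpha> (x0 + t *\<^sub>R (x - x0)) (x - x0))) has_derivative
    (\<lambda>v. \<alpha> x v + integral {0..1} (\<lambda>t. t *\<^sub>R
        (frechet_derivative (\<lambda>y. \<alpha> y (x - x0)) (at (x0 + t *\<^sub>R (x - x0))) v
       - frechet_derivative (\<lambda>y. \<alpha> y v) (at (x0 + t *\<^sub>R (x - x0))) (x - x0))))) (at x)"
  proof -
    have "integral {0..1} (\<lambda>t. F x t v) = \<alpha> x v +
        integral {0..1} (\<lambda>t. t *\<^sub>R (d (\<gamma> x t) v (x - x0) - d (\<gamma> x t) (x - x0) v))" for v
    proof -
      have "(\<lambda>t. F x t v) integrable_on {0..1}"
        by (intro integrable_continuous_real sec[OF x cF])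
      from has_integral_diff[OF integrable_integral[OF this] ftc[OF x, of v]]
      have "((\<lambda>t. t *\<^sub>R (d (\<gamma> x t) v (x - x0) - d (\<gamma> x t) (x - x0) v)) has_integral
          (integral {0..1} (\<lambda>t. F x t v) - \<alpha> x v)) {0..1}"
        by (simp add: F_def algebra_simps)
      then show ?thesis by (simp add: integral_unique)
    qed
    with derP[OF x] show ?thesis by (simp add: P_def[abs_def] \<gamma>_def d_def)
  qed
  have "continuous_on ?B (\<lambda>x. integral (cbox 0 1) (\<lambda>t. F x t v))"
    using cF by (intro integral_continuous_on_param) (simp add: split_beta cbox_interval)
  then have "continuous_on ?B (\<lambda>x. frechet_derivative P (at x) v)"
    by (rule continuous_on_eq) (simp add: frechet_derivative_eq[OF derP] cbox_interval)
  then show "continuous_on ?B (\<lambda>x. frechet_derivative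
      (\<lambda>x. integral {0..1} (\<lambda>t. \<alpha> (x0 + t *\<^sub>R (x - x0)) (x - x0))) (at x) v)"
    by (simp add: P_def[abs_def] \<gamma>_def)
qed

lemma Ck_on_minus: "open S \<Longrightarrow> Ck_on k S f \<Longrightarrow> Ck_on k S (\<lambda>x. - f x)"
  using Ck_on_bounded_linear_compose[OF _ bounded_linear_minus[OF bounded_linear_ident]] .

text \<open>Finitely many pairs of basis vectors determine a bilinear map, and each entry is bounded
  on the compact set; adding 1 to the sum of the bounds makes it positive.\<close>

lemma continuous_bilinear_family_bound:
  fixes G :: "'x::topological_space \<Rightarrow> 'a::euclidean_space \<Rightarrow> 'b::euclidean_space \<Rightarrow> 'c::real_normed_vector"
  assumes K: "compact K" and lin1: "\<And>x v. x \<in> K \<Longrightarrow> linear (G x v)"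
    and lin2: "\<And>x w. x \<in> K \<Longrightarrow> linear (\<lambda>v. G x v w)"
    and cont: "\<And>v w. continuous_on K (\<lambda>x. G x v w)"
  shows "\<exists>C>0. \<forall>x\<in>K. \<forall>v w. norm (G x v w) \<le> C * norm v * norm w"
proof -
  have "\<exists>M. \<forall>x\<in>K. norm (G x i j) \<le> M" for i j
    using compact_imp_bounded[OF compact_continuous_image[OF cont K]] by (auto simp: bounded_iff)
  then obtain M where M: "\<And>i j x. x \<in> K \<Longrightarrow> norm (G x i j) \<le> M i j" by metis
  define C where "C = (\<Sum>i\<in>Basis. \<Sum>j\<in>Basis. \<bar>M i j\<bar>) + 1"
  have "norm (G x v w) \<le> C * norm v * norm w" if x: "x \<in> K" for x v w
  proof -
    have "G x v w = (\<Sum>i\<in>Basis. (v \<bullet> i) *\<^sub>R G x i w)" by (rule linear_sum_Basis[OF lin2[OF x]])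
    also have "\<dots> = (\<Sum>i\<in>Basis. (v \<bullet> i) *\<^sub>R (\<Sum>j\<in>Basis. (w \<bullet> j) *\<^sub>R G x i j))"
      by (intro sum.cong arg_cong[where f="(*\<^sub>R) _"] linear_sum_Basis[OF lin1[OF x]] refl)
    finally have "norm (G x v w) = norm (\<Sum>i\<in>Basis. \<Sum>j\<in>Basis. ((v \<bullet> i) * (w \<bullet> j)) *\<^sub>R G x i j)"
      by (simp add: scaleR_sum_right)
    also have "\<dots> \<le> (\<Sum>i\<in>Basis. \<Sum>j\<in>Basis. (norm v * norm w) * \<bar>M i j\<bar>)"
    proof (intro sum_norm_le)
      fix i :: 'a and j :: 'b assume "i \<in> Basis" "j \<in> Basis"
      then have "\<bar>v \<bullet> i\<bar> * \<bar>w \<bullet> j\<bar> \<le> norm v * norm w" by (intro mult_mono Basis_le_norm) auto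
      then show "norm (((v \<bullet> i) * (w \<bullet> j)) *\<^sub>R G x i j) \<le> (norm v * norm w) * \<bar>M i j\<bar>"
        using M[OF x, of i j] by (simp add: abs_mult mult_mono)
    qed
    also have "\<dots> \<le> C * norm v * norm w"
      by (simp add: C_def sum_distrib_left algebra_simps)
    finally show ?thesis .
  qed
  moreover have "C > 0" by (simp add: C_def add_nonneg_pos sum_nonneg)
  ultimately show ?thesis by blast
qed

text \<open>
  Picard iteration for \<open>s(x) = e - \<integral>\<^sub>0\<^sup>1 G\<^bsub>\<gamma>(t)\<^esub>(x - x\<^sub>0) s(\<gamma>(t)) dt\<close>, \<open>\<gamma>(t) = x\<^sub>0 + t(x - x\<^sub>0)\<close>. By the homotopy
  formula and flatness the defects \<open>ds\<^sub>k + G s\<^sub>k\<close> of the iterates satisfy a contracting recursion,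
  so the derivatives converge to \<open>-G s\<close>.
\<close>

theorem parallel_section_exists:
  fixes G :: "'a::euclidean_space \<Rightarrow> 'a \<Rightarrow> 'b::euclidean_space \<Rightarrow> 'b"
  assumes S: "open S" "x0 \<in> S" and lin1: "\<And>x v. x \<in> S \<Longrightarrow> linear (G x v)"
    and lin2: "\<And>x w. x \<in> S \<Longrightarrow> linear (\<lambda>v. G x v w)"
    and C1: "\<And>v w. Ck_on (Suc 0) S (\<lambda>x. G x v w)"
    and flat: "\<And>x u v w. x \<in> S \<Longrightarrow> frechet_derivative (\<lambda>x. G x v w) (at x) u
       - frechet_derivative (\<lambda>x. G x u w) (at x) v + G x u (G x v w) - G x v (G x u w) = 0"
  shows "\<exists>r>0. ball x0 r \<subseteq> S \<and> (\<forall>e. \<exists>s. s x0 = e \<and>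
           (\<forall>x\<in>ball x0 r. (s has_derivative (\<lambda>v. - G x v (s x))) (at x)))"
proof -
  obtain r0 where r0: "r0 > 0" "cball x0 r0 \<subseteq> S" using S open_contains_cball by blast
  have "\<exists>C>0. \<forall>x\<in>cball x0 r0. \<forall>v w. norm (G x v w) \<le> C * norm v * norm w"
    using r0 lin1 lin2 continuous_on_subset[OF Ck_on_imp_continuous[OF C1]]
    by (intro continuous_bilinear_family_bound) (auto simp: subset_iff)
  then obtain C where C: "C > 0" "\<And>x v w. x \<in> cball x0 r0 \<Longrightarrow> norm (G x v w) \<le> C * norm v * norm w" by blast
  \<comment> \<open>With C r \<le> 1/8 the radial operator \<open>G y (x - x0)\<close> has norm at
    most 1/8 on the ball. The initial value e does not enter, so one radius serves all of
    them.\<close>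
  define r where "r = min r0 (1 / (8 * C))"
  define B where "B = ball x0 r"
  have r: "r > 0" "C * r \<le> 1/8" using r0 C by (auto simp: r_def min_def field_simps)
  have BS: "B \<subseteq> S" using r0 by (auto simp: B_def r_def subset_iff)
  have openB: "open B" by (simp add: B_def)
  have CB: "norm (G x v w) \<le> C * norm v * norm w" if "x \<in> B" for x v w
    using C(2) that by (auto simp: B_def r_def)
  have dG: "((\<lambda>x. G x v w) has_derivative frechet_derivative (\<lambda>x. G x v w) (at x)) (at x)" if "x \<in> B" for x v w
    using Ck_on_imp_has_derivative[OF C1] that BS by blast
  have "\<exists>s. s x0 = e \<and> (\<forall>x\<in>B. (s has_derivative (\<lambda>v. - G x v (s x))) (at x))" for e
  proof -
    define \<gamma> where "\<gamma> x t = x0 + t *\<^sub>R (x - x0)" for x and t :: real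
    have \<gamma>: "\<gamma> x t \<in> B" if "x \<in> B" "t \<in> {0..1}" for x t
    proof -
      have "\<bar>t\<bar> * norm (x - x0) \<le> 1 * norm (x - x0)" using that by (intro mult_right_mono) auto
      then show ?thesis using that by (simp add: \<gamma>_def dist_norm norm_minus_commute B_def)
    qed
    define T where "T s x = e + integral {0..1} (\<lambda>t. - G (\<gamma> x t) (x - x0) (s (\<gamma> x t)))" for s x
    define s where "s k = (T ^^ k) (\<lambda>_. e)" for k
    have s0: "s 0 = (\<lambda>_. e)" and sSuc: "s (Suc k) = T (s k)" for k by (simp_all add: s_def)
    define D where "D k x v = frechet_derivative (s k) (at x) v" for k x v
    define E where "E k x v = D k x v + G x v (s k x)" for k x v
    \<comment> \<open>By flatness the exterior derivative of \<alpha> = - G s along the ray involves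
      s only through its defect ds + G s.\<close>
    define Q where "Q s x v t = t *\<^sub>R (G (\<gamma> x t) v (frechet_derivative s (at (\<gamma> x t)) (x - x0) + G (\<gamma> x t) (x - x0) (s (\<gamma> x t)))
         - G (\<gamma> x t) (x - x0) (frechet_derivative s (at (\<gamma> x t)) v + G (\<gamma> x t) v (s (\<gamma> x t))))" for s x v t
    have linG: "linear (G x v)" "linear (\<lambda>v. G x v w)" if "x \<in> B" for x v w
      using lin1 lin2 that BS by auto
    have CkG: "Ck_on (Suc 0) B (\<lambda>x. G x v w)" for v w using Ck_on_subset[OF C1 BS] .
    have CkGs: "Ck_on (Suc 0) B (\<lambda>x. - G x v (s x))" if "Ck_on (Suc 0) B s" for s v
      by (rule Ck_on_minus[OF openB Ck_on_linear_family[where A="\<lambda>x. G x v", OF openB linG(1) CkG that]])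
    have step: "(T s has_derivative (\<lambda>v. - G x v (s x) + integral {0..1} (Q s x v))) (at x)"
      "Ck_on (Suc 0) B (T s)"
      if s: "Ck_on (Suc 0) B s" and x: "x \<in> B" for s x
    proof -
      have ds: "(s has_derivative frechet_derivative s (at y)) (at y)" if "y \<in> B" for y
        using Ck_on_imp_has_derivative[OF s that] .
      define \<alpha> where "\<alpha> x v = - G x v (s x)" for x v
      have l\<alpha>: "linear (\<alpha> x)" if "x \<in> B" for x
        using linear_compose_neg[OF linG(2)[OF that]] by (simp add: \<alpha>_def[abs_def])
      have c\<alpha>: "Ck_on (Suc 0) B (\<lambda>x. \<alpha> x v)" for v
        using CkGs[OF s] by (simp add: \<alpha>_def)
      have d\<alpha>: "frechet_derivative (\<lambda>y. \<alpha> y v) (at y) u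
          = - frechet_derivative (\<lambda>x. G x v (s y)) (at y) u - G y v (frechet_derivative s (at y) u)"
        if y: "y \<in> B" for y u v
      proof -
        have "((\<lambda>y. \<alpha> y v) has_derivative (\<lambda>u. - (frechet_derivative (\<lambda>x. G x v (s y)) (at y) u
            + G y v (frechet_derivative s (at y) u)))) (at y)"
          unfolding \<alpha>_def
          using dG[OF y] linG ds[OF y] y
          by (intro has_derivative_minus has_derivative_linear_family[where A="\<lambda>x. G x v", OF openB])
            (auto intro: differentiableI)
        then show ?thesis by (simp add: frechet_derivative_eq)
      qed
      note hf = homotopy_formula[where \<alpha>=\<alpha> and ?x0.0=x0 and r=r, folded B_def \<gamma>_def, OF l\<alpha> c\<alpha>]
      have hf1: "((\<lambda>x. integral {0..1} (\<lambda>t. \<alpha> (\<gamma> x t) (x - x0))) has_derivative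
          (\<lambda>v. \<alpha> x v + integral {0..1} (\<lambda>t. t *\<^sub>R
            (frechet_derivative (\<lambda>y. \<alpha> y (x - x0)) (at (\<gamma> x t)) v
             - frechet_derivative (\<lambda>y. \<alpha> y v) (at (\<gamma> x t)) (x - x0))))) (at x)" if "x \<in> B" for x
        by (rule hf(1)) (use that in auto)
      have x0B: "x0 \<in> B" using r by (simp add: B_def)
      have hf2: "continuous_on B (\<lambda>x. frechet_derivative (\<lambda>x. integral {0..1} (\<lambda>t. \<alpha> (\<gamma> x t) (x - x0))) (at x) v)" for v
        by (rule hf(2)[where ?x=x0]) (use x0B in auto)
      have der: "(T s has_derivative (\<lambda>v. - G x v (s x) + integral {0..1} (Q s x v))) (at x)"
        if x: "x \<in> B" for x
      proof -
        have "(T s has_derivative (\<lambda>v. 0 + (\<alpha> x v + integral {0..1} (\<lambda>t. t *\<^sub>R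
            (frechet_derivative (\<lambda>y. \<alpha> y (x - x0)) (at (\<gamma> x t)) v
             - frechet_derivative (\<lambda>y. \<alpha> y v) (at (\<gamma> x t)) (x - x0)))))) (at x)"
          unfolding T_def using hf1[OF x]
          by (intro has_derivative_add has_derivative_const) (simp add: \<alpha>_def)
        moreover have "integral {0..1} (\<lambda>t. t *\<^sub>R
            (frechet_derivative (\<lambda>y. \<alpha> y (x - x0)) (at (\<gamma> x t)) v
             - frechet_derivative (\<lambda>y. \<alpha> y v) (at (\<gamma> x t)) (x - x0)))
          = integral {0..1} (Q s x v)" for v
        proof (rule integral_cong)
          fix t :: real assume "t \<in> {0..1}"
          note y = \<gamma>[OF x this]
          show "t *\<^sub>R (frechet_derivative (\<lambda>y. \<alpha> y (x - x0)) (at (\<gamma> x t)) v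
             - frechet_derivative (\<lambda>y. \<alpha> y v) (at (\<gamma> x t)) (x - x0))
          = Q s x v t"
            using flat[of "\<gamma> x t" v "s (\<gamma> x t)" "x - x0"] y BS
            unfolding Q_def by (intro arg_cong[where f="(*\<^sub>R) t"])
              (simp add: d\<alpha>[OF y] linear_add[OF linG(1)[OF y]] algebra_simps subset_iff)
        qed
        ultimately show ?thesis by (simp add: \<alpha>_def)
      qed
      show "(T s has_derivative (\<lambda>v. - G x v (s x) + integral {0..1} (Q s x v))) (at x)"
        using der[OF x] .
      show "Ck_on (Suc 0) B (T s)"
      proof (simp, intro conjI ballI allI)
        show "T s differentiable (at x)" if "x \<in> B" for x using der[OF that] by (rule differentiableI)
        have "frechet_derivative (T s) (at x)
            = frechet_derivative (\<lambda>x. integral {0..1} (\<lambda>t. \<alpha> (\<gamma> x t) (x - x0))) (at x)" if "x \<in> B" for x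
          unfolding T_def \<alpha>_def[symmetric]
          using has_derivative_add[OF has_derivative_const hf1[OF that], of e]
          by (simp add: frechet_derivative_eq frechet_derivative_eq[OF hf1[OF that]])
        then show "continuous_on B (\<lambda>x. frechet_derivative (T s) (at x) v)" for v
          by (intro continuous_on_eq[OF hf2]) simp_all
      qed
    qed
    have Cs: "Ck_on (Suc 0) B (s k)" for k
    proof (induction k)
      case (Suc k)
      have "x0 \<in> B" using r by (simp add: B_def)
      with step(2)[OF Suc] show ?case by (simp add: sSuc)
    qed (simp add: s0 Ck_on_const del: Ck_on.simps)
    have ders: "(s k has_derivative D k x) (at x)" if "x \<in> B" for x k
      unfolding D_def using Ck_on_imp_has_derivative[OF Cs that] .
    have nx: "norm (x - x0) \<le> r" if "x \<in> B" for x using that by (simp add: B_def dist_norm norm_minus_commute)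
    have Gx: "norm (G y (x - x0) w) \<le> norm w / 8" if "x \<in> B" "y \<in> B" for x y w
    proof -
      have "norm (G y (x - x0) w) \<le> C * norm (x - x0) * norm w" by (rule CB[OF that(2)])
      also have "\<dots> \<le> C * r * norm w" using nx[OF that(1)] C(1) by (intro mult_right_mono mult_left_mono) auto
      also have "\<dots> \<le> 1/8 * norm w" using r by (intro mult_right_mono) auto
      finally show ?thesis by simp
    qed
    have intG: "(\<lambda>t. - G (\<gamma> x t) (x - x0) (s k (\<gamma> x t))) integrable_on {0..1}" if "x \<in> B" for x k
    proof (rule integrable_continuous_real)
      have "continuous_on B (\<lambda>y. - G y (x - x0) (s k y))" by (rule Ck_on_imp_continuous[OF CkGs[OF Cs]])
      then show "continuous_on {0..1} (\<lambda>t. - G (\<gamma> x t) (x - x0) (s k (\<gamma> x t)))"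
        by (rule continuous_on_compose2) (use \<gamma>[OF that] in \<open>auto simp: \<gamma>_def intro!: continuous_intros\<close>)
    qed
    have diffs: "norm (s (Suc k) x - s k x) \<le> norm e * (1/4) ^ Suc k" if "x \<in> B" for x k
      using that
    proof (induction k arbitrary: x)
      case 0
      have "norm (integral {0..1} (\<lambda>t. - G (\<gamma> x t) (x - x0) e)) \<le> norm e / 8"
        using Gx[OF 0] \<gamma>[OF 0] by (intro norm_integral_le) auto
      then show ?case using norm_ge_zero[of e] by (simp add: sSuc T_def s0 del: norm_ge_zero)
    next
      case (Suc k)
      have "s (Suc (Suc k)) x - s (Suc k) x = integral {0..1} (\<lambda>t. - G (\<gamma> x t) (x - x0) (s (Suc k) (\<gamma> x t)))
          - integral {0..1} (\<lambda>t. - G (\<gamma> x t) (x - x0) (s k (\<gamma> x t)))"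
        by (simp only: sSuc[of "Suc k"] sSuc[of k]) (simp add: T_def)
      also have "\<dots> = integral {0..1} (\<lambda>t. - G (\<gamma> x t) (x - x0) (s (Suc k) (\<gamma> x t)) - - G (\<gamma> x t) (x - x0) (s k (\<gamma> x t)))"
        by (rule integral_diff[symmetric]) (intro intG Suc.prems)+
      also have "\<dots> = integral {0..1} (\<lambda>t. - G (\<gamma> x t) (x - x0) (s (Suc k) (\<gamma> x t) - s k (\<gamma> x t)))"
        using linG(1)[OF \<gamma>[OF Suc.prems]] by (intro integral_cong) (simp add: linear_diff)
      also have "norm \<dots> \<le> norm e * (1/4) ^ Suc k / 8"
      proof (rule norm_integral_le)
        fix t :: real assume t: "t \<in> {0..1}"
        have "norm (G (\<gamma> x t) (x - x0) (s (Suc k) (\<gamma> x t) - s k (\<gamma> x t))) \<le> norm (s (Suc k) (\<gamma> x t) - s k (\<gamma> x t)) / 8"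
          by (rule Gx[OF Suc.prems \<gamma>[OF Suc.prems t]])
        also have "\<dots> \<le> norm e * (1/4) ^ Suc k / 8"
          using Suc.IH[OF \<gamma>[OF Suc.prems t]] by simp
        finally show "norm (- G (\<gamma> x t) (x - x0) (s (Suc k) (\<gamma> x t) - s k (\<gamma> x t))) \<le> norm e * (1/4) ^ Suc k / 8"
          by simp
      qed
      also have "\<dots> \<le> norm e * (1/4) ^ Suc (Suc k)" by (simp add: mult_left_mono)
      finally show ?case .
    qed
    \<comment> \<open>The next defect is \<open>G x v\<close> of the difference of two iterates plus
      the integral of Q. Each part is at most a quarter of the previous bound, hence the ratio
      1/2.\<close>
    have Ebound: "norm (E k x v) \<le> C * norm e * (1/2) ^ k * norm v" if "x \<in> B" for k x v
      using that
    proof (induction k arbitrary: x v)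
      case 0
      have "E 0 x v = G x v e" by (simp add: E_def D_def s0)
      then show ?case using CB[OF 0, of v e] by (simp add: mult.assoc mult.left_commute mult.commute)
    next
      case (Suc k)
      define M where "M = C * norm e * (1/2) ^ k"
      have M: "M \<ge> 0" using C by (simp add: M_def)
      have IH: "norm (E k y w) \<le> M * norm w" if "y \<in> B" for y w using Suc.IH[OF that] by (simp add: M_def)
      define R where "R = integral {0..1} (\<lambda>t. t *\<^sub>R (G (\<gamma> x t) v (E k (\<gamma> x t) (x - x0)) - G (\<gamma> x t) (x - x0) (E k (\<gamma> x t) v)))"
      have "D (Suc k) x v = - G x v (s k x) + R"
        using step(1)[OF Cs Suc.prems, of k] by (simp add: D_def sSuc frechet_derivative_eq R_def E_def Q_def[abs_def])
      then have E1: "E (Suc k) x v = G x v (s (Suc k) x - s k x) + R"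
        by (simp add: E_def linear_diff[OF linG(1)[OF Suc.prems]])
      have "norm R \<le> M * norm v / 4"
        unfolding R_def
      proof (rule norm_integral_le)
        fix t :: real assume t: "t \<in> {0..1}"
        note y = \<gamma>[OF Suc.prems t]
        have "norm (G (\<gamma> x t) v (E k (\<gamma> x t) (x - x0))) \<le> C * norm v * norm (E k (\<gamma> x t) (x - x0))" by (rule CB[OF y])
        also have "\<dots> \<le> C * norm v * (M * r)"
          using IH[OF y, of "x - x0"] mult_left_mono[OF nx[OF Suc.prems] M] C by (intro mult_left_mono) auto
        also have "\<dots> = (C * r) * (M * norm v)" by simp
        also have "\<dots> \<le> 1/8 * (M * norm v)" using r M by (intro mult_right_mono) auto
        finally have 1: "norm (G (\<gamma> x t) v (E k (\<gamma> x t) (x - x0))) \<le> M * norm v / 8" by simp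
        have 2: "norm (G (\<gamma> x t) (x - x0) (E k (\<gamma> x t) v)) \<le> M * norm v / 8"
          using Gx[OF Suc.prems y, of "E k (\<gamma> x t) v"] IH[OF y, of v] by simp
        have "norm (G (\<gamma> x t) v (E k (\<gamma> x t) (x - x0)) - G (\<gamma> x t) (x - x0) (E k (\<gamma> x t) v)) \<le> M * norm v / 4"
          using norm_triangle_ineq4[of "G (\<gamma> x t) v (E k (\<gamma> x t) (x - x0))" "G (\<gamma> x t) (x - x0) (E k (\<gamma> x t) v)"] 1 2 by linarith
        moreover have "\<bar>t\<bar> * norm (G (\<gamma> x t) v (E k (\<gamma> x t) (x - x0)) - G (\<gamma> x t) (x - x0) (E k (\<gamma> x t) v))
           \<le> 1 * norm (G (\<gamma> x t) v (E k (\<gamma> x t) (x - x0)) - G (\<gamma> x t) (x - x0) (E k (\<gamma> x t) v))"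
          using t by (intro mult_right_mono) auto
        ultimately show "norm (t *\<^sub>R (G (\<gamma> x t) v (E k (\<gamma> x t) (x - x0)) - G (\<gamma> x t) (x - x0) (E k (\<gamma> x t) v))) \<le> M * norm v / 4"
          by simp
      qed
      moreover have "norm (G x v (s (Suc k) x - s k x)) \<le> M * norm v / 4"
      proof -
        have "norm (G x v (s (Suc k) x - s k x)) \<le> C * norm v * norm (s (Suc k) x - s k x)" by (rule CB[OF Suc.prems])
        also have "\<dots> \<le> C * norm v * (norm e * (1/4) ^ Suc k)"
          using diffs[OF Suc.prems, of k] C by (intro mult_left_mono) auto
        also have "\<dots> \<le> C * norm v * (norm e * ((1/2) ^ k / 4))"
          using C power_mono[of "1/4::real" "1/2" k] by (intro mult_left_mono) auto
        finally show ?thesis by (simp add: M_def mult_ac)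
      qed
      ultimately have "norm (E (Suc k) x v) \<le> M * norm v / 2"
        unfolding E1 using norm_triangle_ineq[of "G x v (s (Suc k) x - s k x)" R] by linarith
      then show ?case by (simp add: M_def mult_ac)
    qed
    \<comment> \<open>The factor \<open>1 - (1/4) ^ j\<close>, in place of 1, lets the induction on
      j close.\<close>
    have tail: "norm (s (n + j) x - s n x) \<le> norm e * (1/4) ^ n * (1 - (1/4) ^ j)" if x: "x \<in> B" for x n j
    proof (induction j)
      case (Suc j)
      have "norm (s (n + Suc j) x - s n x) \<le> norm (s (Suc (n + j)) x - s (n + j) x) + norm (s (n + j) x - s n x)"
        using norm_triangle_ineq[of "s (Suc (n + j)) x - s (n + j) x" "s (n + j) x - s n x"] by simp
      also have "\<dots> \<le> norm e * (1/4) ^ Suc (n + j) + norm e * (1/4) ^ n * (1 - (1/4) ^ j)"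
        by (rule add_mono[OF diffs[OF x] Suc])
      also have "\<dots> \<le> norm e * (1/4) ^ n * (1 - (1/4) ^ Suc j)"
        by (simp add: power_add algebra_simps)
      finally show ?case .
    qed simp
    have tail': "norm (s m x - s n x) \<le> norm e * (1/4) ^ n" if x: "x \<in> B" and "n \<le> m" for x n m
    proof -
      have "norm (s m x - s n x) \<le> norm e * (1/4) ^ n * (1 - (1/4) ^ (m - n))"
        using tail[OF x, of n "m - n"] that by simp
      also have "\<dots> \<le> norm e * (1/4) ^ n * 1" by (intro mult_left_mono) auto
      finally show ?thesis by simp
    qed
    have lim0: "(\<lambda>n. norm e * (1/4::real) ^ n) \<longlonglongrightarrow> 0"
      by (intro tendsto_mult_right_zero LIMSEQ_power_zero) simp
    have "\<exists>l. (\<lambda>n. s n x) \<longlonglongrightarrow> l" if x: "x \<in> B" for x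
    proof -
      have "Cauchy (\<lambda>n. s n x)"
      proof (rule CauchyI')
        fix \<epsilon> :: real assume "\<epsilon> > 0"
        then obtain N where N: "norm e * (1/4) ^ N < \<epsilon>"
          using order_tendstoD(2)[OF lim0] by (auto simp: eventually_sequentially)
        have "dist (s m x) (s n x) < \<epsilon>" if "m \<ge> N" "n > m" for m n
        proof -
          have "norm (s n x - s m x) \<le> norm e * (1/4) ^ m" using tail'[OF x, of m n] that by simp
          also have "\<dots> \<le> norm e * (1/4) ^ N" using that by (intro mult_left_mono power_decreasing) auto
          finally show ?thesis using N by (simp add: dist_norm norm_minus_commute)
        qed
        then show "\<exists>M. \<forall>m\<ge>M. \<forall>n>m. dist (s m x) (s n x) < \<epsilon>" by blast
      qed
      then show ?thesis by (simp add: Cauchy_convergent_iff convergent_def)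
    qed
    \<comment> \<open>The pointwise limit is fixed beforehand because the limit
      \<open>- G x v (S' x)\<close> of the derivatives has to be named when the theorem on sequences
      of derivatives is applied.\<close>
    then obtain S' where S': "\<And>x. x \<in> B \<Longrightarrow> (\<lambda>n. s n x) \<longlonglongrightarrow> S' x" by metis
    have S'n: "norm (S' x - s n x) \<le> norm e * (1/4) ^ n" if x: "x \<in> B" for x n
    proof (rule LIMSEQ_le_const2)
      show "(\<lambda>m. norm (s m x - s n x)) \<longlonglongrightarrow> norm (S' x - s n x)" by (intro tendsto_intros S'[OF x])
      show "\<exists>N. \<forall>m\<ge>N. norm (s m x - s n x) \<le> norm e * (1/4) ^ n" using tail'[OF x] by blast
    qed
    have x0: "x0 \<in> B" using r by (simp add: B_def)
    have "s n x0 = e" for n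
    proof (cases n)
      case (Suc k)
      have "G x0 0 w = 0" for w using linear_0[OF linG(2)[OF x0]] .
      then show ?thesis by (simp add: Suc sSuc T_def \<gamma>_def)
    qed (simp add: s0)
    then have sx0: "(\<lambda>n. s n x0) \<longlonglongrightarrow> e" by simp
    have "\<exists>g. \<forall>x\<in>B. (\<lambda>n. s n x) \<longlonglongrightarrow> g x \<and> (g has_derivative (\<lambda>v. - G x v (S' x))) (at x within B)"
    proof (rule has_derivative_sequence)
      show "convex B" by (simp add: B_def)
      show "(s n has_derivative D n x) (at x within B)" if "x \<in> B" for n x
        using ders[OF that] by (rule has_derivative_at_withinI)
      show "x0 \<in> B" "(\<lambda>n. s n x0) \<longlonglongrightarrow> e" by fact+
      fix \<epsilon> :: real assume \<epsilon>: "\<epsilon> > 0"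
      have "(\<lambda>n. C * norm e * (1/2) ^ n + C * (norm e * (1/4) ^ n)) \<longlonglongrightarrow> 0 + C * 0"
        by (intro tendsto_add tendsto_mult_left lim0 tendsto_mult_right_zero LIMSEQ_power_zero) simp
      then have "\<forall>\<^sub>F n in sequentially. C * norm e * (1/2) ^ n + C * (norm e * (1/4) ^ n) < \<epsilon>"
        using \<epsilon> by (simp add: order_tendstoD)
      then show "\<forall>\<^sub>F n in sequentially. \<forall>x\<in>B. \<forall>h. norm (D n x h - - G x h (S' x)) \<le> \<epsilon> * norm h"
      proof eventually_elim
        case (elim n)
        show ?case
        proof (intro ballI allI)
          fix x h assume x: "x \<in> B"
          have eq: "D n x h - - G x h (S' x) = E n x h + G x h (S' x - s n x)"
            by (simp add: E_def linear_diff[OF linG(1)[OF x]])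
          have "norm (G x h (S' x - s n x)) \<le> C * norm h * norm (S' x - s n x)" by (rule CB[OF x])
          also have "\<dots> \<le> C * norm h * (norm e * (1/4) ^ n)" using S'n[OF x, of n] C by (intro mult_left_mono) auto
          finally have G: "norm (G x h (S' x - s n x)) \<le> C * norm h * (norm e * (1/4) ^ n)" .
          have "norm (D n x h - - G x h (S' x)) \<le> C * norm e * (1/2) ^ n * norm h + C * norm h * (norm e * (1/4) ^ n)"
            unfolding eq by (rule norm_triangle_le[OF add_mono[OF Ebound[OF x] G]])
          also have "\<dots> = (C * norm e * (1/2) ^ n + C * (norm e * (1/4) ^ n)) * norm h"
          proof -
            have "C * norm e * p * norm h + C * norm h * (norm e * q) = (C * norm e * p + C * (norm e * q)) * norm h"
              for p q :: real by algebra
            then show ?thesis .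
          qed
          also have "\<dots> \<le> \<epsilon> * norm h" using elim by (intro mult_right_mono) auto
          finally show "norm (D n x h - - G x h (S' x)) \<le> \<epsilon> * norm h" .
        qed
      qed
    qed
    then obtain g where g: "\<And>x. x \<in> B \<Longrightarrow> (\<lambda>n. s n x) \<longlonglongrightarrow> g x"
      "\<And>x. x \<in> B \<Longrightarrow> (g has_derivative (\<lambda>v. - G x v (S' x))) (at x within B)" by blast
    have gS: "g x = S' x" if "x \<in> B" for x using LIMSEQ_unique[OF g(1)[OF that] S'[OF that]] .
    have "g x0 = e" using LIMSEQ_unique[OF g(1)[OF x0] sx0] .
    moreover have "(g has_derivative (\<lambda>v. - G x v (g x))) (at x)" if "x \<in> B" for x
      using g(2)[OF that] by (simp only: gS[OF that] at_within_open[OF that openB])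
    ultimately show ?thesis by blast
  qed
  then show ?thesis using r(1) BS unfolding B_def by blast
qed

text \<open>The equation expresses the derivative of s through s itself, so each order of regularity
  gives the next one, up to that of G.\<close>

lemma parallel_section_Ck_on:
  fixes G :: "'a::euclidean_space \<Rightarrow> 'a \<Rightarrow> 'b::euclidean_space \<Rightarrow> 'b"
  assumes B: "open B" and lin: "\<And>x v. x \<in> B \<Longrightarrow> linear (G x v)"
    and G: "\<And>v w. Ck_on k B (\<lambda>x. G x v w)"
    and s: "\<And>x. x \<in> B \<Longrightarrow> (s has_derivative (\<lambda>v. - G x v (s x))) (at x)"
  shows "Ck_on k B s"
  using G
proof (induction k)
  case 0
  show ?case
    by (simp, rule continuous_at_imp_continuous_on) (use has_derivative_continuous[OF s] in auto)
next
  case (Suc k)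
  have s': "Ck_on k B s" by (rule Suc.IH[OF Suc.prems[THEN Ck_on_SucD]])
  have "Ck_on k B (\<lambda>x. - G x v (s x))" for v
    by (rule Ck_on_minus[OF B Ck_on_linear_family[where A="\<lambda>x. G x v", OF B lin Suc.prems[THEN Ck_on_SucD] s']])
  with s show ?case by (intro Ck_on_SucI[OF B])
qed

section \<open>Totally real Lagrangian subspaces\<close>

text \<open>A nondegenerate form is the inner product composed with an invertible M, so every
  functional has the shape \<open>\<Omega> u w\<close> in u. For the second claim let z be the
  component of y orthogonal to P: the vector w representing z annihilates P, hence y, so z has
  length zero.\<close>

lemma nondegenerate_form_double_perp:
  fixes \<Omega> :: "'a::euclidean_space \<Rightarrow> 'a \<Rightarrow> real"
  assumes lin: "\<And>u. linear (\<Omega> u)" and alt: "\<And>u v. \<Omega> u v = - \<Omega> v u"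
    and nondeg: "\<And>u. (\<And>v. \<Omega> u v = 0) \<Longrightarrow> u = 0"
  shows "\<exists>w. \<forall>u. \<Omega> u w = u \<bullet> z"
    and "subspace P \<Longrightarrow> (\<And>w. (\<And>p. p \<in> P \<Longrightarrow> \<Omega> p w = 0) \<Longrightarrow> \<Omega> y w = 0) \<Longrightarrow> y \<in> P"
proof -
  have lin': "linear (\<lambda>u. \<Omega> u w)" for w
    using linear_compose_neg[OF lin[of w]] by (simp add: alt[of _ w])
  define M where "M w = (\<Sum>b\<in>Basis. \<Omega> b w *\<^sub>R b)" for w
  have M: "\<Omega> u w = u \<bullet> M w" for u w
    using linear_sum_Basis[OF lin', of u w] by (simp add: M_def inner_sum_right mult.commute)
  have lM: "linear M"
    by (rule linearI)
      (simp_all add: M_def linear_add[OF lin] linear_cmul[OF lin] scaleR_add_left sum.distrib scaleR_sum_right)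
  have "inj M"
  proof (rule linear_injective_0[OF lM, THEN iffD2], intro allI impI)
    fix w assume "M w = 0"
    then have "\<Omega> w u = 0" for u using M[of u w] alt[of w u] by simp
    then show "w = 0" by (rule nondeg)
  qed
  then have sM: "surj M" using lM by (simp add: linear_injective_imp_surjective)
  show ex: "\<exists>w. \<forall>u. \<Omega> u w = u \<bullet> z" for z
    using surjD[OF sM, of z] M by metis
  assume P: "subspace P" and y: "\<And>w. (\<And>p. p \<in> P \<Longrightarrow> \<Omega> p w = 0) \<Longrightarrow> \<Omega> y w = 0"
  obtain p z where pz: "p \<in> span P" "\<And>q. q \<in> span P \<Longrightarrow> orthogonal z q" "y = p + z"
    using orthogonal_subspace_decomp_exists[of P y] by blast
  have sp: "span P = P" using P by (simp add: span_eq_iff)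
  obtain w where w: "\<And>u. \<Omega> u w = u \<bullet> z" using ex by blast
  have "\<Omega> q w = 0" if "q \<in> P" for q
    using pz(2)[of q] that by (simp add: w sp orthogonal_def inner_commute)
  then have "\<Omega> y w = 0" by (rule y)
  moreover have "\<Omega> y w = z \<bullet> z"
    using pz(2)[OF pz(1)] by (simp add: w pz(3) inner_add_left inner_add_right orthogonal_def inner_commute)
  ultimately show "y \<in> P" using pz(1,3) sp by simp
qed

text \<open>
  A maximal isotropic independent set \<open>E\<close> on whose span \<open>\<Omega>(u, J v)\<close> is nondegenerate is Lagrangian:
  in the complement of \<open>span E + J (span E)\<close> one could otherwise adjoin a vector \<open>v\<close> with
  \<open>\<Omega>(v, J v) \<noteq> 0\<close>, or, if there is none, two vectors with \<open>\<Omega>(v, w) = 0\<close> and \<open>\<Omega>(v, J w) \<noteq> 0\<close>.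
\<close>

lemma totally_real_Lagrangian_exists:
  fixes \<Omega> :: "'a::euclidean_space \<Rightarrow> 'a \<Rightarrow> real" and J :: "'a \<Rightarrow> 'a"
  assumes lin: "\<And>u. linear (\<Omega> u)" and alt: "\<And>u v. \<Omega> u v = - \<Omega> v u"
    and nondeg: "\<And>u. (\<And>v. \<Omega> u v = 0) \<Longrightarrow> u = 0"
    and J: "linear J" "\<And>v. J (J v) = - v"
  shows "\<exists>E. finite E \<and> independent E \<and> 2 * card E = DIM('a) \<and>
    (\<forall>u\<in>E. \<forall>v\<in>E. \<Omega> u v = 0) \<and> (\<forall>x\<in>span E. (\<forall>e\<in>E. \<Omega> e (J x) = 0) \<longrightarrow> x = 0) \<and>
    (\<forall>x. (\<forall>e\<in>E. \<Omega> e x = 0) \<longrightarrow> x \<in> span E)"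
proof -
  have lin': "linear (\<lambda>u. \<Omega> u w)" for w
    using linear_compose_neg[OF lin[of w]] by (simp add: alt[of _ w])
  have linJ: "linear (\<lambda>u. \<Omega> u' (J u))" "linear (\<lambda>u. \<Omega> (J u) w)" for w u'
    using linear_compose[OF J(1) lin] linear_compose[OF J(1) lin'] by (simp_all add: o_def)
  note L = linear_add[OF lin] linear_cmul[OF lin] linear_add[OF lin'] linear_cmul[OF lin']
    linear_add[OF J(1)] linear_cmul[OF J(1)] linear_0[OF lin] linear_0[OF lin'] linear_0[OF J(1)]
    linear_diff[OF lin] linear_diff[OF lin'] linear_diff[OF J(1)] linear_neg[OF lin]
  have diag: "\<Omega> u u = 0" for u using alt[of u u] by simp
  \<comment> \<open>\<Omega>(u, J v) is not symmetric in general, so triviality of its right kernel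
    and of its left kernel on span E are carried as two conditions.\<close>
  define R where "R E \<longleftrightarrow> (\<forall>x\<in>span E. (\<forall>e\<in>E. \<Omega> e (J x) = 0) \<longrightarrow> x = 0)" for E
  define Le where "Le E \<longleftrightarrow> (\<forall>x\<in>span E. (\<forall>e\<in>E. \<Omega> x (J e) = 0) \<longrightarrow> x = 0)" for E
  define good where "good E \<longleftrightarrow> independent E \<and> (\<forall>u\<in>E. \<forall>v\<in>E. \<Omega> u v = 0) \<and> R E \<and> Le E" for E
  have "\<exists>E. good E \<and> (\<forall>E'. good E' \<longrightarrow> card E' \<le> card E)"
  proof (rule ex_has_greatest_nat)
    show "good {}" by (simp add: good_def R_def Le_def independent_empty)
    show "\<forall>E. good E \<longrightarrow> card E < Suc DIM('a)"
      using independent_bound by (auto simp: good_def less_Suc_eq_le)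
  qed
  then obtain E where E: "good E" and max: "\<And>E'. good E' \<Longrightarrow> card E' \<le> card E" by blast
  have ind: "independent E" and iso: "\<And>u v. u \<in> E \<Longrightarrow> v \<in> E \<Longrightarrow> \<Omega> u v = 0"
    and RE: "\<And>x. x \<in> span E \<Longrightarrow> (\<And>e. e \<in> E \<Longrightarrow> \<Omega> e (J x) = 0) \<Longrightarrow> x = 0"
    and LE: "\<And>x. x \<in> span E \<Longrightarrow> (\<And>e. e \<in> E \<Longrightarrow> \<Omega> x (J e) = 0) \<Longrightarrow> x = 0"
    using E by (auto simp: good_def R_def Le_def)
  have fin: "finite E" using ind independent_bound by blast
  have Espan: "\<Omega> e k = 0" if "e \<in> E" "k \<in> span E" for e k
    by (rule linear_eq_0_on_span[OF lin _ that(2)]) (rule iso[OF that(1)])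
  \<comment> \<open>The \<Omega>-complement of span E + J (span E); maximality of E will force it to
    be zero.\<close>
  define perp where "perp v \<longleftrightarrow> (\<forall>e\<in>E. \<Omega> e v = 0 \<and> \<Omega> (J e) v = 0)" for v
  have perp_span: "\<Omega> k v = 0" "\<Omega> (J k) v = 0" "\<Omega> v k = 0" "\<Omega> v (J k) = 0" if "perp v" "k \<in> span E" for v k
  proof -
    show 1: "\<Omega> k v = 0"
      by (rule linear_eq_0_on_span[OF lin' _ that(2)]) (use that(1) in \<open>simp add: perp_def\<close>)
    show 2: "\<Omega> (J k) v = 0"
      by (rule linear_eq_0_on_span[OF linJ(2) _ that(2)]) (use that(1) in \<open>simp add: perp_def\<close>)
    show "\<Omega> v k = 0" "\<Omega> v (J k) = 0" using 1 2 alt[of v] by simp_all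
  qed
  define P where "P = {k + J k' |k k'. k \<in> span E \<and> k' \<in> span E}"
  have P: "subspace P"
    unfolding subspace_def
  proof (intro conjI ballI allI)
    have "0 = 0 + J 0" by (simp add: L)
    then show "0 \<in> P" unfolding P_def using span_zero by blast
    show "x + y \<in> P" if x: "x \<in> P" and y: "y \<in> P" for x y
    proof -
      obtain a b c d where "x = a + J b" "y = c + J d" "a \<in> span E" "b \<in> span E" "c \<in> span E" "d \<in> span E"
        using x y unfolding P_def by blast
      then have "x + y = (a + c) + J (b + d)" "a + c \<in> span E" "b + d \<in> span E"
        by (simp_all add: L span_add)
      then show ?thesis unfolding P_def by blast
    qed
    show "r *\<^sub>R x \<in> P" if x: "x \<in> P" for r x
    proof -
      obtain a b where "x = a + J b" "a \<in> span E" "b \<in> span E" using x unfolding P_def by blast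
      then have "r *\<^sub>R x = r *\<^sub>R a + J (r *\<^sub>R b)" "r *\<^sub>R a \<in> span E" "r *\<^sub>R b \<in> span E"
        by (simp_all add: L span_scale scaleR_add_right)
      then show ?thesis unfolding P_def by blast
    qed
  qed
  have EP: "e \<in> P" "J e \<in> P" if "e \<in> E" for e
  proof -
    have "e = e + J 0" "J e = 0 + J e" by (simp_all add: L)
    then show "e \<in> P" "J e \<in> P" unfolding P_def using span_base[OF that] span_zero by blast+
  qed
  have JP: "J x \<in> P" if xP: "x \<in> P" for x
  proof -
    obtain a b where "x = a + J b" "a \<in> span E" "b \<in> span E" using xP unfolding P_def by blast
    then have "J x = - b + J a" "- b \<in> span E" "a \<in> span E" by (simp_all add: L J(2) span_neg)
    then show ?thesis unfolding P_def by blast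
  qed
  have dperp: "y \<in> P" if "\<And>w. perp w \<Longrightarrow> \<Omega> y w = 0" for y
  proof (rule nondegenerate_form_double_perp(2)[OF lin alt nondeg P])
    show "\<Omega> y w = 0" if "\<And>p. p \<in> P \<Longrightarrow> \<Omega> p w = 0" for w
      using \<open>\<And>w. perp w \<Longrightarrow> \<Omega> y w = 0\<close> that EP by (simp add: perp_def)
  qed
  \<comment> \<open>Inside P an \<Omega>-complement of E lies in span E: the summand in J (span E)
    is removed by the right kernel condition.\<close>
  have Lag: "x \<in> span E" if xP: "x \<in> P" "\<And>e. e \<in> E \<Longrightarrow> \<Omega> e x = 0" for x
  proof -
    obtain k k' where k: "x = k + J k'" "k \<in> span E" "k' \<in> span E" using xP(1) unfolding P_def by blast
    have "k' = 0"
      using xP(2) Espan[OF _ k(2)] by (intro RE[OF k(3)]) (simp add: k(1) L)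
    then show ?thesis using k by (simp add: L)
  qed
  have perp0: "v = 0" if v: "perp v" for v
  proof (rule ccontr)
    assume v0: "v \<noteq> 0"
    have vE: "v \<notin> span E" if "perp v" "v \<noteq> 0" for v
      using LE[of v] perp_span(4)[OF that(1)] that(2) span_base by blast
    show False
    proof (cases "\<exists>v. perp v \<and> \<Omega> v (J v) \<noteq> 0")
      case True
      then obtain v where v: "perp v" "\<Omega> v (J v) \<noteq> 0" by blast
      have "v \<noteq> 0" using v(2) linear_0[OF lin'] by metis
      then have nv: "v \<notin> span E" by (rule vE[OF v(1)])
      have "good (insert v E)"
        unfolding good_def R_def Le_def
      proof (intro conjI ballI impI)
        show "independent (insert v E)" using nv ind by (simp add: independent_insert)
        show "\<Omega> x y = 0" if "x \<in> insert v E" "y \<in> insert v E" for x y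
          using that iso perp_span(1,3)[OF v(1) span_base] diag by auto
        fix x assume "x \<in> span (insert v E)"
        then obtain k where k: "x - k *\<^sub>R v \<in> span E" by (auto simp: span_breakdown_eq)
        define y where "y = x - k *\<^sub>R v"
        have x: "x = y + k *\<^sub>R v" "y \<in> span E" using k by (simp_all add: y_def)
        { assume *: "\<forall>e\<in>insert v E. \<Omega> e (J x) = 0"
          then have "\<Omega> v (J y) + k * \<Omega> v (J v) = 0" by (simp add: x(1) L)
          then have "k = 0" using v(2) perp_span(4)[OF v(1) x(2)] by simp
          then show "x = 0" using RE[OF x(2)] * x(1) by (simp add: L) }
        { assume *: "\<forall>e\<in>insert v E. \<Omega> x (J e) = 0"
          have "y = 0"
            using * perp_span(4)[OF v(1) span_base] by (intro LE[OF x(2)]) (simp add: x(1) L)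
          with * v(2) show "x = 0" by (simp add: x(1) L) }
      qed
      from max[OF this] show False using nv fin span_base[of v E] by (auto simp: card_insert_if split: if_splits)
    next
      case False
      then have q: "\<Omega> x (J x) = 0" if "perp x" for x using that by blast
      \<comment> \<open>Polarization of the quadratic form \<Omega>(x, J x), which vanishes on the
        complement.\<close>
      have pol: "\<Omega> x (J y) = - \<Omega> y (J x)" if "perp x" "perp y" for x y
      proof -
        have "perp (x + y)" using that by (simp add: perp_def L)
        from q[OF this] q[OF that(1)] q[OF that(2)] show ?thesis by (simp add: L)
      qed
      \<comment> \<open>Otherwise, on the complement, the functional of J v vanishes on the kernel
        of that of v, hence is c times it, and J v - c v lies in the double complement P. But P is
        J-invariant and J + c maps this vector to - (1 + c^2) v, so v itself would lie in P.\<close>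
      have "\<exists>w. perp w \<and> \<Omega> v w = 0 \<and> \<Omega> v (J w) \<noteq> 0"
      proof (rule ccontr)
        assume "\<not> ?thesis"
        then have ker: "\<Omega> (J v) w = 0" if "perp w" "\<Omega> v w = 0" for w
          using that pol[OF v that(1)] alt[of w "J v"] by auto
        have "\<exists>c. \<forall>w. perp w \<longrightarrow> \<Omega> (J v) w = c * \<Omega> v w"
        proof (cases "\<exists>w0. perp w0 \<and> \<Omega> v w0 \<noteq> 0")
          case True
          then obtain w0 where w0: "perp w0" "\<Omega> v w0 \<noteq> 0" by blast
          have "\<Omega> (J v) w = (\<Omega> (J v) w0 / \<Omega> v w0) * \<Omega> v w" if "perp w" for w
          proof -
            have "perp (w - (\<Omega> v w / \<Omega> v w0) *\<^sub>R w0)" using that w0(1) by (simp add: perp_def L)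
            from ker[OF this] show ?thesis using w0(2) by (simp add: L field_simps)
          qed
          then show ?thesis by blast
        next
          case False
          then show ?thesis using ker by (intro exI[of _ 0]) auto
        qed
        then obtain c where c: "\<And>w. perp w \<Longrightarrow> \<Omega> (J v) w = c * \<Omega> v w" by blast
        have yP: "J v - c *\<^sub>R v \<in> P" by (rule dperp) (simp add: L c)
        have "J (J v - c *\<^sub>R v) + c *\<^sub>R (J v - c *\<^sub>R v) \<in> P"
          by (intro subspace_add[OF P] subspace_scale[OF P] JP yP)
        also have "J (J v - c *\<^sub>R v) + c *\<^sub>R (J v - c *\<^sub>R v) = (- (1 + c * c)) *\<^sub>R v"
          by (simp add: L J(2) algebra_simps)
        finally have "(1 / (- (1 + c * c))) *\<^sub>R ((- (1 + c * c)) *\<^sub>R v) \<in> P" by (rule subspace_scale[OF P])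
        moreover have "1 + c * c \<noteq> 0" using zero_le_square[of c] by linarith
        ultimately have "v \<in> P" by simp
        then have "v \<in> span E" using v by (intro Lag) (auto simp: perp_def)
        then show False using vE[OF v v0] by simp
      qed
      then obtain w where w: "perp w" "\<Omega> v w = 0" "\<Omega> v (J w) \<noteq> 0" by blast
      have wv: "\<Omega> w (J v) = - \<Omega> v (J w)" "\<Omega> w v = 0" using pol[OF w(1) v] alt[of w v] w(2) by auto
      have nv: "v \<notin> span E" by (rule vE[OF v v0])
      have nw: "w \<notin> span (insert v E)"
      proof
        assume "w \<in> span (insert v E)"
        then obtain k where k: "w - k *\<^sub>R v \<in> span E" by (auto simp: span_breakdown_eq)
        have "\<Omega> v (J (w - k *\<^sub>R v)) = 0" by (rule perp_span(4)[OF v k])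
        then show False using w(3) q[OF v] by (simp add: L)
      qed
      have "good (insert w (insert v E))"
        unfolding good_def R_def Le_def
      proof (intro conjI ballI impI)
        show "independent (insert w (insert v E))" using nv nw ind by (simp add: independent_insert)
        show "\<Omega> x y = 0" if "x \<in> insert w (insert v E)" "y \<in> insert w (insert v E)" for x y
          using that iso perp_span(1,3)[OF v span_base] perp_span(1,3)[OF w(1) span_base] diag w(2) wv(2) by auto
        fix x assume "x \<in> span (insert w (insert v E))"
        then obtain l where "x - l *\<^sub>R w \<in> span (insert v E)" by (auto simp: span_breakdown_eq)
        then obtain k where k: "x - l *\<^sub>R w - k *\<^sub>R v \<in> span E" by (auto simp: span_breakdown_eq)
        define y where "y = x - l *\<^sub>R w - k *\<^sub>R v"
        have x: "x = y + k *\<^sub>R v + l *\<^sub>R w" "y \<in> span E" using k by (simp_all add: y_def)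
        { assume *: "\<forall>e\<in>insert w (insert v E). \<Omega> e (J x) = 0"
          then have "\<Omega> v (J y) + k * \<Omega> v (J v) + l * \<Omega> v (J w) = 0" "\<Omega> w (J y) + k * \<Omega> w (J v) + l * \<Omega> w (J w) = 0"
            by (simp_all add: x(1) L)
          then have "l = 0" "k = 0"
            using w(3) wv q[OF v] q[OF w(1)] perp_span(4)[OF v x(2)] perp_span(4)[OF w(1) x(2)] by simp_all
          then show "x = 0" using RE[OF x(2)] * x(1) by (simp add: L) }
        { assume *: "\<forall>e\<in>insert w (insert v E). \<Omega> x (J e) = 0"
          have "y = 0"
            using * perp_span(4)[OF v span_base] perp_span(4)[OF w(1) span_base]
            by (intro LE[OF x(2)]) (simp add: x(1) L)
          with * have "k * \<Omega> v (J v) + l * \<Omega> w (J v) = 0" "k * \<Omega> v (J w) + l * \<Omega> w (J w) = 0"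
            by (simp_all add: x(1) L)
          then have "l = 0" "k = 0" using w(3) wv q[OF v] q[OF w(1)] by simp_all
          with \<open>y = 0\<close> show "x = 0" by (simp add: x(1)) }
      qed
      from max[OF this] show False
        using nv nw fin span_base[of v E] span_base[of w "insert v E"] by (auto simp: card_insert_if split: if_splits)
    qed
  qed
  have PU: "y \<in> P" for y
    by (rule dperp) (drule perp0, simp add: linear_0[OF lin])
  \<comment> \<open>The whole space is the direct sum of span E and J (span E), which have equal
    dimension.\<close>
  have card: "2 * card E = DIM('a)"
  proof -
    have injJ: "inj J" using J by (metis injI neg_equal_iff_equal)
    have sub: "subspace (J ` span E)" by (rule linear_subspace_image[OF J(1) subspace_span])
    have "{x + y |x y. x \<in> span E \<and> y \<in> J ` span E} = UNIV"
      using PU unfolding P_def by blast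
    moreover have "span E \<inter> J ` span E = {0}"
    proof -
      have "k' = 0" if "J k' \<in> span E" "k' \<in> span E" for k'
        using RE[OF that(2)] Espan[OF _ that(1)] by blast
      then show ?thesis using span_zero[of E] linear_0[OF J(1)] by (auto simp: image_iff)
    qed
    moreover have "dim (J ` span E) = dim (span E)"
      using dim_image_eq[OF J(1), of "span E"] inj_on_subset[OF injJ] by simp
    moreover have "dim (span E) = card E" using dim_span_eq_card_independent[OF ind] by simp
    ultimately show ?thesis
      using dim_sums_Int[OF subspace_span[of E] sub] by simp
  qed
  show ?thesis
    by (rule exI[of _ E]) (use fin ind card iso RE Lag[OF PU] in auto)
qed

text \<open>The Lagrangian basis e is completed to a symplectic basis (e, f), and L reads off
  coordinates in it. The real parts of L vanish exactly on the Lagrangian subspace, so the last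
  property is its total reality: no nonzero v has both v and J v in it. The factor 2 matches that of
  the induced form.\<close>

lemma adapted_symplectic_coordinates:
  fixes \<Omega> :: "complex^'n \<Rightarrow> complex^'n \<Rightarrow> real"
  assumes lin: "\<And>u. linear (\<Omega> u)" and alt: "\<And>u v. \<Omega> u v = - \<Omega> v u"
    and nondeg: "\<And>u. (\<And>v. \<Omega> u v = 0) \<Longrightarrow> u = 0"
  obtains L :: "complex^'n \<Rightarrow> complex^'n" where "linear L"
    "\<And>u v. \<Omega> u v = 2 * (\<Sum>i\<in>UNIV. Re (L u $ i) * Im (L v $ i) - Re (L v $ i) * Im (L u $ i))"
    "\<And>v. (\<And>i. Re (L v $ i) = 0) \<Longrightarrow> (\<And>i. Re (L (imul v) $ i) = 0) \<Longrightarrow> v = 0"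
proof -
  have linJ: "linear (imul :: complex^'n \<Rightarrow> complex^'n)"
    by (rule linearI) (simp_all add: imul_def vec_eq_iff algebra_simps)
  have JJ: "imul (imul v) = - v" for v :: "complex^'n"
    by (simp add: imul_def vec_eq_iff)
  have lin': "linear (\<lambda>u. \<Omega> u w)" for w
    using linear_compose_neg[OF lin[of w]] by (simp add: alt[of _ w])
  note L = linear_add[OF lin] linear_cmul[OF lin] linear_add[OF lin'] linear_cmul[OF lin']
    linear_diff[OF lin] linear_diff[OF lin'] linear_sum[OF lin] linear_sum[OF lin']
  obtain E where E: "finite E \<and> independent E \<and> 2 * card E = DIM(complex^'n) \<and>
    (\<forall>u\<in>E. \<forall>v\<in>E. \<Omega> u v = 0) \<and> (\<forall>x\<in>span E. (\<forall>e\<in>E. \<Omega> e (imul x) = 0) \<longrightarrow> x = 0) \<and>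
    (\<forall>x. (\<forall>e\<in>E. \<Omega> e x = 0) \<longrightarrow> x \<in> span E)"
    by (rule exE[OF totally_real_Lagrangian_exists[OF lin alt nondeg linJ JJ]])
  then have fin: "finite E" and ind: "independent E" and card: "2 * card E = DIM(complex^'n)"
    and iso: "\<And>u v. u \<in> E \<Longrightarrow> v \<in> E \<Longrightarrow> \<Omega> u v = 0"
    and tr: "\<And>x. x \<in> span E \<Longrightarrow> (\<And>e. e \<in> E \<Longrightarrow> \<Omega> e (imul x) = 0) \<Longrightarrow> x = 0"
    and Lag: "\<And>x. (\<And>e. e \<in> E \<Longrightarrow> \<Omega> e x = 0) \<Longrightarrow> x \<in> span E"
    by simp_all
  have "card E = CARD('n)" using card by simp
  then obtain e :: "'n \<Rightarrow> complex^'n" where e: "bij_betw e UNIV E"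
    using finite_same_card_bij[OF finite fin] by metis
  have eE: "e i \<in> E" for i using e by (auto simp: bij_betw_def)
  have inje: "e i = e j \<longleftrightarrow> i = j" for i j using e by (auto simp: bij_betw_def inj_on_def)
  have Ee: "\<exists>i. x = e i" if "x \<in> E" for x using e that by (auto simp: bij_betw_def)
  have "\<exists>g. \<forall>i. \<Omega> (e i) g = (if i = j then 1 else 0)" for j
  proof -
    obtain \<phi> :: "complex^'n \<Rightarrow> real" where \<phi>: "linear \<phi>" "\<And>x. x \<in> E \<Longrightarrow> \<phi> x = (if x = e j then 1 else 0)"
      using linear_independent_extend[OF ind, of "\<lambda>x. if x = e j then 1 else 0"] by blast
    obtain g where g: "\<And>u. \<Omega> u g = u \<bullet> (\<Sum>b\<in>Basis. \<phi> b *\<^sub>R b)"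
      using nondegenerate_form_double_perp(1)[OF lin alt nondeg] by metis
    have "\<Omega> u g = \<phi> u" for u
      using linear_sum_Basis[OF \<phi>(1), of u] by (simp add: g inner_sum_right mult.commute)
    then show ?thesis using \<phi>(2)[OF eE] inje by (intro exI[of _ g]) simp
  qed
  then obtain g where g: "\<And>i j. \<Omega> (e i) (g j) = (if i = j then 1 else 0)" by metis
  have g': "\<Omega> (g j) (e i) = - (if i = j then 1 else 0)" for i j using alt[of "g j" "e i"] g by simp
  \<comment> \<open>Correction by half the mutual pairings makes the f isotropic and leaves their
    pairing with the e unchanged.\<close>
  define c where "c j k = - \<Omega> (g j) (g k) / 2" for j k
  define f where "f j = g j + (\<Sum>k\<in>UNIV. c j k *\<^sub>R e k)" for j
  have ef: "\<Omega> (e i) (f j) = (if i = j then 1 else 0)" for i j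
    using iso[OF eE eE] by (simp add: f_def L g)
  have ff: "\<Omega> (f i) (f j) = 0" for i j
  proof -
    have "\<Omega> (f i) (f j) = \<Omega> (g i) (f j) + (\<Sum>k\<in>UNIV. c i k * \<Omega> (e k) (f j))"
      unfolding f_def[of i] by (simp add: L)
    also have "\<dots> = \<Omega> (g i) (g j) - c j i + c i j"
      by (simp add: ef) (simp add: f_def L g' sum_negf if_distrib[of "\<lambda>x. _ * x"] cong: if_cong)
    also have "\<dots> = 0" using alt[of "g j" "g i"] by (simp add: c_def)
    finally show ?thesis .
  qed
  \<comment> \<open>The difference x of the two sides pairs to zero with all e, so it lies in span
    E, and to zero with all f, so its coefficients vanish.\<close>
  have rep: "v = (\<Sum>j\<in>UNIV. \<Omega> (e j) v *\<^sub>R f j) + (\<Sum>j\<in>UNIV. \<Omega> v (f j) *\<^sub>R e j)" for v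
  proof -
    define x where "x = v - ((\<Sum>j\<in>UNIV. \<Omega> (e j) v *\<^sub>R f j) + (\<Sum>j\<in>UNIV. \<Omega> v (f j) *\<^sub>R e j))"
    have "\<Omega> (e i) x = 0" for i
      by (simp add: x_def L ef iso[OF eE eE] if_distrib[of "\<lambda>x. _ * x"] cong: if_cong)
    then have "x \<in> span E" using Ee by (intro Lag) metis
    then obtain u where "x = (\<Sum>b\<in>E. u b *\<^sub>R b)" using span_finite[OF fin] by auto
    then have xu: "x = (\<Sum>j\<in>UNIV. u (e j) *\<^sub>R e j)"
      using sum.reindex_bij_betw[OF e, of "\<lambda>b. u b *\<^sub>R b"] by simp
    have "\<Omega> x (f i) = 0" for i
      by (simp add: x_def L ef ff if_distrib[of "\<lambda>x. _ * x"] cong: if_cong)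
    moreover have "\<Omega> x (f i) = u (e i)" for i
      unfolding xu by (simp add: L ef if_distrib[of "\<lambda>x. _ * x"] cong: if_cong)
    ultimately have "x = 0" using xu by simp
    then show ?thesis by (simp add: x_def)
  qed
  \<comment> \<open>Halving the real part produces the factor 2 in the normal form, and the minus
    sign gives the form its required sign.\<close>
  define Lm where "Lm v = (\<chi> j. Complex (- \<Omega> (e j) v / 2) (\<Omega> v (f j)))" for v
  show ?thesis
  proof (rule that[of Lm])
    show "linear Lm"
      by (rule linearI) (simp_all add: Lm_def vec_eq_iff complex_eq_iff L field_simps)
    show "\<Omega> u v = 2 * (\<Sum>i\<in>UNIV. Re (Lm u $ i) * Im (Lm v $ i) - Re (Lm v $ i) * Im (Lm u $ i))" for u v
    proof -
      have "\<Omega> u v = (\<Sum>j\<in>UNIV. \<Omega> (e j) u * \<Omega> (f j) v) + (\<Sum>j\<in>UNIV. \<Omega> u (f j) * \<Omega> (e j) v)"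
        by (subst rep[of u]) (simp add: L)
      also have "\<dots> = 2 * (\<Sum>i\<in>UNIV. Re (Lm u $ i) * Im (Lm v $ i) - Re (Lm v $ i) * Im (Lm u $ i))"
        by (simp add: Lm_def alt[of "f _" v] sum_distrib_left sum.distrib[symmetric] sum_subtractf[symmetric] algebra_simps)
      finally show ?thesis .
    qed
    show "v = 0" if "\<And>i. Re (Lm v $ i) = 0" "\<And>i. Re (Lm (imul v) $ i) = 0" for v
    proof (rule tr)
      have 1: "\<Omega> (e i) v = 0" "\<Omega> (e i) (imul v) = 0" for i using that by (simp_all add: Lm_def)
      show "v \<in> span E" using Ee 1 by (intro Lag) metis
      show "\<Omega> x (imul v) = 0" if "x \<in> E" for x using Ee[OF that] 1 by metis
    qed
  qed
qed

section \<open>Charts and tangent vectors\<close>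

lemma linear_imul: "linear (imul :: complex^'n \<Rightarrow> complex^'n)"
  by (rule linearI) (simp_all add: imul_def vec_eq_iff algebra_simps)

lemma imul_imul [simp]: "imul (imul v) = - v"
  by (simp add: imul_def vec_eq_iff)

text \<open>\<open>frechet_derivative\<close> picks some derivative; functions agreeing near x have
  the same candidates, so the picks agree even where no derivative exists.\<close>

lemma frechet_derivative_cong_open:
  assumes "open S" "x \<in> S" "\<And>y. y \<in> S \<Longrightarrow> f y = g y"
  shows "frechet_derivative f (at x) = frechet_derivative g (at x)"
proof -
  have "(f has_derivative D) (at x) \<longleftrightarrow> (g has_derivative D) (at x)" for D
    using has_derivative_transform_within_open[OF _ assms(1,2), of f D UNIV g]
      has_derivative_transform_within_open[OF _ assms(1,2), of g D UNIV f] assms(3) by auto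
  then show ?thesis by (simp add: frechet_derivative_def)
qed

definition transition_deriv :: "('m, 'n::finite) chart \<Rightarrow> ('m, 'n) chart \<Rightarrow> 'm \<Rightarrow> complex^'n \<Rightarrow> complex^'n" where
  "transition_deriv c d q = frechet_derivative (snd d \<circ> chart_inv c) (at (snd c q))"

text \<open>Inverse of taking the component in the chart c. The zero entries follow the convention
  of \<open>tangent_space\<close>, so that tangent vectors can be compared as functions.\<close>

definition chart_tvec :: "('m, 'n::finite) chart set \<Rightarrow> ('m, 'n) chart \<Rightarrow> 'm \<Rightarrow> complex^'n \<Rightarrow> ('m, 'n) tvec" where
  "chart_tvec A c q w = (\<lambda>d. if d \<in> A \<and> q \<in> fst d then transition_deriv c d q w else 0)"

locale holomorphic_atlas =
  fixes A :: "('m::{t2_space, second_countable_topology}, 'n::finite) chart set"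
  assumes complex_manifold: "complex_manifold A"
begin

lemma open_chart: "c \<in> A \<Longrightarrow> open (fst c)" "c \<in> A \<Longrightarrow> open (snd c ` fst c)"
  using complex_manifold by (auto simp: complex_manifold_def)

lemma chart_homeomorphism: "c \<in> A \<Longrightarrow> homeomorphism (fst c) (snd c ` fst c) (snd c) (chart_inv c)"
  using complex_manifold by (auto simp: complex_manifold_def)

lemma chart_inv_left [simp]: "c \<in> A \<Longrightarrow> q \<in> fst c \<Longrightarrow> chart_inv c (snd c q) = q"
  using chart_homeomorphism by (simp add: homeomorphism_def)

lemma chart_inv_right: "c \<in> A \<Longrightarrow> z \<in> snd c ` fst c \<Longrightarrow> snd c (chart_inv c z) = z"
  "c \<in> A \<Longrightarrow> z \<in> snd c ` fst c \<Longrightarrow> chart_inv c z \<in> fst c"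
  by auto

lemma open_chart_image:
  assumes c: "c \<in> A" and N: "open N" "N \<subseteq> fst c"
  shows "open (snd c ` N)"
proof -
  have "snd c ` N = snd c ` fst c \<inter> chart_inv c -` N"
    using N(2) c by force
  moreover have "continuous_on (snd c ` fst c) (chart_inv c)"
    using chart_homeomorphism[OF c] by (simp add: homeomorphism_def)
  ultimately show ?thesis
    using continuous_open_preimage[OF _ open_chart(2)[OF c] N(1)] by simp
qed

lemma transition_holo: "c \<in> A \<Longrightarrow> d \<in> A \<Longrightarrow> holo imul imul (snd d \<circ> chart_inv c) (snd c ` (fst c \<inter> fst d))"
  using complex_manifold by (auto simp: complex_manifold_def)

lemma open_overlap: "c \<in> A \<Longrightarrow> d \<in> A \<Longrightarrow> open (snd c ` (fst c \<inter> fst d))"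
  by (intro open_chart_image) (auto simp: open_chart)

lemma transition_Ck_on: "c \<in> A \<Longrightarrow> d \<in> A \<Longrightarrow> Ck_on k (snd c ` (fst c \<inter> fst d)) (snd d \<circ> chart_inv c)"
  by (intro holo_imp_Ck_on[OF _ linear_imul transition_holo] open_overlap)

lemma transition_has_derivative:
  assumes "c \<in> A" "d \<in> A" "q \<in> fst c" "q \<in> fst d"
  shows "((snd d \<circ> chart_inv c) has_derivative transition_deriv c d q) (at (snd c q))"
    and "transition_deriv c d q (imul w) = imul (transition_deriv c d q w)"
  using holoD[OF transition_holo[OF assms(1,2)], of "snd c q"] assms by (auto simp: transition_deriv_def)

lemma linear_transition_deriv:
  "c \<in> A \<Longrightarrow> d \<in> A \<Longrightarrow> q \<in> fst c \<Longrightarrow> q \<in> fst d \<Longrightarrow> linear (transition_deriv c d q)"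
  using transition_has_derivative(1) has_derivative_linear by blast

lemma transition_deriv_cocycle:
  assumes "c \<in> A" "d \<in> A" "e \<in> A" "q \<in> fst c" "q \<in> fst d" "q \<in> fst e"
  shows "transition_deriv d e q (transition_deriv c d q w) = transition_deriv c e q w"
proof -
  have q: "(snd d \<circ> chart_inv c) (snd c q) = snd d q" using assms by simp
  have "(((snd e \<circ> chart_inv d) \<circ> (snd d \<circ> chart_inv c)) has_derivative
      (transition_deriv d e q \<circ> transition_deriv c d q)) (at (snd c q))"
    by (rule diff_chain_at) (use assms transition_has_derivative(1) q in simp_all)
  then have "((snd e \<circ> chart_inv c) has_derivative (transition_deriv d e q \<circ> transition_deriv c d q)) (at (snd c q))"
    by (rule has_derivative_transform_within_open[OF _ open_overlap[OF assms(1,2)]])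
      (use assms in auto)
  then show ?thesis by (simp add: transition_deriv_def[of c e] frechet_derivative_eq)
qed

lemma transition_deriv_self:
  assumes "c \<in> A" "q \<in> fst c"
  shows "transition_deriv c c q w = w"
proof -
  have "((snd c \<circ> chart_inv c) has_derivative (\<lambda>v. v)) (at (snd c q))"
    by (rule has_derivative_transform_within_open[OF has_derivative_ident open_chart(2)[OF assms(1)]])
      (use assms in auto)
  then show ?thesis by (simp add: transition_deriv_def frechet_derivative_eq)
qed

lemma chart_tvec_in_tangent_space: "c \<in> A \<Longrightarrow> q \<in> fst c \<Longrightarrow> chart_tvec A c q w \<in> tangent_space A q"
  using transition_deriv_cocycle
  by (auto simp: tangent_space_def chart_tvec_def transition_deriv_def[symmetric])

lemma chart_tvec_component [simp]: "c \<in> A \<Longrightarrow> q \<in> fst c \<Longrightarrow> chart_tvec A c q w c = w"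
  by (simp add: chart_tvec_def transition_deriv_self)

lemma tangent_space_transition:
  "v \<in> tangent_space A q \<Longrightarrow> c \<in> A \<Longrightarrow> d \<in> A \<Longrightarrow> q \<in> fst c \<Longrightarrow> q \<in> fst d \<Longrightarrow> v d = transition_deriv c d q (v c)"
  unfolding tangent_space_def transition_deriv_def by blast

lemma tangent_space_zero: "v \<in> tangent_space A q \<Longrightarrow> \<not> (c \<in> A \<and> q \<in> fst c) \<Longrightarrow> v c = 0"
  unfolding tangent_space_def by blast

lemma tangent_spaceI:
  "(\<And>c d. c \<in> A \<Longrightarrow> d \<in> A \<Longrightarrow> q \<in> fst c \<Longrightarrow> q \<in> fst d \<Longrightarrow> v d = transition_deriv c d q (v c)) \<Longrightarrow>
   (\<And>c. \<not> (c \<in> A \<and> q \<in> fst c) \<Longrightarrow> v c = 0) \<Longrightarrow> v \<in> tangent_space A q"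
  unfolding tangent_space_def transition_deriv_def by blast

lemma tangent_space_eq_chart_tvec:
  assumes "c \<in> A" "q \<in> fst c" "v \<in> tangent_space A q"
  shows "v = chart_tvec A c q (v c)"
proof
  show "v d = chart_tvec A c q (v c) d" for d
  proof (cases "d \<in> A \<and> q \<in> fst d")
    case True
    then show ?thesis
      using tangent_space_transition[OF assms(3,1) _ assms(2), of d] by (simp add: chart_tvec_def)
  next
    case False
    then have "chart_tvec A c q w d = 0" for w unfolding chart_tvec_def by auto
    then show ?thesis using tangent_space_zero[OF assms(3) False] by simp
  qed
qed

lemma tangent_space_eqI:
  "c \<in> A \<Longrightarrow> q \<in> fst c \<Longrightarrow> u \<in> tangent_space A q \<Longrightarrow> v \<in> tangent_space A q \<Longrightarrow> u c = v c \<Longrightarrow> u = v"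
  using tangent_space_eq_chart_tvec by metis

lemma tangent_space_lincomb:
  assumes "u \<in> tangent_space A q" "v \<in> tangent_space A q"
  shows "(\<lambda>c. a *\<^sub>R u c + b *\<^sub>R v c) \<in> tangent_space A q"
proof -
  have "a *\<^sub>R u d + b *\<^sub>R v d = transition_deriv c d q (a *\<^sub>R u c + b *\<^sub>R v c)"
    if "c \<in> A" "d \<in> A" "q \<in> fst c" "q \<in> fst d" for c d
    using assms[THEN tangent_space_transition, OF that] linear_transition_deriv[OF that]
    by (simp add: linear_add linear_cmul)
  then show ?thesis
    using assms[THEN tangent_space_zero] by (intro tangent_spaceI) (blast, simp)
qed

lemma chart_tvec_lincomb:
  "c \<in> A \<Longrightarrow> q \<in> fst c \<Longrightarrow>
   chart_tvec A c q (a *\<^sub>R v + b *\<^sub>R w) = (\<lambda>d. a *\<^sub>R chart_tvec A c q v d + b *\<^sub>R chart_tvec A c q w d)"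
  by (rule tangent_space_eqI[of c]) (auto intro: chart_tvec_in_tangent_space tangent_space_lincomb)

lemma chart_at: "q \<in> mfd_carrier A \<Longrightarrow> chart_at A q \<in> A \<and> q \<in> fst (chart_at A q)"
  unfolding chart_at_def mfd_carrier_def by (rule someI_ex) auto

lemma has_derivative_change_chart:
  assumes c: "c \<in> A" "q \<in> fst c" and d: "d \<in> A" "q \<in> fst d"
    and f: "((f \<circ> chart_inv c) has_derivative D) (at (snd c q))"
  shows "((f \<circ> chart_inv d) has_derivative (\<lambda>w. D (transition_deriv d c q w))) (at (snd d q))"
proof -
  have q: "(snd c \<circ> chart_inv d) (snd d q) = snd c q" using c d by simp
  have "((f \<circ> chart_inv c \<circ> (snd c \<circ> chart_inv d)) has_derivative (D \<circ> transition_deriv d c q)) (at (snd d q))"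
    by (rule diff_chain_at) (use c d transition_has_derivative(1) q f in simp_all)
  then have "((f \<circ> chart_inv d) has_derivative (D \<circ> transition_deriv d c q)) (at (snd d q))"
    by (rule has_derivative_transform_within_open[OF _ open_overlap[OF d(1) c(1)]])
      (use c d in auto)
  then show ?thesis by (simp add: o_def)
qed

text \<open>\<open>deriv_at\<close> computes in a chart picked by choice; by the chain rule for the
  coordinate change any chart containing the point may be used.\<close>

lemma deriv_at_chart:
  assumes c: "c \<in> A" "q \<in> fst c" and v: "v \<in> tangent_space A q"
    and f: "((f \<circ> chart_inv c) has_derivative D) (at (snd c q))"
  shows "deriv_at A q v f = D (v c)"
proof -
  have "q \<in> mfd_carrier A" using c by (auto simp: mfd_carrier_def)
  note d = chart_at[OF this]
  show ?thesis
    using has_derivative_change_chart[OF c d[THEN conjunct1] d[THEN conjunct2] f]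
      tangent_space_transition[OF v d[THEN conjunct1] c(1) d[THEN conjunct2] c(2)]
    by (simp add: deriv_at_def Let_def frechet_derivative_eq)
qed

text \<open>Smoothness is demanded in all charts, but coordinate changes are holomorphic, hence
  smooth, so one chart decides.\<close>

lemma smooth_funI:
  fixes f :: "'m \<Rightarrow> real"
  assumes c: "c \<in> A" and N: "open N" "N \<subseteq> fst c" and f: "\<And>k. Ck_on k (snd c ` N) (f \<circ> chart_inv c)"
  shows "smooth_fun A N f"
  unfolding smooth_fun_def smooth_on_def
proof (intro ballI allI)
  fix d k assume d: "d \<in> A"
  let ?S = "snd d ` (fst d \<inter> N)"
  have S: "open ?S" using d N by (intro open_chart_image) (auto simp: open_chart)
  have "Ck_on k ?S (\<lambda>z. (f \<circ> chart_inv c) ((snd c \<circ> chart_inv d) z))"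
    by (rule Ck_on_compose[OF S open_chart_image[OF c N] _ Ck_on_subset[OF transition_Ck_on[OF d c]] f])
      (use d N in auto)
  then show "Ck_on k ?S (f \<circ> chart_inv d)"
    by (rule Ck_on_cong[OF S, rotated]) (use c d N in auto)
qed

text \<open>As for functions, with the derivative of the coordinate change as an additional smooth
  factor.\<close>

lemma smooth_vfieldI:
  assumes c: "c \<in> A" and N: "open N" "N \<subseteq> fst c" and x: "\<And>k. Ck_on k (snd c ` N) x"
  shows "smooth_vfield A N (\<lambda>q. chart_tvec A c q (x (snd c q)))"
  unfolding smooth_vfield_def smooth_on_def
proof (intro conjI ballI allI)
  show "chart_tvec A c q (x (snd c q)) \<in> tangent_space A q" if "q \<in> N" for q
    using c N that by (intro chart_tvec_in_tangent_space) auto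
  fix d k assume d: "d \<in> A"
  let ?S = "snd d ` (fst d \<inter> N)"
  let ?\<tau> = "snd c \<circ> chart_inv d"
  have S: "open ?S" using d N by (intro open_chart_image) (auto simp: open_chart)
  have T: "?\<tau> ` ?S \<subseteq> snd c ` N" "?\<tau> ` ?S \<subseteq> snd c ` (fst c \<inter> fst d)" using d N by auto
  have \<tau>: "Ck_on k ?S ?\<tau>" using N by (intro Ck_on_subset[OF transition_Ck_on[OF d c]]) auto
  have "Ck_on k ?S (\<lambda>z. frechet_derivative (snd d \<circ> chart_inv c) (at (?\<tau> z)) (x (?\<tau> z)))"
  proof (rule Ck_on_linear_family[where A="\<lambda>z. frechet_derivative (snd d \<circ> chart_inv c) (at (?\<tau> z))", OF S])
    show "linear (frechet_derivative (snd d \<circ> chart_inv c) (at (?\<tau> z)))" if "z \<in> ?S" for z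
      using holoD(1)[OF transition_holo[OF c d], of "?\<tau> z"] T(2) that
      by (intro has_derivative_linear) auto
    show "Ck_on k ?S (\<lambda>z. frechet_derivative (snd d \<circ> chart_inv c) (at (?\<tau> z)) b)" for b
      by (rule Ck_on_compose[OF S open_overlap[OF c d] T(2) \<tau>, of "\<lambda>y. frechet_derivative (snd d \<circ> chart_inv c) (at y) b"])
        (rule Ck_on_frechet_derivative[OF transition_Ck_on[OF c d]])
    show "Ck_on k ?S (\<lambda>z. x (?\<tau> z))"
      by (rule Ck_on_compose[OF S open_chart_image[OF c N] T(1) \<tau> x])
  qed
  then show "Ck_on k ?S (\<lambda>z. chart_tvec A c (chart_inv d z) (x (snd c (chart_inv d z))) d)"
    by (rule Ck_on_cong[OF S, rotated]) (use c d N in \<open>auto simp: chart_tvec_def transition_deriv_def\<close>)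
qed

lemma smooth_vfieldD:
  assumes "smooth_vfield A S X"
  shows "q \<in> S \<Longrightarrow> X q \<in> tangent_space A q"
    and "c \<in> A \<Longrightarrow> S \<subseteq> fst c \<Longrightarrow> Ck_on k (snd c ` S) (\<lambda>z. X (chart_inv c z) c)"
  using assms by (auto simp: smooth_vfield_def smooth_on_def Int_absorb1)

lemma smooth_vfield_subset: "smooth_vfield A S X \<Longrightarrow> T \<subseteq> S \<Longrightarrow> smooth_vfield A T X"
  unfolding smooth_vfield_def smooth_on_def
  by (meson Ck_on_subset Int_mono image_mono order_refl subsetD)

lemma smooth_vfield_add:
  assumes S: "open S" and X: "smooth_vfield A S X" and Y: "smooth_vfield A S Y"
  shows "smooth_vfield A S (\<lambda>q c. X q c + Y q c)"
  unfolding smooth_vfield_def smooth_on_def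
proof (intro conjI ballI allI)
  show "(\<lambda>c. X q c + Y q c) \<in> tangent_space A q" if "q \<in> S" for q
    using tangent_space_lincomb[of "X q" q "Y q" 1 1] X Y that by (simp add: smooth_vfield_def)
  show "Ck_on k (snd c ` (fst c \<inter> S)) (\<lambda>z. X (chart_inv c z) c + Y (chart_inv c z) c)" if "c \<in> A" for c k
    using X Y that S
    by (intro Ck_on_add open_chart_image) (auto simp: smooth_vfield_def smooth_on_def open_chart)
qed

lemma smooth_vfield_scale:
  assumes S: "open S" and X: "smooth_vfield A S X" and f: "smooth_fun A S f"
  shows "smooth_vfield A S (\<lambda>q c. f q *\<^sub>R X q c)"
  unfolding smooth_vfield_def smooth_on_def
proof (intro conjI ballI allI)
  show "(\<lambda>c. f q *\<^sub>R X q c) \<in> tangent_space A q" if "q \<in> S" for q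
    using tangent_space_lincomb[of "X q" q "X q" "f q" 0] X that by (simp add: smooth_vfield_def)
  show "Ck_on k (snd c ` (fst c \<inter> S)) (\<lambda>z. f (chart_inv c z) *\<^sub>R X (chart_inv c z) c)" if "c \<in> A" for c k
    using X f that S
    by (intro Ck_on_bilinear[OF _ bounded_bilinear_scaleR] open_chart_image)
      (auto simp: smooth_vfield_def smooth_fun_def smooth_on_def open_chart o_def)
qed

end

section \<open>Christoffel symbols\<close>

locale atlas_connection = holomorphic_atlas A
  for A :: "('m::{t2_space, second_countable_topology}, 'n::finite) chart set" +
  fixes nabla :: "('m, 'n) conn"
  assumes connection: "connection A nabla"
begin

definition christoffel :: "('m, 'n) chart \<Rightarrow> complex^'n \<Rightarrow> complex^'n \<Rightarrow> complex^'n \<Rightarrow> complex^'n" where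
  "christoffel c z v w =
     nabla (chart_inv c z) (chart_tvec A c (chart_inv c z) v) (\<lambda>q. chart_tvec A c q w) c"

lemma carrier: "c \<in> A \<Longrightarrow> fst c \<subseteq> mfd_carrier A"
  by (auto simp: mfd_carrier_def)

lemma smooth_fun_const: "smooth_fun A S (\<lambda>_. r)"
  by (simp add: smooth_fun_def smooth_on_def o_def Ck_on_const)

lemma
  assumes S: "open S" "S \<subseteq> mfd_carrier A" and X: "smooth_vfield A S X"
  shows nabla_smooth: "smooth_vfield A S Y \<Longrightarrow> smooth_vfield A S (\<lambda>q. nabla q (Y q) X)"
    and nabla_local: "p \<in> S \<Longrightarrow> v \<in> tangent_space A p \<Longrightarrow> smooth_vfield A S Y \<Longrightarrow>
      (\<And>q. q \<in> S \<Longrightarrow> X q = Y q) \<Longrightarrow> nabla p v X = nabla p v Y"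
    and nabla_tangent: "p \<in> S \<Longrightarrow> v \<in> tangent_space A p \<Longrightarrow> nabla p v X \<in> tangent_space A p"
    and nabla_lincomb: "p \<in> S \<Longrightarrow> v \<in> tangent_space A p \<Longrightarrow> w \<in> tangent_space A p \<Longrightarrow>
      nabla p (\<lambda>c. a *\<^sub>R v c + b *\<^sub>R w c) X = (\<lambda>c. a *\<^sub>R nabla p v X c + b *\<^sub>R nabla p w X c)"
    and nabla_add: "p \<in> S \<Longrightarrow> v \<in> tangent_space A p \<Longrightarrow> smooth_vfield A S Y \<Longrightarrow>
      nabla p v (\<lambda>q c. X q c + Y q c) = (\<lambda>c. nabla p v X c + nabla p v Y c)"
    and nabla_scale: "p \<in> S \<Longrightarrow> v \<in> tangent_space A p \<Longrightarrow> smooth_fun A S f \<Longrightarrow>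
      nabla p v (\<lambda>q c. f q *\<^sub>R X q c) = (\<lambda>c. deriv_at A p v f *\<^sub>R X p c + f p *\<^sub>R nabla p v X c)"
proof -
  \<comment> \<open>The axioms come in one bundle over X, Y and f; a constant function, or X itself,
    fills the slots that a clause does not mention.\<close>
  note * = connection[unfolded connection_def, rule_format, of S X, OF conjI[OF S]]
  show "smooth_vfield A S (\<lambda>q. nabla q (Y q) X)" if "smooth_vfield A S Y"
    using *[OF conjI[OF X conjI[OF that smooth_fun_const]]] by blast
  show "nabla p v X = nabla p v Y"
    if "p \<in> S" "v \<in> tangent_space A p" "smooth_vfield A S Y" "\<And>q. q \<in> S \<Longrightarrow> X q = Y q"
    using *[OF conjI[OF X conjI[OF that(3) smooth_fun_const]]] that by blast
  show "nabla p v X \<in> tangent_space A p" if "p \<in> S" "v \<in> tangent_space A p"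
    using *[OF conjI[OF X conjI[OF X smooth_fun_const]]] that by blast
  show "nabla p (\<lambda>c. a *\<^sub>R v c + b *\<^sub>R w c) X = (\<lambda>c. a *\<^sub>R nabla p v X c + b *\<^sub>R nabla p w X c)"
    if "p \<in> S" "v \<in> tangent_space A p" "w \<in> tangent_space A p"
    using *[OF conjI[OF X conjI[OF X smooth_fun_const]]] that by blast
  show "nabla p v (\<lambda>q c. X q c + Y q c) = (\<lambda>c. nabla p v X c + nabla p v Y c)"
    if "p \<in> S" "v \<in> tangent_space A p" "smooth_vfield A S Y"
    using *[OF conjI[OF X conjI[OF that(3) smooth_fun_const]]] that by blast
  show "nabla p v (\<lambda>q c. f q *\<^sub>R X q c) = (\<lambda>c. deriv_at A p v f *\<^sub>R X p c + f p *\<^sub>R nabla p v X c)"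
    if "p \<in> S" "v \<in> tangent_space A p" "smooth_fun A S f"
    using *[OF conjI[OF X conjI[OF X that(3)]]] that by blast
qed

lemma const_field_smooth: "c \<in> A \<Longrightarrow> smooth_vfield A (fst c) (\<lambda>q. chart_tvec A c q w)"
  using smooth_vfieldI[of c "fst c" "\<lambda>_. w"] by (simp add: open_chart Ck_on_const)

lemma christoffel_Ck_on:
  assumes c: "c \<in> A"
  shows "Ck_on k (snd c ` fst c) (\<lambda>z. christoffel c z v w)"
  unfolding christoffel_def
  using smooth_vfieldD(2)[OF nabla_smooth[OF open_chart(1)[OF c] carrier[OF c] const_field_smooth[OF c] const_field_smooth[OF c]] c order_refl] .

lemma nabla_chart_const:
  assumes c: "c \<in> A" "p \<in> fst c" "v \<in> tangent_space A p"
  shows "nabla p v (\<lambda>q. chart_tvec A c q w) c = christoffel c (snd c p) (v c) w"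
  using c tangent_space_eq_chart_tvec[OF c] by (simp add: christoffel_def)

lemma linear_christoffel1:
  assumes c: "c \<in> A" and z: "z \<in> snd c ` fst c"
  shows "linear (\<lambda>v. christoffel c z v w)"
proof -
  obtain p where p: "p \<in> fst c" "z = snd c p" using z by blast
  note C = open_chart(1)[OF c] carrier[OF c] const_field_smooth[OF c]
  have "christoffel c z (a *\<^sub>R v + b *\<^sub>R v') w = a *\<^sub>R christoffel c z v w + b *\<^sub>R christoffel c z v' w" for a b v v'
    using nabla_lincomb[OF C p(1) chart_tvec_in_tangent_space[OF c p(1)] chart_tvec_in_tangent_space[OF c p(1)], of a v b v' w]
    by (simp add: christoffel_def p c chart_tvec_lincomb)
  from this[of 1 _ 1] this[of _ _ 0] show ?thesis by (intro linearI) simp_all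
qed

lemma linear_christoffel2:
  assumes c: "c \<in> A" and z: "z \<in> snd c ` fst c"
  shows "linear (christoffel c z v)"
proof -
  obtain p where p: "p \<in> fst c" "z = snd c p" using z by blast
  let ?v = "chart_tvec A c p v"
  note C = open_chart(1)[OF c] carrier[OF c]
  note K = const_field_smooth[OF c]
  have t: "?v \<in> tangent_space A p" by (rule chart_tvec_in_tangent_space[OF c p(1)])
  show ?thesis
  proof (rule linearI)
    fix w w'
    have "nabla p ?v (\<lambda>q. chart_tvec A c q (w + w')) = nabla p ?v (\<lambda>q d. chart_tvec A c q w d + chart_tvec A c q w' d)"
      by (rule nabla_local[OF C K p(1) t smooth_vfield_add[OF C(1) K K]])
        (use chart_tvec_lincomb[OF c, of _ 1 w 1 w'] in simp)
    then show "christoffel c z v (w + w') = christoffel c z v w + christoffel c z v w'"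
      using nabla_add[OF C K p(1) t K] by (simp add: christoffel_def p c)
  next
    fix r w
    have "nabla p ?v (\<lambda>q. chart_tvec A c q (r *\<^sub>R w)) = nabla p ?v (\<lambda>q d. r *\<^sub>R chart_tvec A c q w d)"
      by (rule nabla_local[OF C K p(1) t smooth_vfield_scale[OF C(1) K smooth_fun_const]])
        (use chart_tvec_lincomb[OF c, of _ r w 0 w] in simp)
    moreover have "deriv_at A p ?v (\<lambda>_. r) = 0"
      using deriv_at_chart[OF c p(1) t, of "\<lambda>_. r" "\<lambda>_. 0"] by (simp add: o_def)
    ultimately show "christoffel c z v (r *\<^sub>R w) = r *\<^sub>R christoffel c z v w"
      using nabla_scale[OF C K p(1) t smooth_fun_const] by (simp add: christoffel_def p c)
  qed
qed

text \<open>The induction starts from a single field, so that additivity is all it uses.\<close>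

lemma nabla_sum:
  assumes S: "open S" "S \<subseteq> mfd_carrier A" and p: "p \<in> S" "v \<in> tangent_space A p"
    and B: "finite B" "B \<noteq> {}" and F: "\<And>b. b \<in> B \<Longrightarrow> smooth_vfield A S (F b)"
  shows "smooth_vfield A S (\<lambda>q c. \<Sum>b\<in>B. F b q c) \<and>
    nabla p v (\<lambda>q c. \<Sum>b\<in>B. F b q c) = (\<lambda>c. \<Sum>b\<in>B. nabla p v (F b) c)"
  using B F
proof (induction B rule: finite_ne_induct)
  case (insert b B)
  then have 1: "smooth_vfield A S (\<lambda>q c. \<Sum>b\<in>B. F b q c)" "smooth_vfield A S (F b)" by auto
  show ?case
    using insert smooth_vfield_add[OF S(1) 1(2,1)] nabla_add[OF S 1(2) p 1(1)] by simp
qed simp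

text \<open>X is replaced, by locality, with its expansion in fields of constant components, to
  which additivity and the Leibniz rule apply. From here on the abstract connection is calculus on
  an open set of \<open>complex^'n\<close>.\<close>

theorem nabla_chart:
  assumes c: "c \<in> A" and S: "open S" "S \<subseteq> fst c" and X: "smooth_vfield A S X"
    and p: "p \<in> S" and v: "v \<in> tangent_space A p"
  shows "nabla p v X c = frechet_derivative (\<lambda>z. X (chart_inv c z) c) (at (snd c p)) (v c)
      + christoffel c (snd c p) (v c) (X p c)"
proof -
  define E where "E b = (\<lambda>q. chart_tvec A c q b)" for b
  define f where "f b q = X q c \<bullet> b" for b q
  have SA: "S \<subseteq> mfd_carrier A" using S(2) carrier[OF c] by blast
  have pc: "p \<in> fst c" using p S by blast
  have E: "smooth_vfield A S (E b)" for b
    unfolding E_def by (rule smooth_vfield_subset[OF const_field_smooth[OF c] S(2)])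
  have xC: "Ck_on k (snd c ` S) (\<lambda>z. X (chart_inv c z) c)" for k
    by (rule smooth_vfieldD(2)[OF X c S(2)])
  have oS: "open (snd c ` S)" by (rule open_chart_image[OF c S])
  have f: "smooth_fun A S (f b)" for b
    unfolding f_def
    by (rule smooth_funI[OF c S]) (use Ck_on_bounded_linear_compose[OF oS bounded_linear_inner_left xC] in \<open>simp add: o_def\<close>)
  have fE: "smooth_vfield A S (\<lambda>q d. f b q *\<^sub>R E b q d)" for b
    by (rule smooth_vfield_scale[OF S(1) E f])
  have eq: "X q = (\<lambda>d. \<Sum>b\<in>Basis. f b q *\<^sub>R E b q d)" if "q \<in> S" for q
  proof
    fix d
    have qc: "q \<in> fst c" using that S by blast
    have "X q d = chart_tvec A c q (X q c) d"
      using tangent_space_eq_chart_tvec[OF c qc smooth_vfieldD(1)[OF X that]] by simp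
    also have "\<dots> = (\<Sum>b\<in>Basis. f b q *\<^sub>R E b q d)"
    proof (cases "d \<in> A \<and> q \<in> fst d")
      case True
      then show ?thesis
        using linear_sum_Basis[OF linear_transition_deriv[OF c _ qc], of d "X q c"]
        by (simp add: chart_tvec_def E_def f_def)
    next
      case False
      then have "chart_tvec A c q w d = 0" for w unfolding chart_tvec_def by auto
      then show ?thesis by (simp add: E_def)
    qed
    finally show "X q d = (\<Sum>b\<in>Basis. f b q *\<^sub>R E b q d)" .
  qed
  note sum = nabla_sum[where B=Basis and F="\<lambda>b q d. f b q *\<^sub>R E b q d", OF S(1) SA p v finite_Basis nonempty_Basis fE]
  define D where "D = frechet_derivative (\<lambda>z. X (chart_inv c z) c) (at (snd c p))"
  have D: "((\<lambda>z. X (chart_inv c z) c) has_derivative D) (at (snd c p))"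
    unfolding D_def using Ck_on_imp_has_derivative[OF xC] p by blast
  have df: "deriv_at A p v (f b) = D (v c) \<bullet> b" for b
  proof (rule deriv_at_chart[OF c pc v])
    show "((f b \<circ> chart_inv c) has_derivative (\<lambda>u. D u \<bullet> b)) (at (snd c p))"
      using bounded_linear.has_derivative[OF bounded_linear_inner_left D] by (simp add: f_def o_def)
  qed
  have "nabla p v X = nabla p v (\<lambda>q d. \<Sum>b\<in>Basis. f b q *\<^sub>R E b q d)"
    by (rule nabla_local[OF S(1) SA X p v sum[THEN conjunct1] eq])
  then have "nabla p v X c = (\<Sum>b\<in>Basis. nabla p v (\<lambda>q d. f b q *\<^sub>R E b q d) c)"
    using sum by simp
  also have "\<dots> = (\<Sum>b\<in>Basis. (D (v c) \<bullet> b) *\<^sub>R b + (X p c \<bullet> b) *\<^sub>R christoffel c (snd c p) (v c) b)"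
    using nabla_scale[OF S(1) SA E p v f] nabla_chart_const[OF c pc v]
    by (intro sum.cong refl) (simp add: df E_def f_def c pc)
  also have "\<dots> = D (v c) + christoffel c (snd c p) (v c) (X p c)"
    using linear_sum_Basis[OF linear_christoffel2[OF c], of "snd c p" "v c" "X p c"] pc
    by (simp add: sum.distrib euclidean_representation)
  finally show ?thesis by (simp add: D_def)
qed

end

section \<open>Open subsets of complex n-space\<close>

lemma chart_inv_open_atlas [simp]: "z \<in> U \<Longrightarrow> chart_inv (U, id) z = z"
  using inv_into_f_f[of id U z] by (simp add: chart_inv_def)

lemma mfd_carrier_open_atlas [simp]: "mfd_carrier (open_atlas U) = U"
  by (simp add: mfd_carrier_def open_atlas_def)

lemma complex_manifold_open_atlas:
  fixes U :: "(complex^'n::finite) set"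
  assumes U: "open U"
  shows "complex_manifold (open_atlas U)"
proof -
  have "homeomorphism U U id (chart_inv (U, id))"
    unfolding homeomorphism_def by (auto cong: continuous_on_cong)
  moreover have "holo imul imul (id \<circ> chart_inv (U, id)) U"
    by (rule holo_cong[OF U, of "\<lambda>z. z"]) (auto intro!: holoI derivative_eq_intros)
  ultimately show ?thesis
    using U by (simp add: complex_manifold_def open_atlas_def)
qed

lemma holomorphic_atlas_open_atlas: "open U \<Longrightarrow> holomorphic_atlas (open_atlas U)"
  by (rule holomorphic_atlas.intro) (rule complex_manifold_open_atlas)

lemma deriv_at_open_atlas:
  assumes "open U" "p \<in> U"
  shows "deriv_at (open_atlas U) p v f = frechet_derivative f (at p) (v (U, id))"
proof -
  have "chart_at (open_atlas U) p = (U, id)"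
    using assms(2) unfolding chart_at_def open_atlas_def by (intro some_equality) auto
  then show ?thesis
    using frechet_derivative_cong_open[OF assms, of "f \<circ> chart_inv (U, id)" f] by (simp add: deriv_at_def)
qed

lemma tangent_space_open_atlas:
  assumes "open U" "p \<in> U"
  shows "v \<in> tangent_space (open_atlas U) p \<longleftrightarrow> (\<forall>d. d \<noteq> (U, id) \<longrightarrow> v d = 0)"
proof -
  interpret holomorphic_atlas "open_atlas U" by (rule holomorphic_atlas_open_atlas[OF assms(1)])
  have U: "(U, id) \<in> open_atlas U" "p \<in> fst (U, id)" using assms by (simp_all add: open_atlas_def)
  show ?thesis
  proof
    show "\<forall>d. d \<noteq> (U, id) \<longrightarrow> v d = 0" if "v \<in> tangent_space (open_atlas U) p"
      using tangent_space_zero[OF that] by (simp add: open_atlas_def)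
    assume 0: "\<forall>d. d \<noteq> (U, id) \<longrightarrow> v d = 0"
    show "v \<in> tangent_space (open_atlas U) p"
    proof (rule tangent_spaceI)
      show "v d = transition_deriv c d p (v c)" if "c \<in> open_atlas U" "d \<in> open_atlas U" for c d
        using that transition_deriv_self[OF U] by (simp add: open_atlas_def)
      show "v c = 0" if "\<not> (c \<in> open_atlas U \<and> p \<in> fst c)" for c
        using 0 that U by metis
    qed
  qed
qed

lemma smooth_fun_open_atlas:
  assumes "open S" "S \<subseteq> U"
  shows "smooth_fun (open_atlas U) S f \<longleftrightarrow> (\<forall>k. Ck_on k S f)"
proof -
  have "z \<in> S \<Longrightarrow> (f \<circ> chart_inv (U, id)) z = f z" for z using assms by auto
  then have "Ck_on k S (f \<circ> chart_inv (U, id)) \<longleftrightarrow> Ck_on k S f" for k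
    using Ck_on_cong[OF assms(1), of "f \<circ> chart_inv (U, id)" f k]
      Ck_on_cong[OF assms(1), of f "f \<circ> chart_inv (U, id)" k] by metis
  then show ?thesis
    using assms by (simp add: smooth_fun_def smooth_on_def open_atlas_def Int_absorb1)
qed

lemma smooth_vfield_open_atlas:
  assumes "open U" "open S" "S \<subseteq> U"
  shows "smooth_vfield (open_atlas U) S X \<longleftrightarrow>
    (\<forall>q\<in>S. \<forall>d. d \<noteq> (U, id) \<longrightarrow> X q d = 0) \<and> (\<forall>k. Ck_on k S (\<lambda>z. X z (U, id)))"
proof -
  have "z \<in> S \<Longrightarrow> X (chart_inv (U, id) z) (U, id) = X z (U, id)" for z using assms by auto
  then have "Ck_on k S (\<lambda>z. X (chart_inv (U, id) z) (U, id)) \<longleftrightarrow> Ck_on k S (\<lambda>z. X z (U, id))" for k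
    using Ck_on_cong[OF assms(2), of "\<lambda>z. X (chart_inv (U, id) z) (U, id)" "\<lambda>z. X z (U, id)" k]
      Ck_on_cong[OF assms(2), of "\<lambda>z. X z (U, id)" "\<lambda>z. X (chart_inv (U, id) z) (U, id)" k] by metis
  moreover have "(\<forall>q\<in>S. X q \<in> tangent_space (open_atlas U) q) \<longleftrightarrow> (\<forall>q\<in>S. \<forall>d. d \<noteq> (U, id) \<longrightarrow> X q d = 0)"
    using assms tangent_space_open_atlas[OF assms(1)] by blast
  ultimately show ?thesis
    using assms by (simp add: smooth_vfield_def smooth_on_def open_atlas_def Int_absorb1)
qed

lemma lie_bracket_open_atlas:
  assumes "open U" "p \<in> U"
  shows "lie_bracket (open_atlas U) X Y p (U, id) =
      frechet_derivative (\<lambda>z. Y z (U, id)) (at p) (X p (U, id)) - frechet_derivative (\<lambda>z. X z (U, id)) (at p) (Y p (U, id))"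
    and "d \<noteq> (U, id) \<Longrightarrow> lie_bracket (open_atlas U) X Y p d = 0"
  using assms frechet_derivative_cong_open[OF assms, of "\<lambda>z. X (chart_inv (U, id) z) (U, id)" "\<lambda>z. X z (U, id)"]
    frechet_derivative_cong_open[OF assms, of "\<lambda>z. Y (chart_inv (U, id) z) (U, id)" "\<lambda>z. Y z (U, id)"]
  by (auto simp: lie_bracket_def open_atlas_def)

section \<open>The flat connection of a system of affine coordinates\<close>

lemma bounded_linear_Re_nth: "bounded_linear (\<lambda>w :: complex^'n. Re (w $ i))"
  and bounded_linear_Im_nth: "bounded_linear (\<lambda>w :: complex^'n. Im (w $ i))"
  by (rule bounded_linear_compose[OF bounded_linear_Re bounded_linear_vec_nth]
      bounded_linear_compose[OF bounded_linear_Im bounded_linear_vec_nth])+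

text \<open>The connection for which the real components of \<open>g\<close> are affine coordinates.\<close>

definition coordinate_connection :: "(complex^'n::finite) set \<Rightarrow> (complex^'n \<Rightarrow> complex^'n) \<Rightarrow> (complex^'n, 'n) conn" where
  "coordinate_connection U g p v X = (\<lambda>d. if d = (U, id) \<and> p \<in> U
     then inv (frechet_derivative g (at p))
       (frechet_derivative (\<lambda>z. frechet_derivative g (at z) (X z (U, id))) (at p) (v (U, id)))
     else 0)"

text \<open>Dg conjugates the connection into the ordinary derivative. Only smooth local fields are
  tested: the axioms say nothing about other arguments, so equality with
  \<open>coordinate_connection\<close> could not be expected of an abstract connection.\<close>

definition coordinate_compatible :: "(complex^'n::finite) set \<Rightarrow> (complex^'n \<Rightarrow> complex^'n) \<Rightarrow> (complex^'n, 'n) conn \<Rightarrow> bool" where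
  "coordinate_compatible U g nabla \<longleftrightarrow> (\<forall>S X p v. open S \<and> S \<subseteq> U \<and> smooth_vfield (open_atlas U) S X \<and> p \<in> S \<and>
      v \<in> tangent_space (open_atlas U) p \<longrightarrow>
      frechet_derivative g (at p) (nabla p v X (U, id))
        = frechet_derivative (\<lambda>z. frechet_derivative g (at z) (X z (U, id))) (at p) (v (U, id)))"

locale affine_coordinates =
  fixes U :: "(complex^'n::finite) set" and g :: "complex^'n \<Rightarrow> complex^'n"
  assumes open_U: "open U" and smooth_g: "\<And>k. Ck_on k U g"
    and inj_g: "\<And>z. z \<in> U \<Longrightarrow> inj (frechet_derivative g (at z))"
begin

sublocale holomorphic_atlas "open_atlas U"
  by (rule holomorphic_atlas_open_atlas[OF open_U])

abbreviation "Dg z \<equiv> frechet_derivative g (at z)"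

lemma g_has_derivative: "z \<in> U \<Longrightarrow> (g has_derivative Dg z) (at z)"
  using Ck_on_imp_has_derivative[OF smooth_g] .

lemma linear_Dg: "z \<in> U \<Longrightarrow> linear (Dg z)"
  using has_derivative_linear[OF g_has_derivative] .

lemma Ck_on_Dg: "Ck_on k U (\<lambda>z. Dg z v)"
  using Ck_on_frechet_derivative[OF smooth_g] .

lemma Dg_differentiable: "z \<in> U \<Longrightarrow> (\<lambda>z. Dg z v) differentiable (at z)"
  using Ck_on_imp_has_derivative[OF Ck_on_Dg] by (rule differentiableI)

lemma inv_Dg [simp]: "z \<in> U \<Longrightarrow> inv (Dg z) (Dg z v) = v"
  by (rule inv_f_f[OF inj_g])

lemma Dg_inv [simp]: "z \<in> U \<Longrightarrow> Dg z (inv (Dg z) v) = v"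
  using linear_injective_imp_surjective[OF linear_Dg inj_g] by (simp add: surj_f_inv_f)

lemma linear_inv_Dg: "z \<in> U \<Longrightarrow> linear (inv (Dg z))"
  by (rule linear_inverse_fun[OF linear_Dg inv_Dg Dg_inv])

lemma Ck_on_inv_Dg: "Ck_on k U (\<lambda>z. inv (Dg z) v)"
  by (rule Ck_on_inverse_family[where A=Dg and B="\<lambda>z. inv (Dg z)", OF open_U linear_Dg Ck_on_Dg inv_Dg Dg_inv])

lemma Ck_on_Dg_field:
  assumes "open S" "S \<subseteq> U" "Ck_on k S x"
  shows "Ck_on k S (\<lambda>z. Dg z (x z))"
  by (rule Ck_on_linear_family[where A=Dg, OF assms(1) _ Ck_on_subset[OF Ck_on_Dg assms(2)] assms(3)])
    (use assms linear_Dg in auto)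

lemma Dg_field_has_derivative:
  assumes S: "open S" "S \<subseteq> U" "\<And>k. Ck_on k S x" "p \<in> S"
  shows "((\<lambda>z. Dg z (x z)) has_derivative frechet_derivative (\<lambda>z. Dg z (x z)) (at p)) (at p)"
    and "frechet_derivative (\<lambda>z. Dg z (x z)) (at p) v
      = frechet_derivative (\<lambda>z. Dg z (x p)) (at p) v + Dg p (frechet_derivative x (at p) v)"
proof -
  have "((\<lambda>z. Dg z (x z)) has_derivative
      (\<lambda>v. frechet_derivative (\<lambda>z. Dg z (x p)) (at p) v + Dg p (frechet_derivative x (at p) v))) (at p)"
    using S linear_Dg Dg_differentiable Ck_on_imp_has_derivative[OF S(3,4)]
    by (intro has_derivative_linear_family[where A=Dg, OF S(1)]) auto
  then show "((\<lambda>z. Dg z (x z)) has_derivative frechet_derivative (\<lambda>z. Dg z (x z)) (at p)) (at p)"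
    "frechet_derivative (\<lambda>z. Dg z (x z)) (at p) v
      = frechet_derivative (\<lambda>z. Dg z (x p)) (at p) v + Dg p (frechet_derivative x (at p) v)"
    by (simp_all add: frechet_derivative_eq)
qed

lemma Dg_symmetric: "p \<in> U \<Longrightarrow> frechet_derivative (\<lambda>z. Dg z v) (at p) w = frechet_derivative (\<lambda>z. Dg z w) (at p) v"
  using second_derivative_symmetric[OF open_U _ smooth_g] .

lemma smooth_vfieldD':
  assumes "open S" "S \<subseteq> U" "smooth_vfield (open_atlas U) S X"
  shows "Ck_on k S (\<lambda>z. X z (U, id))" "q \<in> S \<Longrightarrow> d \<noteq> (U, id) \<Longrightarrow> X q d = 0"
  using assms(3) unfolding smooth_vfield_open_atlas[OF open_U assms(1,2)] by blast+

lemma coordinate_compatible_coordinate_connection: "coordinate_compatible U g (coordinate_connection U g)"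
  by (auto simp: coordinate_compatible_def coordinate_connection_def subset_iff)

text \<open>Each axiom is a rule of calculus for the vector-valued function
  \<open>Dg z (X z (U, id))\<close>, transported back by the inverse of Dg, which depends smoothly
  on the point.\<close>

lemma connection_coordinate_connection: "connection (open_atlas U) (coordinate_connection U g)"
  unfolding connection_def
proof (intro allI impI, elim conjE, intro conjI ballI allI impI)
  let ?n = "coordinate_connection U g"
  fix S X Y and f :: "complex^'n \<Rightarrow> real"
  assume S: "open S" and SU: "S \<subseteq> mfd_carrier (open_atlas U)"
    and X: "smooth_vfield (open_atlas U) S X" and Y: "smooth_vfield (open_atlas U) S Y"
    and f: "smooth_fun (open_atlas U) S f"
  have SU: "S \<subseteq> U" using SU by simp
  note xC = smooth_vfieldD'(1)[OF S SU X] and yC = smooth_vfieldD'(1)[OF S SU Y]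
  have fC: "Ck_on k S f" for k using f smooth_fun_open_atlas[OF S SU] by blast
  let ?x = "\<lambda>z. X z (U, id)" and ?y = "\<lambda>z. Y z (U, id)"
  note dx = Dg_field_has_derivative(1)[where x="?x", OF S SU xC] and dy = Dg_field_has_derivative(1)[where x="?y", OF S SU yC]
  show "smooth_vfield (open_atlas U) S (\<lambda>q. ?n q (Y q) X)"
    unfolding smooth_vfield_open_atlas[OF open_U S SU]
  proof (intro conjI allI ballI impI)
    show "?n q (Y q) X d = 0" if "d \<noteq> (U, id)" for q d using that by (simp add: coordinate_connection_def)
    fix k
    have "Ck_on k S (\<lambda>z. inv (Dg z) (frechet_derivative (\<lambda>z. Dg z (?x z)) (at z) (?y z)))"
    proof (rule Ck_on_linear_family[where A="\<lambda>z. inv (Dg z)", OF S])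
      show "linear (inv (Dg z))" if "z \<in> S" for z using linear_inv_Dg that SU by blast
      show "Ck_on k S (\<lambda>z. inv (Dg z) b)" for b by (rule Ck_on_subset[OF Ck_on_inv_Dg SU])
      show "Ck_on k S (\<lambda>z. frechet_derivative (\<lambda>z. Dg z (?x z)) (at z) (?y z))"
        by (rule Ck_on_linear_family[where A="\<lambda>z. frechet_derivative (\<lambda>z. Dg z (?x z)) (at z)", OF S
              has_derivative_linear[OF dx] Ck_on_frechet_derivative[OF Ck_on_Dg_field[OF S SU xC]] yC])
    qed
    then show "Ck_on k S (\<lambda>z. ?n z (Y z) X (U, id))"
      by (rule Ck_on_cong[OF S, rotated]) (use SU in \<open>auto simp: coordinate_connection_def\<close>)
  qed
  fix p v w and a b :: real
  assume p: "p \<in> S" and v: "v \<in> tangent_space (open_atlas U) p" and w: "w \<in> tangent_space (open_atlas U) p"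
  have pU: "p \<in> U" using p SU by blast
  note lin = has_derivative_linear[OF dx[OF p]] and li = linear_inv_Dg[OF pU]
  show "?n p v X = ?n p v Y" if "\<forall>q\<in>S. X q = Y q"
    using frechet_derivative_cong_open[OF S p, of "\<lambda>z. Dg z (?x z)" "\<lambda>z. Dg z (?y z)"] that
    by (simp add: coordinate_connection_def cong: if_cong)
  show "?n p v X \<in> tangent_space (open_atlas U) p"
    by (simp add: tangent_space_open_atlas[OF open_U pU] coordinate_connection_def)
  show "?n p (\<lambda>c. a *\<^sub>R v c + b *\<^sub>R w c) X = (\<lambda>c. a *\<^sub>R ?n p v X c + b *\<^sub>R ?n p w X c)"
    by (rule ext) (simp add: coordinate_connection_def linear_add[OF lin] linear_cmul[OF lin] linear_add[OF li] linear_cmul[OF li])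
  show "?n p v (\<lambda>q c. X q c + Y q c) = (\<lambda>c. ?n p v X c + ?n p v Y c)"
  proof -
    have "frechet_derivative (\<lambda>z. Dg z (?x z + ?y z)) (at p)
        = (\<lambda>v. frechet_derivative (\<lambda>z. Dg z (?x z)) (at p) v + frechet_derivative (\<lambda>z. Dg z (?y z)) (at p) v)"
      by (rule frechet_derivative_eq, rule has_derivative_transform_within_open[OF has_derivative_add[OF dx[OF p] dy[OF p]] S p])
        (simp add: linear_add[OF linear_Dg[OF subsetD[OF SU]]])
    then show ?thesis by (intro ext) (simp add: coordinate_connection_def linear_add[OF li])
  qed
  show "?n p v (\<lambda>q c. f q *\<^sub>R X q c) = (\<lambda>c. deriv_at (open_atlas U) p v f *\<^sub>R X p c + f p *\<^sub>R ?n p v X c)"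
  proof
    fix d
    have "frechet_derivative (\<lambda>z. Dg z (f z *\<^sub>R ?x z)) (at p)
        = (\<lambda>v. f p *\<^sub>R frechet_derivative (\<lambda>z. Dg z (?x z)) (at p) v + frechet_derivative f (at p) v *\<^sub>R Dg p (?x p))"
      by (rule frechet_derivative_eq, rule has_derivative_transform_within_open[OF
            has_derivative_scaleR[OF Ck_on_imp_has_derivative[OF fC p] dx[OF p]] S p])
        (simp add: linear_cmul[OF linear_Dg[OF subsetD[OF SU]]])
    then show "?n p v (\<lambda>q c. f q *\<^sub>R X q c) d = deriv_at (open_atlas U) p v f *\<^sub>R X p d + f p *\<^sub>R ?n p v X d"
      using smooth_vfieldD'(2)[OF S SU X p, of d] pU
      by (auto simp: coordinate_connection_def linear_add[OF li] linear_cmul[OF li] deriv_at_open_atlas[OF open_U pU])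
  qed
qed

text \<open>Both tensors vanish by symmetry of second derivatives: of g itself for the torsion, of
  \<open>Dg z (Z z (U, id))\<close> for the curvature.\<close>

lemma flat_torsionfree_coordinate_connection:
  "flat_torsionfree_connection (open_atlas U) (coordinate_connection U g)"
  unfolding flat_torsionfree_connection_def
proof (intro conjI connection_coordinate_connection)
  let ?n = "coordinate_connection U g"
  show "torsionfree (open_atlas U) ?n"
    unfolding torsionfree_def
  proof (intro allI impI ballI, elim conjE)
    fix S X Y p d
    assume S: "open S" and SU: "S \<subseteq> mfd_carrier (open_atlas U)"
      and X: "smooth_vfield (open_atlas U) S X" and Y: "smooth_vfield (open_atlas U) S Y" and p: "p \<in> S"
    have SU: "S \<subseteq> U" using SU by simp
    then have pU: "p \<in> U" using p by blast
    let ?x = "\<lambda>z. X z (U, id)" and ?y = "\<lambda>z. Y z (U, id)"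
    note dx = Dg_field_has_derivative(2)[where x="?x", OF S SU smooth_vfieldD'(1)[OF S SU X] p]
      and dy = Dg_field_has_derivative(2)[where x="?y", OF S SU smooth_vfieldD'(1)[OF S SU Y] p]
    have "inv (Dg p) (frechet_derivative (\<lambda>z. Dg z (?y z)) (at p) (?x p) - frechet_derivative (\<lambda>z. Dg z (?x z)) (at p) (?y p))
        = frechet_derivative ?y (at p) (?x p) - frechet_derivative ?x (at p) (?y p)"
      unfolding dx dy
      using Dg_symmetric[OF pU, of "?y p" "?x p"] pU
      by (simp add: linear_diff[OF linear_Dg[OF pU], symmetric])
    then show "?n p (X p) Y d - ?n p (Y p) X d = lie_bracket (open_atlas U) X Y p d"
      using lie_bracket_open_atlas[OF open_U pU, where X=X and Y=Y] pU
      by (cases "d = (U, id)") (auto simp: coordinate_connection_def linear_diff[OF linear_inv_Dg[OF pU]])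
  qed
  show "flat_connection (open_atlas U) ?n"
    unfolding flat_connection_def
  proof (intro allI impI ballI, elim conjE)
    fix S X Y Z p d
    assume S: "open S" and SU: "S \<subseteq> mfd_carrier (open_atlas U)"
      and X: "smooth_vfield (open_atlas U) S X" and Y: "smooth_vfield (open_atlas U) S Y"
      and Z: "smooth_vfield (open_atlas U) S Z" and p: "p \<in> S"
    have SU: "S \<subseteq> U" using SU by simp
    then have pU: "p \<in> U" using p by blast
    let ?x = "\<lambda>z. X z (U, id)" and ?y = "\<lambda>z. Y z (U, id)" and ?z = "\<lambda>z. Z z (U, id)"
    define h where "h z = Dg z (?z z)" for z
    define H where "H z = frechet_derivative h (at z)" for z
    have hC: "Ck_on k S h" for k
      unfolding h_def by (rule Ck_on_Dg_field[OF S SU smooth_vfieldD'(1)[OF S SU Z]])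
    have HC: "Ck_on k S (\<lambda>z. H z v)" for k v unfolding H_def by (rule Ck_on_frechet_derivative[OF hC])
    have linH: "linear (H z)" if "z \<in> S" for z
      unfolding H_def using has_derivative_linear[OF Ck_on_imp_has_derivative[OF hC that]] .
    \<comment> \<open>In the expansion of the iterated derivative the first term is a second
      derivative of h and cancels by symmetry, while the terms with the derivative of W add up to
      the bracket.\<close>
    have key: "Dg p (?n p (V p) (\<lambda>q. ?n q (W q) Z) (U, id))
        = frechet_derivative (\<lambda>z. H z (W p (U, id))) (at p) (V p (U, id))
          + H p (frechet_derivative (\<lambda>z. W z (U, id)) (at p) (V p (U, id)))"
      if W: "smooth_vfield (open_atlas U) S W" for V W
    proof -
      have "Dg p (?n p (V p) (\<lambda>q. ?n q (W q) Z) (U, id))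
          = frechet_derivative (\<lambda>z. Dg z (?n z (W z) Z (U, id))) (at p) (V p (U, id))"
        using pU by (simp add: coordinate_connection_def[of U g p])
      also have "frechet_derivative (\<lambda>z. Dg z (?n z (W z) Z (U, id))) (at p)
          = frechet_derivative (\<lambda>z. H z (W z (U, id))) (at p)"
        by (rule frechet_derivative_cong_open[OF S p])
          (use SU in \<open>auto simp: coordinate_connection_def H_def h_def[abs_def]\<close>)
      also have "\<dots> = (\<lambda>v. frechet_derivative (\<lambda>z. H z (W p (U, id))) (at p) v
          + H p (frechet_derivative (\<lambda>z. W z (U, id)) (at p) v))"
        by (rule frechet_derivative_eq, rule has_derivative_linear_family[where A=H and h="\<lambda>z. W z (U, id)" and ?x0.0=p,
              OF S p linH differentiableI[OF Ck_on_imp_has_derivative[OF HC p]]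
                Ck_on_imp_has_derivative[OF smooth_vfieldD'(1)[OF S SU W] p] refl])
      finally show ?thesis .
    qed
    have sym: "frechet_derivative (\<lambda>z. H z v) (at p) w = frechet_derivative (\<lambda>z. H z w) (at p) v" for v w
      unfolding H_def by (rule second_derivative_symmetric[OF S p hC])
    have "Dg p (?n p (lie_bracket (open_atlas U) X Y p) Z (U, id)) = H p (lie_bracket (open_atlas U) X Y p (U, id))"
      using pU by (simp add: coordinate_connection_def H_def h_def[abs_def])
    also have "\<dots> = H p (frechet_derivative ?y (at p) (?x p)) - H p (frechet_derivative ?x (at p) (?y p))"
      by (simp add: lie_bracket_open_atlas(1)[OF open_U pU] linear_diff[OF linH[OF p]])
    finally have "Dg p (?n p (X p) (\<lambda>q. ?n q (Y q) Z) (U, id) - ?n p (Y p) (\<lambda>q. ?n q (X q) Z) (U, id)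
        - ?n p (lie_bracket (open_atlas U) X Y p) Z (U, id)) = 0"
      using sym[of "?x p" "?y p"] by (simp add: linear_diff[OF linear_Dg[OF pU]] key[OF X] key[OF Y])
    then have "?n p (X p) (\<lambda>q. ?n q (Y q) Z) (U, id) - ?n p (Y p) (\<lambda>q. ?n q (X q) Z) (U, id)
        - ?n p (lie_bracket (open_atlas U) X Y p) Z (U, id) = 0"
      using linear_injective_0[OF linear_Dg[OF pU]] inj_g[OF pU] by blast
    moreover have "?n p v V d = 0" if "d \<noteq> (U, id)" for v V
      using that by (simp add: coordinate_connection_def)
    ultimately show "?n p (X p) (\<lambda>q. ?n q (Y q) Z) d - ?n p (Y p) (\<lambda>q. ?n q (X q) Z) d
        - ?n p (lie_bracket (open_atlas U) X Y p) Z d = 0"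
      by (cases "d = (U, id)") simp_all
  qed
qed

text \<open>Read together, these formulas say that the Hessian condition for \<open>l (g z)\<close>
  is the l-component of \<open>coordinate_compatible\<close>; they serve both implications between
  the two notions.\<close>

lemma component_affine_iff:
  fixes l :: "complex^'n \<Rightarrow> real"
  assumes l: "bounded_linear l" and S: "open S" "S \<subseteq> U" and X: "smooth_vfield (open_atlas U) S X" and p: "p \<in> S"
  shows "deriv_at (open_atlas U) p v (\<lambda>q. deriv_at (open_atlas U) q (X q) (\<lambda>z. l (g z)))
       = l (frechet_derivative (\<lambda>z. Dg z (X z (U, id))) (at p) (v (U, id)))"
    and "deriv_at (open_atlas U) p u (\<lambda>z. l (g z)) = l (Dg p (u (U, id)))"
proof -
  have pU: "p \<in> U" using p S by blast
  have 1: "deriv_at (open_atlas U) q u (\<lambda>z. l (g z)) = l (Dg q (u (U, id)))" if "q \<in> U" for q u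
    using bounded_linear.has_derivative[OF l g_has_derivative[OF that]]
    by (simp add: deriv_at_open_atlas[OF open_U that] frechet_derivative_eq)
  then show "deriv_at (open_atlas U) p u (\<lambda>z. l (g z)) = l (Dg p (u (U, id)))" using pU by simp
  have "frechet_derivative (\<lambda>q. deriv_at (open_atlas U) q (X q) (\<lambda>z. l (g z))) (at p)
      = frechet_derivative (\<lambda>q. l (Dg q (X q (U, id)))) (at p)"
    by (rule frechet_derivative_cong_open[OF S(1) p]) (use S 1 in auto)
  also have "\<dots> = (\<lambda>v. l (frechet_derivative (\<lambda>z. Dg z (X z (U, id))) (at p) v))"
    by (rule frechet_derivative_eq, rule bounded_linear.has_derivative[OF l
          Dg_field_has_derivative(1)[where x="\<lambda>z. X z (U, id)", OF S smooth_vfieldD'(1)[OF S X] p]])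
  finally show "deriv_at (open_atlas U) p v (\<lambda>q. deriv_at (open_atlas U) q (X q) (\<lambda>z. l (g z)))
       = l (frechet_derivative (\<lambda>z. Dg z (X z (U, id))) (at p) (v (U, id)))"
    by (simp add: deriv_at_open_atlas[OF open_U pU])
qed

lemma affine_fun_component:
  fixes l :: "complex^'n \<Rightarrow> real"
  assumes "coordinate_compatible U g nabla" and l: "bounded_linear l"
  shows "affine_fun (open_atlas U) nabla (\<lambda>z. l (g z))"
  unfolding affine_fun_def
proof (intro conjI allI impI ballI, goal_cases)
  case 1
  show ?case
    using Ck_on_bounded_linear_compose[OF open_U l smooth_g] by (simp add: smooth_fun_open_atlas[OF open_U])
next
  case (2 S X p v)
  then have S: "open S" "S \<subseteq> U" "smooth_vfield (open_atlas U) S X" by auto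
  then have "Dg p (nabla p v X (U, id)) = frechet_derivative (\<lambda>z. Dg z (X z (U, id))) (at p) (v (U, id))"
    using assms(1) 2 unfolding coordinate_compatible_def by blast
  then show ?case using component_affine_iff[OF l S 2(2)] by simp
qed

lemma coordinate_compatibleI:
  assumes Re: "\<And>i. affine_fun (open_atlas U) nabla (\<lambda>z. Re (g z $ i))"
    and Im: "\<And>i. affine_fun (open_atlas U) nabla (\<lambda>z. Im (g z $ i))"
  shows "coordinate_compatible U g nabla"
  unfolding coordinate_compatible_def
proof (intro allI impI, elim conjE)
  fix S X p v
  assume S: "open S" "S \<subseteq> U" "smooth_vfield (open_atlas U) S X" and p: "p \<in> S" and v: "v \<in> tangent_space (open_atlas U) p"
  have "l (frechet_derivative (\<lambda>z. Dg z (X z (U, id))) (at p) (v (U, id))) = l (Dg p (nabla p v X (U, id)))"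
    if "bounded_linear l" "affine_fun (open_atlas U) nabla (\<lambda>z. l (g z))" for l :: "complex^'n \<Rightarrow> real"
  proof -
    have "deriv_at (open_atlas U) p v (\<lambda>q. deriv_at (open_atlas U) q (X q) (\<lambda>z. l (g z)))
        = deriv_at (open_atlas U) p (nabla p v X) (\<lambda>z. l (g z))"
      using that(2) S p v unfolding affine_fun_def mfd_carrier_open_atlas by blast
    then show ?thesis unfolding component_affine_iff[OF that(1) S p] .
  qed
  from this[OF bounded_linear_Re_nth Re] this[OF bounded_linear_Im_nth Im]
  show "Dg p (nabla p v X (U, id)) = frechet_derivative (\<lambda>z. Dg z (X z (U, id))) (at p) (v (U, id))"
    by (simp add: vec_eq_iff complex_eq_iff)
qed

end

section \<open>Regular one-forms\<close>

text \<open>The constant form 2 \<Sum> dx \<and> dy on real 2n-space, with the pair (x, y) stored as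
  the complex vector x + i y.\<close>

definition standard_form :: "complex^'n \<Rightarrow> complex^'n \<Rightarrow> real" where
  "standard_form a b = 2 * (\<Sum>i\<in>UNIV. Re (a $ i) * Im (b $ i) - Re (b $ i) * Im (a $ i))"

text \<open>Its real and imaginary parts are the affine coordinates of the connection induced by \<open>F\<close>.\<close>

definition real_coordinates :: "(complex^'n \<Rightarrow> complex^'n) \<Rightarrow> complex^'n \<Rightarrow> complex^'n" where
  "real_coordinates F z = (\<chi> i. Complex (Re (z $ i)) (Re (F z $ i)))"

lemma bounded_bilinear_standard_form:
  "bounded_bilinear (standard_form :: complex^'n \<Rightarrow> complex^'n \<Rightarrow> real)"
proof -
  have "bilinear (standard_form :: complex^'n \<Rightarrow> complex^'n \<Rightarrow> real)"
    unfolding bilinear_def standard_form_def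
    by (auto intro!: linearI simp: sum_distrib_left sum.distrib[symmetric] algebra_simps sum_subtractf[symmetric])
  then show ?thesis by (simp add: bilinear_conv_bounded_bilinear)
qed

lemma standard_form_alt: "standard_form a b = - standard_form b a"
  by (simp add: standard_form_def sum_negf[symmetric] flip: mult_minus_right)

lemma standard_form_nondegenerate:
  fixes a :: "complex^'n"
  assumes "\<And>b. standard_form a b = 0"
  shows "a = 0"
proof -
  have "standard_form a (axis i x) = 2 * (Re (a $ i) * Im x - Re x * Im (a $ i))" for i x
  proof -
    have "Re (a $ j) * Im (axis i x $ j) - Re (axis i x $ j) * Im (a $ j)
        = (if j = i then Re (a $ i) * Im x - Re x * Im (a $ i) else 0)" for j
      by (simp add: axis_def)
    then show ?thesis by (simp add: standard_form_def)
  qed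
  then have "Re (a $ i) = 0" "Im (a $ i) = 0" for i
    using assms[of "axis i \<i>"] assms[of "axis i 1"] by simp_all
  then show ?thesis by (simp add: vec_eq_iff complex_eq_iff)
qed

lemma vector_scaleR_decomp: "(h::complex) *s v = Re h *\<^sub>R v + Im h *\<^sub>R imul v"
  by (simp add: vec_eq_iff imul_def complex_eq_iff)

lemma imul_zero [simp]: "imul 0 = 0"
  by (simp add: imul_def vec_eq_iff)

lemma linear_complex_scale:
  assumes "linear D" "\<And>v. D (imul v) = imul (D v)"
  shows "D (h *s v) = h *s D v"
  by (simp add: vector_scaleR_decomp linear_add[OF assms(1)] linear_cmul[OF assms(1)] assms(2))

locale holomorphic_one_form =
  fixes U :: "(complex^'n::finite) set" and F :: "complex^'n \<Rightarrow> complex^'n"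
  assumes holomorphic: "holomorphic_1form U F"
begin

lemma open_U: "open U" and holo_F: "holo imul imul F U"
  using holomorphic by (auto simp: holomorphic_1form_def)

abbreviation "DF z \<equiv> frechet_derivative F (at z)"

lemma F_has_derivative: "z \<in> U \<Longrightarrow> (F has_derivative DF z) (at z)"
  and DF_imul: "z \<in> U \<Longrightarrow> DF z (imul v) = imul (DF z v)"
  using holoD[OF holo_F] by blast+

lemma linear_DF: "z \<in> U \<Longrightarrow> linear (DF z)"
  using F_has_derivative by (rule has_derivative_linear)

lemma DF_scale: "z \<in> U \<Longrightarrow> DF z (h *s v) = h *s DF z v"
  by (rule linear_complex_scale[OF linear_DF DF_imul])

lemma smooth_F: "Ck_on k U F"
  by (rule holo_imp_Ck_on[OF open_U linear_imul holo_F])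

abbreviation "g \<equiv> real_coordinates F"

lemma real_coordinates_has_derivative:
  assumes "z \<in> U"
  shows "(g has_derivative (\<lambda>v. \<chi> i. Complex (Re (v $ i)) (Re (DF z v $ i)))) (at z)"
proof -
  have "bounded_linear (\<lambda>v. \<chi> i. Complex (Re (fst v $ i)) (Re (snd v $ i)) :: complex^'n)"
    by (rule linear_conv_bounded_linear[THEN iffD1], rule linearI) (simp_all add: vec_eq_iff complex_eq_iff)
  from bounded_linear.has_derivative[OF this has_derivative_Pair[OF has_derivative_ident F_has_derivative[OF assms]]]
  show ?thesis by (simp add: real_coordinates_def[abs_def])
qed

lemma Dg_component:
  assumes "z \<in> U"
  shows "frechet_derivative g (at z) v $ i = Complex (Re (v $ i)) (Re (DF z v $ i))"
  using real_coordinates_has_derivative[OF assms] by (simp add: frechet_derivative_eq)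

lemma smooth_real_coordinates: "Ck_on k U g"
proof -
  have "bounded_linear (\<lambda>v. \<chi> i. Complex (Re (v $ i)) 0 :: complex^'n)"
    "bounded_linear (\<lambda>v. \<chi> i. Complex 0 (Re (v $ i)) :: complex^'n)"
    by (rule linear_conv_bounded_linear[THEN iffD1], rule linearI, simp_all add: vec_eq_iff complex_eq_iff)+
  note bl = this
  have "Ck_on k U (\<lambda>z. (\<chi> i. Complex (Re (z $ i)) 0) + (\<chi> i. Complex 0 (Re (F z $ i))))"
    by (rule Ck_on_add[OF open_U Ck_on_bounded_linear[OF bl(1)] Ck_on_bounded_linear_compose[OF open_U bl(2) smooth_F]])
  moreover have "g = (\<lambda>z. (\<chi> i. Complex (Re (z $ i)) 0) + (\<chi> i. Complex 0 (Re (F z $ i))))"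
    by (rule ext) (simp add: real_coordinates_def vec_eq_iff complex_eq_iff)
  ultimately show ?thesis by simp
qed

text \<open>\<open>regular_1form\<close> uses one-variable complex derivatives; complex linearity of
  DF makes its restriction to an axis a complex multiplication and so matches the two.\<close>

lemma partial_derivative:
  assumes z: "z \<in> U"
  shows "deriv (\<lambda>t. F (z + axis j t) $ i) 0 = DF z (axis j 1) $ i"
proof (rule DERIV_imp_deriv)
  have "((\<lambda>t. z + axis j t) has_derivative (\<lambda>t. axis j t)) (at 0)"
    unfolding has_derivative_vec_iff
  proof
    show "((\<lambda>t. (z + axis j t) $ i) has_derivative (\<lambda>t. axis j t $ i)) (at 0)" for i
      by (cases "i = j") (auto simp: axis_def intro!: derivative_eq_intros)
  qed
  moreover have "(F has_derivative DF z) (at (z + axis j 0))"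
    using F_has_derivative[OF z] by (simp add: axis_def zero_vec_def[symmetric])
  ultimately have "((\<lambda>t. F (z + axis j t)) has_derivative (\<lambda>t. DF z (axis j t))) (at 0)"
    using diff_chain_at by (fastforce simp: o_def)
  then have "((\<lambda>t. F (z + axis j t) $ i) has_derivative (\<lambda>t. DF z (axis j t) $ i)) (at 0)"
    by (rule bounded_linear.has_derivative[OF bounded_linear_vec_nth])
  moreover have "axis j t = t *s axis j 1" for t :: complex
    by (simp add: vec_eq_iff axis_def)
  then have "(\<lambda>t. DF z (axis j t) $ i) = (\<lambda>t. DF z (axis j 1) $ i * t)"
    using DF_scale[OF z, of _ "axis j 1"] by (metis mult.commute vector_smult_component)
  ultimately show "((\<lambda>t. F (z + axis j t) $ i) has_field_derivative DF z (axis j 1) $ i) (at 0)"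
    by (simp only: has_field_derivative_def)
qed

definition ImDF :: "complex^'n \<Rightarrow> real^'n^'n" where
  "ImDF z = (\<chi> i j. Im (DF z (axis j 1) $ i))"

text \<open>Real coefficients pass through imaginary parts, so on real vectors Im DF is given by a
  real matrix.\<close>

lemma Im_DF_real:
  assumes z: "z \<in> U"
  shows "Im (DF z (\<chi> j. complex_of_real (a $ j)) $ i) = (ImDF z *v a) $ i"
proof -
  have e: "(\<chi> j. complex_of_real (a $ j)) = (\<Sum>j\<in>UNIV. (a $ j) *\<^sub>R (axis j 1 :: complex^'n))"
    by (simp add: vec_eq_iff axis_def if_distrib of_real_def cong: if_cong)
  show ?thesis
    unfolding e by (simp add: linear_sum[OF linear_DF[OF z]] linear_cmul[OF linear_DF[OF z]]
        ImDF_def matrix_vector_mult_def mult.commute)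
qed

lemma regular_iff: "regular_1form U F \<longleftrightarrow> (\<forall>z\<in>U. \<forall>a. ImDF z *v a = 0 \<longrightarrow> a = 0)"
proof -
  have "(\<chi> i j. Im (deriv (\<lambda>t. F (z + axis j t) $ i) 0)) = ImDF z" if "z \<in> U" for z
    by (simp add: ImDF_def partial_derivative[OF that])
  then have "regular_1form U F \<longleftrightarrow> (\<forall>z\<in>U. invertible (ImDF z))"
    by (simp add: regular_1form_def)
  then show ?thesis
    by (simp add: invertible_left_inverse matrix_left_invertible_ker)
qed

lemma real_vector_eq: "(\<And>i. Im (v $ i) = 0) \<Longrightarrow> v = (\<chi> j. complex_of_real ((\<chi> j. Re (v $ j)) $ j))" for v :: "complex^'n"
  by (simp add: vec_eq_iff complex_eq_iff)

text \<open>A vector v lies in the kernel of Dg iff v and DF v are purely imaginary. With v = i w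
  this says, by complex linearity, that w and DF w are real, that is, w is a real vector in the
  kernel of Im DF.\<close>

lemma regular_iff_inj_Dg: "regular_1form U F \<longleftrightarrow> (\<forall>z\<in>U. inj (frechet_derivative g (at z)))"
  unfolding regular_iff
proof (intro ball_cong refl)
  fix z assume z: "z \<in> U"
  have lin: "linear (frechet_derivative g (at z))"
    using has_derivative_linear[OF real_coordinates_has_derivative[OF z]] real_coordinates_has_derivative[OF z]
    by (simp add: frechet_derivative_eq)
  have ker: "frechet_derivative g (at z) v = 0 \<longleftrightarrow> (\<forall>i. Re (v $ i) = 0) \<and> (\<forall>i. Re (DF z v $ i) = 0)" for v
    by (auto simp: vec_eq_iff Dg_component[OF z] complex_eq_iff)
  have conv: "Re (DF z (imul v) $ i) = - Im (DF z v $ i)" "Re (imul v $ i) = - Im (v $ i)" for v i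
    unfolding DF_imul[OF z] by (simp_all add: imul_def)
  show "(\<forall>a. ImDF z *v a = 0 \<longrightarrow> a = 0) \<longleftrightarrow> inj (frechet_derivative g (at z))"
    unfolding linear_injective_0[OF lin] ker
  proof (intro iffI allI impI)
    fix v assume *: "\<forall>a. ImDF z *v a = 0 \<longrightarrow> a = 0" and v: "(\<forall>i. Re (v $ i) = 0) \<and> (\<forall>i. Re (DF z v $ i) = 0)"
    define w where "w = - imul v"
    have vw: "v = imul w" using linear_neg[OF linear_imul, of "imul v"] by (simp add: w_def)
    have "Im (w $ i) = 0" "Im (DF z w $ i) = 0" for i
      using v conv[of w i] by (simp_all add: vw)
    then have "ImDF z *v (\<chi> j. Re (w $ j)) = 0"
      using Im_DF_real[OF z, of "\<chi> j. Re (w $ j)"] real_vector_eq[of w] by (simp add: vec_eq_iff)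
    then have "w = 0" using * real_vector_eq[of w] \<open>\<And>i. Im (w $ i) = 0\<close>
      by (metis (mono_tags, lifting) of_real_0 vec_eq_iff vec_lambda_beta zero_index)
    then show "v = 0" using vw linear_0[OF linear_imul] by simp
  next
    fix a assume *: "\<forall>v. (\<forall>i. Re (v $ i) = 0) \<and> (\<forall>i. Re (DF z v $ i) = 0) \<longrightarrow> v = 0" and a: "ImDF z *v a = 0"
    define w :: "complex^'n" where "w = (\<chi> j. of_real (a $ j))"
    have "Re (imul w $ i) = 0" "Re (DF z (imul w) $ i) = 0" for i
      using Im_DF_real[OF z, of a i] a conv[of w i] by (simp_all add: w_def)
    then have "imul w = 0" using * by blast
    then show "a = 0" by (simp add: w_def vec_eq_iff imul_def)
  qed
qed

lemma section_has_derivative: "z \<in> U \<Longrightarrow> (section_of F has_derivative (\<lambda>v. (v, DF z v))) (at z)"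
  using has_derivative_Pair[OF has_derivative_ident F_has_derivative] by (simp add: section_of_def[abs_def])

lemma holomorphic_immersion_section: "holomorphic_immersion U (section_of F)"
  unfolding holomorphic_immersion_def
proof
  show "holo imul imul_V (section_of F) U"
    by (rule holoI[OF section_has_derivative]) (simp_all add: imul_V_def DF_imul)
  show "\<forall>p\<in>U. inj (frechet_derivative (section_of F) (at p))"
  proof
    show "inj (frechet_derivative (section_of F) (at p))" if "p \<in> U" for p
      unfolding frechet_derivative_eq[OF section_has_derivative[OF that]] by (simp add: inj_def)
  qed
qed

lemma induced_form_eq:
  assumes "p \<in> U"
  shows "induced_form U (section_of F) p u v
    = standard_form (frechet_derivative g (at p) (u (U, id))) (frechet_derivative g (at p) (v (U, id)))"
  using assms
  by (simp add: induced_form_def form_V_def standard_form_def deriv_at_open_atlas[OF open_U]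
      frechet_derivative_eq[OF section_has_derivative] Dg_component)

end

locale regular_one_form = holomorphic_one_form U F
  for U :: "(complex^'n::finite) set" and F +
  assumes regular: "regular_1form U F"
begin

sublocale affine_coordinates U g
  by unfold_locales (use open_U smooth_real_coordinates regular regular_iff_inj_Dg in auto)

text \<open>A real tangent vector of the graph is (v, DF v) with both entries real, so Im DF kills
  the real vector v and regularity gives v = 0.\<close>

lemma totally_complex_section: "totally_complex U (section_of F)"
  unfolding totally_complex_def
proof
  fix z assume z: "z \<in> U"
  have D: "frechet_derivative (section_of F) (at z) = (\<lambda>v. (v, DF z v))"
    using section_has_derivative[OF z] by (rule frechet_derivative_eq)
  have "v = 0" if "\<And>i. Im (v $ i) = 0" "\<And>i. Im (DF z v $ i) = 0" for v :: "complex^'n"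
  proof -
    have "ImDF z *v (\<chi> j. Re (v $ j)) = 0"
      using Im_DF_real[OF z, of "\<chi> j. Re (v $ j)"] real_vector_eq[OF that(1)] that(2) by (simp add: vec_eq_iff)
    then have "(\<chi> j. Re (v $ j)) = 0" using regular z unfolding regular_iff by blast
    then show ?thesis using that(1) by (simp add: vec_eq_iff complex_eq_iff)
  qed
  then show "real_points \<inter> range (frechet_derivative (section_of F) (at z)) = {0}"
    using linear_0[OF linear_DF[OF z]]
    by (auto simp: D real_points_def zero_prod_def image_iff)
qed

lemma induced_connection_iff:
  "induced_connection U (section_of F) nabla \<longleftrightarrow>
    flat_torsionfree_connection (open_atlas U) nabla \<and> coordinate_compatible U g nabla"
proof -
  have c: "Re (fst (section_of F z) $ i) = Re (g z $ i)" "Re (snd (section_of F z) $ i) = Im (g z $ i)" for z i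
    by (simp_all add: section_of_def real_coordinates_def)
  show ?thesis
    unfolding induced_connection_def c
    using coordinate_compatibleI affine_fun_component[OF _ bounded_linear_Re_nth] affine_fun_component[OF _ bounded_linear_Im_nth] by blast
qed

lemma induced_connection_exists: "\<exists>nabla. induced_connection U (section_of F) nabla"
  using flat_torsionfree_coordinate_connection coordinate_compatible_coordinate_connection
  unfolding induced_connection_iff by blast

section \<open>The induced form: parallel and symplectic\<close>

abbreviation "\<omega> \<equiv> induced_form U (section_of F)"

text \<open>Expressed through Dg X and Dg Y the form has constant coefficients, so the product rule
  for a bilinear map is its parallelism.\<close>

lemma induced_form_fields:
  assumes S: "open S" "S \<subseteq> U" and X: "smooth_vfield (open_atlas U) S X" and Y: "smooth_vfield (open_atlas U) S Y"
  shows "smooth_fun (open_atlas U) S (\<lambda>q. \<omega> q (X q) (Y q))"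
    and "coordinate_compatible U g nabla \<Longrightarrow> p \<in> S \<Longrightarrow> v \<in> tangent_space (open_atlas U) p \<Longrightarrow>
      deriv_at (open_atlas U) p v (\<lambda>q. \<omega> q (X q) (Y q)) = \<omega> p (nabla p v X) (Y p) + \<omega> p (X p) (nabla p v Y)"
proof -
  let ?x = "\<lambda>z. Dg z (X z (U, id))" and ?y = "\<lambda>z. Dg z (Y z (U, id))"
  have C: "Ck_on k S ?x" "Ck_on k S ?y" for k
    using Ck_on_Dg_field[OF S smooth_vfieldD'(1)[OF S X]] Ck_on_Dg_field[OF S smooth_vfieldD'(1)[OF S Y]] by blast+
  have eq: "standard_form (?x z) (?y z) = \<omega> z (X z) (Y z)" if "z \<in> S" for z
    using induced_form_eq S that by (simp add: subset_iff)
  show "smooth_fun (open_atlas U) S (\<lambda>q. \<omega> q (X q) (Y q))"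
    unfolding smooth_fun_open_atlas[OF S]
    using Ck_on_cong[OF S(1) eq Ck_on_bilinear[OF S(1) bounded_bilinear_standard_form C]] by simp
  assume n: "coordinate_compatible U g nabla" and p: "p \<in> S" and v: "v \<in> tangent_space (open_atlas U) p"
  have pU: "p \<in> U" using p S by blast
  have n': "Dg p (nabla p v W (U, id)) = frechet_derivative (\<lambda>z. Dg z (W z (U, id))) (at p) (v (U, id))"
    if "smooth_vfield (open_atlas U) S W" for W
    using n S p v that unfolding coordinate_compatible_def by blast
  have "((\<lambda>z. standard_form (?x z) (?y z)) has_derivative
      (\<lambda>v. standard_form (?x p) (frechet_derivative ?y (at p) v) + standard_form (frechet_derivative ?x (at p) v) (?y p))) (at p)"
    by (rule bounded_bilinear.FDERIV[OF bounded_bilinear_standard_form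
          Ck_on_imp_has_derivative[OF C(1) p] Ck_on_imp_has_derivative[OF C(2) p]])
  from has_derivative_transform_within_open[OF this S(1) p eq]
  show "deriv_at (open_atlas U) p v (\<lambda>q. \<omega> q (X q) (Y q)) = \<omega> p (nabla p v X) (Y p) + \<omega> p (X p) (nabla p v Y)"
    by (simp add: deriv_at_open_atlas[OF open_U pU] frechet_derivative_eq induced_form_eq[OF pU] n'[OF X] n'[OF Y])
qed

lemma parallel_induced_form: "coordinate_compatible U g nabla \<Longrightarrow> parallel_form (open_atlas U) nabla \<omega>"
  unfolding parallel_form_def mfd_carrier_open_atlas using induced_form_fields(2) by blast

text \<open>Closedness follows from parallelism: each derivative splits into two covariant terms
  and, without torsion, each bracket does too; all of them cancel in pairs by antisymmetry.
  Nondegeneracy is pulled back along the isomorphism Dg.\<close>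

lemma symplectic_induced_form:
  assumes n: "coordinate_compatible U g nabla" and t: "torsionfree (open_atlas U) nabla"
  shows "symplectic_form (open_atlas U) \<omega>"
  unfolding symplectic_form_def
proof (intro conjI ballI impI allI)
  interpret sf: bounded_bilinear "standard_form :: complex^'n \<Rightarrow> _" by (rule bounded_bilinear_standard_form)
  show "two_form (open_atlas U) \<omega>"
    unfolding two_form_def
  proof (intro conjI ballI allI impI)
    fix p u v x a b assume p: "p \<in> mfd_carrier (open_atlas U)"
    then have p: "p \<in> U" by simp
    show "\<omega> p u v = - \<omega> p v u" using standard_form_alt by (simp add: induced_form_eq[OF p])
    show "\<omega> p (\<lambda>c. a *\<^sub>R u c + b *\<^sub>R v c) x = a * \<omega> p u x + b * \<omega> p v x"
      by (simp add: induced_form_eq[OF p] linear_add[OF linear_Dg[OF p]] linear_cmul[OF linear_Dg[OF p]]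
          sf.add_left sf.scaleR_left)
  next
    fix S X Y
    assume "open S \<and> S \<subseteq> mfd_carrier (open_atlas U) \<and> smooth_vfield (open_atlas U) S X \<and> smooth_vfield (open_atlas U) S Y"
    then show "smooth_fun (open_atlas U) S (\<lambda>q. \<omega> q (X q) (Y q))" using induced_form_fields(1) by simp
  qed
  show "closed_form (open_atlas U) \<omega>"
    unfolding closed_form_def
  proof (intro allI impI ballI, elim conjE)
    fix S X Y Z p
    assume S: "open S" and SU: "S \<subseteq> mfd_carrier (open_atlas U)"
      and X: "smooth_vfield (open_atlas U) S X" and Y: "smooth_vfield (open_atlas U) S Y"
      and Z: "smooth_vfield (open_atlas U) S Z" and p: "p \<in> S"
    have SU': "S \<subseteq> U" using SU by simp
    then have pU: "p \<in> U" using p by blast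
    have T: "V p \<in> tangent_space (open_atlas U) p" if "smooth_vfield (open_atlas U) S V" for V
      using smooth_vfieldD(1)[OF that p] .
    have lie: "lie_bracket (open_atlas U) V W p (U, id) = nabla p (V p) W (U, id) - nabla p (W p) V (U, id)"
      if "smooth_vfield (open_atlas U) S V" "smooth_vfield (open_atlas U) S W" for V W
      using t S SU p that unfolding torsionfree_def by metis
    note d = induced_form_fields(2)[OF S SU' _ _ n p T]
    show "deriv_at (open_atlas U) p (X p) (\<lambda>q. \<omega> q (Y q) (Z q))
          + deriv_at (open_atlas U) p (Y p) (\<lambda>q. \<omega> q (Z q) (X q))
          + deriv_at (open_atlas U) p (Z p) (\<lambda>q. \<omega> q (X q) (Y q))
          - \<omega> p (lie_bracket (open_atlas U) X Y p) (Z p)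
          - \<omega> p (lie_bracket (open_atlas U) Y Z p) (X p)
          - \<omega> p (lie_bracket (open_atlas U) Z X p) (Y p) = 0"
      unfolding d[OF Y Z X] d[OF Z X Y] d[OF X Y Z] induced_form_eq[OF pU] lie[OF X Y] lie[OF Y Z] lie[OF Z X]
        linear_diff[OF linear_Dg[OF pU]] sf.diff_left
      using standard_form_alt[of "Dg p (X p (U, id))"] standard_form_alt[of "Dg p (Y p (U, id))"]
        standard_form_alt[of "Dg p (Z p (U, id))"] by simp
  qed
  fix p v c
  assume p: "p \<in> mfd_carrier (open_atlas U)" and v: "v \<in> tangent_space (open_atlas U) p"
    and 0: "\<forall>u\<in>tangent_space (open_atlas U) p. \<omega> p v u = 0"
  then have p: "p \<in> U" by simp
  have "Dg p (v (U, id)) = 0"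
  proof (rule standard_form_nondegenerate)
    fix b
    \<comment> \<open>Dg is onto, so every b comes from a tangent vector.\<close>
    define u :: "(complex^'n, 'n) tvec" where "u = (\<lambda>d. if d = (U, id) then inv (Dg p) b else 0)"
    have "u \<in> tangent_space (open_atlas U) p"
      by (simp add: tangent_space_open_atlas[OF open_U p] u_def)
    then show "standard_form (Dg p (v (U, id))) b = 0"
      using 0 p by (auto simp: induced_form_eq[OF p] u_def)
  qed
  then have "v (U, id) = 0" using linear_injective_0[OF linear_Dg[OF p]] inj_g[OF p] by blast
  then show "v c = 0" using v unfolding tangent_space_open_atlas[OF open_U p] by (cases "c = (U, id)") (simp, blast)
qed

end

section \<open>Conic one-forms and the scaling action\<close>

lemma scale_has_derivative:
  "((\<lambda>p. fst p *s snd p) has_derivative (\<lambda>q. fst q *s snd p + fst p *s snd q)) (at (p :: complex \<times> (complex^'n)))"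
  unfolding has_derivative_vec_iff
  by (auto intro!: derivative_eq_intros bounded_linear.has_derivative[OF bounded_linear_vec_nth])

locale conic_one_form = regular_one_form U F
  for U :: "(complex^'n::finite) set" and F +
  assumes conic: "conic_1form U F"
begin

lemma scale_left_has_derivative: "((\<lambda>\<mu>. \<mu> *s z) has_derivative (\<lambda>h. h *s z)) (at \<mu>)" for z :: "complex^'n"
  unfolding has_derivative_vec_iff by (auto intro!: derivative_eq_intros)

lemma Euler: "z \<in> U \<Longrightarrow> DF z z = F z"
proof -
  assume z: "z \<in> U"
  have "(F has_derivative DF z) (at (1 *s z))" using F_has_derivative[OF z] by simp
  then have "((\<lambda>\<mu>. F (\<mu> *s z)) has_derivative (\<lambda>h. DF z (h *s z))) (at 1)"
    using diff_chain_at[OF scale_left_has_derivative] by (fastforce simp: o_def)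
  moreover have "((\<lambda>\<mu>. F (\<mu> *s z)) has_derivative (\<lambda>h. h *s F z)) (at 1)"
  proof (rule has_derivative_transform_eventually[OF scale_left_has_derivative])
    have "\<forall>\<^sub>F \<mu> in nhds 1. F (\<mu> *s z) = \<mu> *s F z" using conic z by (simp add: conic_1form_def)
    then show "\<forall>\<^sub>F \<mu> in at 1. \<mu> *s F z = F (\<mu> *s z)"
      by (auto simp: eventually_nhds_conv_at elim: eventually_mono)
  qed simp_all
  ultimately have "(\<lambda>h. DF z (h *s z)) = (\<lambda>h. h *s F z)" by (rule has_derivative_unique)
  from fun_cong[OF this, of 1] show ?thesis by simp
qed

text \<open>Differentiating DF(y) y = F(y) in a direction v cancels DF v and leaves zero for the
  second derivative on (v, z). Symmetry makes z the direction of differentiation, and complex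
  linearity extends this to all multiples of z.\<close>

lemma second_derivative_radial:
  assumes z: "z \<in> U"
  shows "frechet_derivative (\<lambda>y. DF y v) (at z) (h *s z) = 0"
proof -
  have diff: "(\<lambda>y. DF y w) differentiable (at z)" for w
    using Ck_on_imp_has_derivative[OF Ck_on_frechet_derivative[OF smooth_F] z] by (rule differentiableI)
  have "((\<lambda>y. DF y y) has_derivative (\<lambda>v. frechet_derivative (\<lambda>y. DF y z) (at z) v + DF z v)) (at z)"
    by (rule has_derivative_linear_family[where A=DF and h="\<lambda>y. y", OF open_U z linear_DF diff has_derivative_ident refl])
  moreover have "((\<lambda>y. DF y y) has_derivative DF z) (at z)"
    using F_has_derivative[OF z] by (rule has_derivative_transform_within_open[OF _ open_U z]) (simp add: Euler)
  ultimately have "(\<lambda>v. frechet_derivative (\<lambda>y. DF y z) (at z) v + DF z v) = DF z" by (rule has_derivative_unique)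
  from fun_cong[OF this, of v] have "frechet_derivative (\<lambda>y. DF y v) (at z) z = 0"
    using second_derivative_symmetric[OF open_U z smooth_F, of v z] by simp
  moreover have "frechet_derivative (\<lambda>y. DF y v) (at z) (h *s z) = h *s frechet_derivative (\<lambda>y. DF y v) (at z) z"
    using holoD[OF holo_frechet_derivative[OF open_U linear_imul holo_F] z]
    by (intro linear_complex_scale has_derivative_linear[where F="at z"])
  ultimately show ?thesis by simp
qed

definition scale_domain :: "(complex \<times> (complex^'n)) set" where
  "scale_domain = {(\<mu>, z). \<mu> \<noteq> 0 \<and> z \<in> U \<and> \<mu> *s z \<in> U}"

lemma continuous_on_scale: "continuous_on S (\<lambda>p. fst p *s (snd p :: complex^'n))"
  using has_derivative_continuous[OF scale_has_derivative] by (intro continuous_at_imp_continuous_on) auto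

lemma open_scale_domain: "open scale_domain"
proof -
  have "scale_domain = {p. fst p \<noteq> 0} \<inter> (snd -` U) \<inter> ((\<lambda>p. fst p *s snd p) -` U)"
    by (auto simp: scale_domain_def)
  then show ?thesis
    using open_U continuous_on_scale by (auto intro!: open_Int open_Collect_neq open_vimage continuous_intros)
qed

lemma local_Cstar_action_scale: "local_Cstar_action (open_atlas U) scale_domain (*s)"
  unfolding local_Cstar_action_def mfd_carrier_open_atlas
proof (intro conjI ballI allI impI)
  show "open scale_domain" by (rule open_scale_domain)
  show "{1} \<times> U \<subseteq> scale_domain" "scale_domain \<subseteq> (- {0}) \<times> U" by (auto simp: scale_domain_def)
  show "case p of (\<mu>, p) \<Rightarrow> \<mu> *s p \<in> U" if "p \<in> scale_domain" for p using that by (auto simp: scale_domain_def)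
  show "continuous_on scale_domain (\<lambda>(\<mu>, p). \<mu> *s p)" using continuous_on_scale by (simp add: split_beta)
  fix c d assume "c \<in> open_atlas U" "d \<in> open_atlas U"
  then have cd: "c = (U, id)" "d = (U, id)" by (simp_all add: open_atlas_def)
  have eq: "{(\<mu>, z). z \<in> snd c ` fst c \<and> (\<mu>, chart_inv c z) \<in> scale_domain \<and> \<mu> *s chart_inv c z \<in> fst d} = scale_domain"
    by (auto simp: cd scale_domain_def)
  have "holo imul_C imul (\<lambda>p. fst p *s snd p) scale_domain"
    by (rule holoI[OF scale_has_derivative]) (auto simp: imul_C_def imul_def vec_eq_iff algebra_simps split: prod.splits)
  then have "holo imul_C imul (\<lambda>(\<mu>, z). snd d (\<mu> *s chart_inv c z)) scale_domain"
    by (rule holo_cong[OF open_scale_domain, rotated]) (auto simp: cd scale_domain_def)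
  then show "holo imul_C imul (\<lambda>(\<mu>, z). snd d (\<mu> *s chart_inv c z))
     {(\<mu>, z). z \<in> snd c ` fst c \<and> (\<mu>, chart_inv c z) \<in> scale_domain \<and> \<mu> *s chart_inv c z \<in> fst d}"
    unfolding eq .
qed (auto simp: vector_smult_assoc)

text \<open>For a parallel X the function \<open>Dg z (X z (U, id))\<close> has zero derivative, and
  Dg is constant along complex rays. Hence X has the same components at q and at \<mu> q, while the
  differential of scaling is multiplication by \<mu>.\<close>

lemma conic_action_scale:
  assumes n: "coordinate_compatible U g nabla"
  shows "conic_action (open_atlas U) nabla scale_domain (*s)"
  unfolding conic_action_def
proof (intro allI impI ballI, elim conjE)
  fix S X q \<mu>
  assume S: "open S" and SU: "S \<subseteq> mfd_carrier (open_atlas U)" and X: "parallel_vfield (open_atlas U) nabla S X"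
    and q: "q \<in> S" and \<mu>: "connected_component {\<nu>. (\<nu>, q) \<in> scale_domain \<and> \<nu> *s q \<in> S} 1 \<mu>"
  have SU: "S \<subseteq> U" using SU by simp
  have sX: "smooth_vfield (open_atlas U) S X" using X by (simp add: parallel_vfield_def)
  define T where "T = {\<nu>. (\<nu>, q) \<in> scale_domain \<and> \<nu> *s q \<in> S}"
  \<comment> \<open>T may be disconnected; constancy is propagated only along the component of 1,
    which is open because T is.\<close>
  define C where "C = connected_component_set T 1"
  have "T = {\<nu>. \<nu> \<noteq> 0} \<inter> ((\<lambda>\<nu>. \<nu> *s q) -` S)" using q SU by (auto simp: T_def scale_domain_def)
  moreover have "continuous_on UNIV (\<lambda>\<nu>. \<nu> *s q)"
    using has_derivative_continuous[OF scale_left_has_derivative] by (intro continuous_at_imp_continuous_on) auto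
  ultimately have "open T" using S by (auto intro!: open_Int open_Collect_neq open_vimage continuous_intros)
  then have C: "open C" "connected C" by (simp_all add: C_def open_connected_component)
  have "\<mu> \<in> C" "C \<subseteq> T" using \<mu> connected_component_subset by (auto simp: C_def T_def)
  moreover have "1 \<in> T" using q SU by (auto simp: T_def scale_domain_def)
  then have "1 \<in> C" by (simp add: C_def connected_component_refl)
  ultimately have CT: "\<mu> \<in> C" "1 \<in> C" "\<And>\<nu>. \<nu> \<in> C \<Longrightarrow> \<nu> \<noteq> 0 \<and> \<nu> *s q \<in> S \<and> \<nu> *s q \<in> U"
    using SU by (auto simp: T_def scale_domain_def)
  \<comment> \<open>The velocity of the orbit is a multiple of its current point, the direction
    covered by \<open>second_derivative_radial\<close>.\<close>
  have h: "h *s q = (h / \<nu>) *s (\<nu> *s q)" if "\<nu> \<in> C" for h \<nu>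
    using CT(3)[OF that] by (simp add: vector_smult_assoc)
  have const: "f (\<mu> *s q) = f q"
    if f: "\<And>\<nu>. \<nu> \<in> C \<Longrightarrow> (f has_derivative f' \<nu>) (at (\<nu> *s q))" "\<And>\<nu> h. \<nu> \<in> C \<Longrightarrow> f' \<nu> (h *s (\<nu> *s q)) = 0"
    for f :: "complex^'n \<Rightarrow> complex^'n" and f'
  proof -
    have "f (\<mu> *s q) = f (1 *s q)"
    proof (rule has_derivative_zero_unique_connected[OF C _ CT(1,2), of "\<lambda>\<nu>. f (\<nu> *s q)"])
      fix \<nu> assume \<nu>: "\<nu> \<in> C"
      have "((\<lambda>\<nu>. f (\<nu> *s q)) has_derivative (\<lambda>h. f' \<nu> (h *s q))) (at \<nu>)"
        using diff_chain_at[OF scale_left_has_derivative f(1)[OF \<nu>]] by (simp add: o_def)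
      moreover have "f' \<nu> (h *s q) = 0" for h by (subst h[OF \<nu>]) (rule f(2)[OF \<nu>])
      ultimately show "((\<lambda>\<nu>. f (\<nu> *s q)) has_derivative (\<lambda>h. 0)) (at \<nu>)" by simp
    qed
    then show ?thesis by simp
  qed
  have DF: "DF (\<mu> *s q) v = DF q v" for v
    by (rule const[OF Ck_on_imp_has_derivative[OF Ck_on_frechet_derivative[OF smooth_F]] second_derivative_radial])
      (use CT in auto)
  have qU: "q \<in> U" "\<mu> *s q \<in> U" "\<mu> *s q \<in> S" "\<mu> \<noteq> 0" using q SU CT by auto
  have Dg: "Dg (\<mu> *s q) v = Dg q v" for v
    using qU by (simp add: vec_eq_iff Dg_component DF)
  have par: "frechet_derivative (\<lambda>z. Dg z (X z (U, id))) (at y) w = 0" if y: "y \<in> S" for y w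
  proof -
    have yU: "y \<in> U" using y SU by blast
    define v :: "(complex^'n, 'n) tvec" where "v = (\<lambda>d. if d = (U, id) then w else 0)"
    have v: "v \<in> tangent_space (open_atlas U) y" by (simp add: tangent_space_open_atlas[OF open_U yU] v_def)
    then have "nabla y v X (U, id) = 0" using X y by (simp add: parallel_vfield_def)
    moreover have "Dg y (nabla y v X (U, id)) = frechet_derivative (\<lambda>z. Dg z (X z (U, id))) (at y) (v (U, id))"
      using n S SU sX y v unfolding coordinate_compatible_def by blast
    ultimately show ?thesis using linear_0[OF linear_Dg[OF yU]] by (simp add: v_def)
  qed
  have "Dg (\<mu> *s q) (X (\<mu> *s q) (U, id)) = Dg q (X q (U, id))"
    by (rule const[of "\<lambda>z. Dg z (X z (U, id))", OF
          Dg_field_has_derivative(1)[where x="\<lambda>z. X z (U, id)", OF S SU smooth_vfieldD'(1)[OF S SU sX]] par])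
      (use CT in auto)
  then have "Dg q (X (\<mu> *s q) (U, id)) = Dg q (X q (U, id))" by (simp add: Dg)
  then have eq: "X (\<mu> *s q) (U, id) = X q (U, id)" using inj_g[OF qU(1)] by (simp add: inj_eq)
  have z0: "X (\<mu> *s q) d = 0" if "d \<noteq> (U, id)" for d by (rule smooth_vfieldD'(2)[OF S SU sX qU(3) that])
  have "((\<lambda>z. \<mu> *s z) has_derivative (\<lambda>v. \<mu> *s v)) (at q)"
    unfolding has_derivative_vec_iff
    by (auto intro!: derivative_eq_intros bounded_linear.has_derivative[OF bounded_linear_vec_nth])
  then have D: "frechet_derivative (\<lambda>z. \<mu> *s z) (at q) v = \<mu> *s v" for v by (simp add: frechet_derivative_eq)
  show "tangent_map (open_atlas U) (open_atlas U) ((*s) \<mu>) q (X q)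
      = (\<lambda>c. Re \<mu> *\<^sub>R X (\<mu> *s q) c + Im \<mu> *\<^sub>R J_op (X (\<mu> *s q)) c)"
  proof
    fix d
    show "tangent_map (open_atlas U) (open_atlas U) ((*s) \<mu>) q (X q) d
        = Re \<mu> *\<^sub>R X (\<mu> *s q) d + Im \<mu> *\<^sub>R J_op (X (\<mu> *s q)) d"
    proof (cases "d = (U, id)")
      case True
      then show ?thesis
        using qU by (simp add: tangent_map_def open_atlas_def[of U, symmetric] deriv_at_open_atlas[OF open_U qU(1)] D
          J_op_def eq vector_scaleR_decomp[of \<mu> "X q (U, id)"] o_def) (simp add: open_atlas_def)
    next
      case False
      then show ?thesis by (simp add: tangent_map_def open_atlas_def z0 J_op_def)
    qed
  qed
qed

theorem induced_conic_symplectic_manifold: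
  assumes "induced_connection U (section_of F) nabla"
  shows "conic_symplectic_manifold (open_atlas U) nabla \<omega>"
proof -
  have n: "flat_torsionfree_connection (open_atlas U) nabla" "coordinate_compatible U g nabla"
    using assms by (simp_all add: induced_connection_iff)
  then show ?thesis
    unfolding conic_symplectic_manifold_def conic_complex_manifold_def
    using complex_manifold_open_atlas[OF open_U] local_Cstar_action_scale conic_action_scale[OF n(2)]
      parallel_induced_form[OF n(2)] symplectic_induced_form[OF n(2)]
    by (auto simp: flat_torsionfree_connection_def)
qed

end

section \<open>Parallel frames\<close>

text \<open>The parallel sections starting at the basis vectors share one ball, since its radius
  does not depend on the initial value; extending them linearly in that value gives P. Close to x0
  the map P is close to the identity, hence injective.\<close>

lemma parallel_frame_exists:
  fixes G :: "'a::euclidean_space \<Rightarrow> 'a \<Rightarrow> 'a \<Rightarrow> 'a"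
  assumes S: "open S" "x0 \<in> S" and lin1: "\<And>x v. x \<in> S \<Longrightarrow> linear (G x v)"
    and lin2: "\<And>x w. x \<in> S \<Longrightarrow> linear (\<lambda>v. G x v w)"
    and Ck: "\<And>k v w. Ck_on k S (\<lambda>x. G x v w)"
    and flat: "\<And>x u v w. x \<in> S \<Longrightarrow> frechet_derivative (\<lambda>x. G x v w) (at x) u
       - frechet_derivative (\<lambda>x. G x u w) (at x) v + G x u (G x v w) - G x v (G x u w) = 0"
  obtains r P where "r > 0" "ball x0 r \<subseteq> S" "\<And>w. P x0 w = w"
    "\<And>x. x \<in> ball x0 r \<Longrightarrow> linear (P x)" "\<And>x. x \<in> ball x0 r \<Longrightarrow> inj (P x)"
    "\<And>x w. x \<in> ball x0 r \<Longrightarrow> ((\<lambda>x. P x w) has_derivative (\<lambda>v. - G x v (P x w))) (at x)"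
    "\<And>k w. Ck_on k (ball x0 r) (\<lambda>x. P x w)"
proof -
  obtain r0 where r0: "r0 > 0" "ball x0 r0 \<subseteq> S"
    "\<And>e. \<exists>s. s x0 = e \<and> (\<forall>x\<in>ball x0 r0. (s has_derivative (\<lambda>v. - G x v (s x))) (at x))"
    using parallel_section_exists[of S x0 G, OF S lin1 lin2 Ck flat] by blast
  then obtain s where s: "\<And>e. s e x0 = e"
    "\<And>e x. x \<in> ball x0 r0 \<Longrightarrow> (s e has_derivative (\<lambda>v. - G x v (s e x))) (at x)" by metis
  define P where "P x w = (\<Sum>b\<in>Basis. (w \<bullet> b) *\<^sub>R s b x)" for x w
  have linP: "linear (P x)" for x
    by (rule linearI) (simp_all add: P_def inner_add_left scaleR_add_left sum.distrib scaleR_sum_right)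
  \<comment> \<open>DIM basis vectors, each displaced by less than e, displace w by at most half its
    norm.\<close>
  define e where "e = 1 / (2 * DIM('a))"
  have e: "e > 0" by (simp add: e_def)
  have "\<forall>b\<in>Basis. \<forall>\<^sub>F x in nhds x0. dist (s b x) b < e"
  proof
    fix b :: 'a
    have "isCont (s b) x0" using has_derivative_continuous[OF s(2)] r0 by auto
    then have "(s b \<longlongrightarrow> b) (nhds x0)" using s(1)[of b] by (simp add: isCont_def tendsto_nhds_iff)
    then show "\<forall>\<^sub>F x in nhds x0. dist (s b x) b < e" using e by (rule tendstoD)
  qed
  then have "\<forall>\<^sub>F x in nhds x0. \<forall>b\<in>Basis. dist (s b x) b < e"
    by (simp add: eventually_ball_finite_distrib)
  then obtain r1 where r1: "r1 > 0" "\<And>x b. dist x x0 < r1 \<Longrightarrow> b \<in> Basis \<Longrightarrow> dist (s b x) b < e"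
    unfolding eventually_nhds_metric by blast
  define r where "r = min r0 r1"
  have r: "r > 0" "ball x0 r \<subseteq> ball x0 r0" "ball x0 r \<subseteq> S" using r0 r1 by (auto simp: r_def)
  have inj: "inj (P x)" if x: "x \<in> ball x0 r" for x
    unfolding linear_injective_0[OF linP]
  proof (intro allI impI)
    fix w assume w: "P x w = 0"
    have "norm (P x w - w) = norm (\<Sum>b\<in>Basis. (w \<bullet> b) *\<^sub>R (s b x - b))"
      by (simp add: P_def scaleR_diff_right sum_subtractf euclidean_representation)
    also have "\<dots> \<le> (\<Sum>b\<in>(Basis::'a set). norm w * e)"
    proof (rule sum_norm_le)
      fix b :: 'a assume b: "b \<in> Basis"
      have "\<bar>w \<bullet> b\<bar> * norm (s b x - b) \<le> norm w * e"
        using r1(2)[of x b] x b by (intro mult_mono Basis_le_norm) (auto simp: r_def dist_commute dist_norm[symmetric])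
      then show "norm ((w \<bullet> b) *\<^sub>R (s b x - b)) \<le> norm w * e" by simp
    qed
    also have "\<dots> = norm w / 2" by (simp add: e_def)
    finally show "w = 0" using w by simp
  qed
  have der: "((\<lambda>x. P x w) has_derivative (\<lambda>v. - G x v (P x w))) (at x)" if x: "x \<in> ball x0 r" for x w
  proof -
    have xS: "x \<in> S" using x r by blast
    have "((\<lambda>x. P x w) has_derivative (\<lambda>v. \<Sum>b\<in>Basis. (w \<bullet> b) *\<^sub>R (- G x v (s b x)))) (at x)"
      unfolding P_def by (intro has_derivative_sum has_derivative_scaleR_right s(2)) (use x r in blast)
    then show ?thesis
      by (simp add: P_def linear_sum[OF lin1[OF xS]] linear_cmul[OF lin1[OF xS]] sum_negf)
  qed
  have "Ck_on k (ball x0 r) (\<lambda>x. P x w)" for k w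
    by (rule parallel_section_Ck_on[OF open_ball _ Ck_on_subset[OF Ck r(3)] der]) (use r lin1 in auto)
  then show ?thesis
    using r linP inj der by (intro that[of r P]) (auto simp: P_def s euclidean_representation)
qed

text \<open>dP = - G P gives dT = T G for the inverse T, so differentiating the components of a
  field \<eta> amounts to applying T to its covariant derivative.\<close>

lemma frame_components_has_derivative:
  fixes G :: "'a::euclidean_space \<Rightarrow> 'a \<Rightarrow> 'a \<Rightarrow> 'a" and P T :: "'a \<Rightarrow> 'a \<Rightarrow> 'a"
  assumes B: "open B" "x \<in> B" and lin: "\<And>x. x \<in> B \<Longrightarrow> linear (P x)"
    and PT: "\<And>x u. x \<in> B \<Longrightarrow> P x (T x u) = u" and TP: "\<And>x u. x \<in> B \<Longrightarrow> T x (P x u) = u"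
    and P: "\<And>x w. x \<in> B \<Longrightarrow> ((\<lambda>x. P x w) has_derivative (\<lambda>v. - G x v (P x w))) (at x)"
    and \<eta>: "(\<eta> has_derivative \<eta>') (at x)"
  shows "((\<lambda>x. T x (\<eta> x)) has_derivative (\<lambda>v. T x (G x v (\<eta> x) + \<eta>' v))) (at x)"
proof -
  have linT: "linear (T x)" if "x \<in> B" for x
    by (rule linear_inverse_fun[OF lin[OF that] TP[OF that] PT[OF that]])
  have cont: "continuous_on B (\<lambda>x. P x w)" for w
    by (rule continuous_at_imp_continuous_on) (use has_derivative_continuous[OF P] in auto)
  have dT: "((\<lambda>x. T x u) has_derivative (\<lambda>v. - T x (- G x v u))) (at x)" for u
    using has_derivative_inverse_family[where A=P and B=T and ?x0.0=x and u=u, OF B lin cont TP PT P[OF B(2)] refl] PT[OF B(2)] by simp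
  have "((\<lambda>x. T x (\<eta> x)) has_derivative (\<lambda>v. frechet_derivative (\<lambda>y. T y (\<eta> x)) (at x) v + T x (\<eta>' v))) (at x)"
    by (rule has_derivative_linear_family[where A=T, OF B linT differentiableI[OF dT] \<eta> refl])
  then show ?thesis
    by (simp add: frechet_derivative_eq[OF dT] linear_add[OF linT[OF B(2)]] linear_neg[OF linT[OF B(2)]])
qed

section \<open>The holomorphic inverse function theorem\<close>

text \<open>The real inverse function theorem provides \<kappa>; its derivative inverts a complex
  linear map and is therefore complex linear.\<close>

lemma holo_inverse_function:
  fixes f :: "complex^'n \<Rightarrow> complex^'n"
  assumes B: "open B" "x0 \<in> B" and f: "holo imul imul f B" and inj: "inj (frechet_derivative f (at x0))"
  obtains N V \<kappa> where "open N" "N \<subseteq> B" "x0 \<in> N" "open V" "homeomorphism N V f \<kappa>" "holo imul imul \<kappa> V"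
    "\<And>y v. y \<in> V \<Longrightarrow> frechet_derivative \<kappa> (at y) (frechet_derivative f (at (\<kappa> y)) v) = v"
    "\<And>y v. y \<in> V \<Longrightarrow> frechet_derivative f (at (\<kappa> y)) (frechet_derivative \<kappa> (at y) v) = v"
proof -
  define f' where "f' x = Blinfun (frechet_derivative f (at x))" for x
  have f': "blinfun_apply (f' x) = frechet_derivative f (at x)" if "x \<in> B" for x
    unfolding f'_def by (rule bounded_linear_Blinfun_apply[OF has_derivative_bounded_linear[OF holoD(1)[OF f that]]])
  have lin0: "linear (frechet_derivative f (at x0))" using holoD(1)[OF f B(2)] by (rule has_derivative_linear)
  obtain g where g: "linear g" "g \<circ> frechet_derivative f (at x0) = id"
    using linear_injective_left_inverse[OF lin0 inj] by blast
  have bl: "blinfun_apply (Blinfun g) = g"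
    by (rule bounded_linear_Blinfun_apply) (use g(1) linear_conv_bounded_linear in blast)
  have inv: "Blinfun g o\<^sub>L f' x0 = id_blinfun"
    by (rule blinfun_eqI) (use g(2) bl f'[OF B(2)] in \<open>simp add: o_def fun_eq_iff\<close>)
  have der: "(f has_derivative blinfun_apply (f' x)) (at x)" if "x \<in> B" for x
    using holoD(1)[OF f that] f'[OF that] by simp
  have cont: "continuous_on B f'"
  proof (rule continuous_on_blinfun_componentwise)
    fix b :: "complex^'n"
    have "continuous_on B (\<lambda>x. frechet_derivative f (at x) b)"
      by (rule Ck_on_imp_continuous[OF Ck_on_frechet_derivative[OF holo_imp_Ck_on[OF B(1) linear_imul f, of "Suc 0"]]])
    then show "continuous_on B (\<lambda>x. f' x b)" by (rule continuous_on_eq) (simp add: f')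
  qed
  obtain N V \<kappa> \<kappa>' where N: "open N" "N \<subseteq> B" "x0 \<in> N" "open V" "homeomorphism N V f \<kappa>"
    and \<kappa>: "\<And>y. y \<in> V \<Longrightarrow> (\<kappa> has_derivative \<kappa>' y) (at y)"
      "\<And>y. y \<in> V \<Longrightarrow> \<kappa>' y = Hilbert_Choice.inv (blinfun_apply (f' (\<kappa> y)))"
      "\<And>y. y \<in> V \<Longrightarrow> bij (blinfun_apply (f' (\<kappa> y)))"
    using inverse_function_theorem[OF B(1) der cont B(2) inv] by metis
  have \<kappa>N: "\<kappa> y \<in> B" if "y \<in> V" for y using N(2,5) that by (auto simp: homeomorphism_def)
  have d\<kappa>: "frechet_derivative \<kappa> (at y) = \<kappa>' y" if "y \<in> V" for y using \<kappa>(1)[OF that] by (rule frechet_derivative_eq)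
  have i1: "frechet_derivative \<kappa> (at y) (frechet_derivative f (at (\<kappa> y)) v) = v" if "y \<in> V" for y v
    using bij_is_inj[OF \<kappa>(3)[OF that]] by (simp add: d\<kappa>[OF that] \<kappa>(2)[OF that] f'[OF \<kappa>N[OF that], symmetric])
  have i2: "frechet_derivative f (at (\<kappa> y)) (frechet_derivative \<kappa> (at y) v) = v" if "y \<in> V" for y v
    using bij_is_surj[OF \<kappa>(3)[OF that]]
    by (simp add: d\<kappa>[OF that] \<kappa>(2)[OF that] f'[OF \<kappa>N[OF that], symmetric] surj_f_inv_f)
  have "holo imul imul \<kappa> V"
  proof (rule holoI)
    show "(\<kappa> has_derivative frechet_derivative \<kappa> (at y)) (at y)" if "y \<in> V" for y
      using \<kappa>(1)[OF that] d\<kappa>[OF that] by simp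
    show "frechet_derivative \<kappa> (at y) (imul v) = imul (frechet_derivative \<kappa> (at y) v)" if y: "y \<in> V" for y v
    proof -
      have "frechet_derivative f (at (\<kappa> y)) (imul (frechet_derivative \<kappa> (at y) v)) = imul v"
        by (simp add: holoD(2)[OF f \<kappa>N[OF y]] i2[OF y])
      then show ?thesis using i1[OF y, of "imul (frechet_derivative \<kappa> (at y) v)"] by simp
    qed
  qed
  then show ?thesis using N i1 i2 by (intro that[of N V \<kappa>])
qed

text \<open>By Euler's equation the function \<open>inverse \<mu> *s F (\<mu> *s z)\<close> of \<mu>
  has zero derivative on a disc around 1, so it keeps its value at 1.\<close>

lemma (in holomorphic_one_form) Euler_imp_conic:
  assumes Euler: "\<And>z. z \<in> U \<Longrightarrow> DF z z = F z"
  shows "conic_1form U F"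
  unfolding conic_1form_def
proof
  fix z assume z: "z \<in> U"
  have s: "((\<lambda>\<mu>. \<mu> *s z) has_derivative (\<lambda>h. h *s z)) (at \<mu>)" for \<mu> and z :: "complex^'n"
    unfolding has_derivative_vec_iff by (auto intro!: derivative_eq_intros)
  have "continuous_on UNIV (\<lambda>\<mu>. \<mu> *s z)"
    using has_derivative_continuous[OF s] by (intro continuous_at_imp_continuous_on) auto
  then have o: "open ({\<mu>::complex. \<mu> \<noteq> 0} \<inter> ((\<lambda>\<mu>. \<mu> *s z) -` U))"
    using open_U by (intro open_Int open_Collect_neq open_vimage continuous_intros)
  have "1 \<in> {\<mu>::complex. \<mu> \<noteq> 0} \<inter> ((\<lambda>\<mu>. \<mu> *s z) -` U)" using z by simp
  then obtain d where d: "d > 0" "ball 1 d \<subseteq> {\<mu>::complex. \<mu> \<noteq> 0} \<inter> ((\<lambda>\<mu>. \<mu> *s z) -` U)"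
    by (rule openE[OF o])
  have "inverse \<mu> *s F (\<mu> *s z) = inverse 1 *s F (1 *s z)" if \<mu>: "\<mu> \<in> ball 1 d" for \<mu> :: complex
  proof (rule has_derivative_zero_unique_connected[OF open_ball connected_ball _ \<mu>, of "\<lambda>\<mu>. inverse \<mu> *s F (\<mu> *s z)"])
    fix \<nu> :: complex assume "\<nu> \<in> ball 1 d"
    from subsetD[OF d(2) this] have \<nu>: "\<nu> \<noteq> 0" "\<nu> *s z \<in> U" by simp_all
    have F: "((\<lambda>\<mu>. F (\<mu> *s z)) has_derivative (\<lambda>h. DF (\<nu> *s z) (h *s z))) (at \<nu>)"
      using diff_chain_at[OF s F_has_derivative[OF \<nu>(2)]] by (simp add: o_def)
    have "DF (\<nu> *s z) (h *s z) = (h / \<nu>) *s F (\<nu> *s z)" for h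
    proof -
      have "h *s z = (h / \<nu>) *s (\<nu> *s z)" using \<nu>(1) by (simp add: vector_smult_assoc)
      then show ?thesis using DF_scale[OF \<nu>(2), of "h / \<nu>" "\<nu> *s z"] Euler[OF \<nu>(2)] by (simp only:)
    qed
    with F have F': "((\<lambda>\<mu>. F (\<mu> *s z)) has_derivative (\<lambda>h. (h / \<nu>) *s F (\<nu> *s z))) (at \<nu>)" by simp
    have i: "(inverse has_derivative (\<lambda>h. - (inverse \<nu> * h * inverse \<nu>))) (at \<nu>)"
      using \<nu>(1) by (rule has_derivative_inverse')
    \<comment> \<open>The projections are left in place so that the product rule
      \<open>scale_has_derivative\<close> matches syntactically.\<close>
    have "((\<lambda>\<mu>. fst (inverse \<mu>, F (\<mu> *s z)) *s snd (inverse \<mu>, F (\<mu> *s z))) has_derivative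
        (\<lambda>h. fst (- (inverse \<nu> * h * inverse \<nu>), (h / \<nu>) *s F (\<nu> *s z)) *s snd (inverse \<nu>, F (\<nu> *s z))
           + fst (inverse \<nu>, F (\<nu> *s z)) *s snd (- (inverse \<nu> * h * inverse \<nu>), (h / \<nu>) *s F (\<nu> *s z)))) (at \<nu>)"
      using diff_chain_at[OF has_derivative_Pair[OF i F'] scale_has_derivative] by (simp add: o_def)
    moreover have z0: "- (inverse \<nu> * h * inverse \<nu>) *s w + inverse \<nu> *s ((h / \<nu>) *s w) = 0" for h and w :: "complex^'n"
      by (simp add: vec_eq_iff divide_inverse)
    ultimately show "((\<lambda>\<mu>. inverse \<mu> *s F (\<mu> *s z)) has_derivative (\<lambda>h. 0)) (at \<nu>)"
      by (simp only: fst_conv snd_conv z0)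
  qed (use d in simp)
  then have "F (\<mu> *s z) = \<mu> *s F z" if "\<mu> \<in> ball 1 d" for \<mu> :: complex
  proof -
    have "\<mu> \<noteq> 0" using subsetD[OF d(2) that] by simp
    then show ?thesis using \<open>\<And>\<mu>. \<mu> \<in> ball 1 d \<Longrightarrow> _\<close>[OF that] by (metis inverse_1 right_inverse vector_smult_assoc vector_smult_lid)
  qed
  then show "\<forall>\<^sub>F \<mu> in nhds 1. F (\<mu> *s z) = \<mu> *s F z"
    using eventually_nhds_in_open[of "ball 1 d" 1] d by (auto elim: eventually_mono)
qed

section \<open>Flat torsionfree connections in a chart\<close>

locale flat_torsionfree_atlas = atlas_connection +
  assumes flat: "flat_connection A nabla" and torsionfree: "torsionfree A nabla"
begin

lemma zero_tangent: "(\<lambda>c. 0) \<in> tangent_space A q"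
  using linear_0[OF linear_transition_deriv] by (intro tangent_spaceI) auto

text \<open>Fields of constant components commute, so vanishing torsion is the symmetry of the
  Christoffel symbols.\<close>

lemma
  assumes c: "c \<in> A" and q: "q \<in> fst c"
  shows christoffel_symmetric: "christoffel c (snd c q) v w = christoffel c (snd c q) w v"
    and lie_bracket_const: "lie_bracket A (\<lambda>q. chart_tvec A c q v) (\<lambda>q. chart_tvec A c q w) q = (\<lambda>c. 0)"
proof -
  define E where "E w = (\<lambda>q. chart_tvec A c q w)" for w
  note C = open_chart(1)[OF c] carrier[OF c]
  have K: "smooth_vfield A (fst c) (E w)" for w unfolding E_def by (rule const_field_smooth[OF c])
  have t: "E w q \<in> tangent_space A q" for w unfolding E_def by (rule chart_tvec_in_tangent_space[OF c q])
  have tor: "nabla q (E v q) (E w) d - nabla q (E w q) (E v) d = lie_bracket A (E v) (E w) q d" for d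
    using torsionfree[unfolded torsionfree_def, rule_format, of "fst c" "E v" "E w" q d] C K q by blast
  have "frechet_derivative (\<lambda>z. E w (chart_inv c z) c) (at (snd c q)) = (\<lambda>_. 0)" for w
    by (rule frechet_derivative_eq, rule has_derivative_transform_within_open[OF has_derivative_const open_chart(2)[OF c], of _ w])
      (use c q in \<open>auto simp: E_def\<close>)
  then have 0: "lie_bracket A (E v) (E w) q c = 0"
    using c q by (simp add: lie_bracket_def)
  show "christoffel c (snd c q) v w = christoffel c (snd c q) w v"
    using tor[of c] 0 c q by (simp add: christoffel_def E_def)
  \<comment> \<open>The bracket vanishes in the chart c by computation. To pass to the other charts
    it has to be a tangent vector, which follows because torsionfreeness displays it as a
    combination of covariant derivatives.\<close>
  have "lie_bracket A (E v) (E w) q = (\<lambda>d. 1 *\<^sub>R nabla q (E v q) (E w) d + (-1) *\<^sub>R nabla q (E w q) (E v) d)"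
    using tor by (intro ext) simp
  moreover have "\<dots> \<in> tangent_space A q"
    by (intro tangent_space_lincomb nabla_tangent[OF C K q t])
  ultimately have "lie_bracket A (E v) (E w) q \<in> tangent_space A q" by simp
  from tangent_space_eqI[OF c q this zero_tangent 0]
  show "lie_bracket A (\<lambda>q. chart_tvec A c q v) (\<lambda>q. chart_tvec A c q w) q = (\<lambda>c. 0)" by (simp add: E_def)
qed

lemma nabla_zero:
  assumes "open S" "S \<subseteq> mfd_carrier A" "smooth_vfield A S X" "q \<in> S"
  shows "nabla q (\<lambda>c. 0) X = (\<lambda>c. 0)"
  using nabla_lincomb[OF assms zero_tangent zero_tangent, of 0 0] by simp

text \<open>The curvature condition for fields of constant components, whose bracket drops out; it
  is the integrability condition under which parallel sections exist.\<close>

lemma christoffel_flat: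
  assumes c: "c \<in> A" and z: "z \<in> snd c ` fst c"
  shows "frechet_derivative (\<lambda>x. christoffel c x v w) (at z) u - frechet_derivative (\<lambda>x. christoffel c x u w) (at z) v
    + christoffel c z u (christoffel c z v w) - christoffel c z v (christoffel c z u w) = 0"
proof -
  obtain q where q: "q \<in> fst c" "z = snd c q" using z by blast
  define E where "E w = (\<lambda>q. chart_tvec A c q w)" for w
  note C = open_chart(1)[OF c] carrier[OF c]
  have K: "smooth_vfield A (fst c) (E w)" for w unfolding E_def by (rule const_field_smooth[OF c])
  have t: "E w q \<in> tangent_space A q" for w unfolding E_def by (rule chart_tvec_in_tangent_space[OF c q(1)])
  have n: "nabla q (E u q) (\<lambda>q. nabla q (E v q) (E w)) c
      = frechet_derivative (\<lambda>x. christoffel c x v w) (at z) u + christoffel c z u (christoffel c z v w)" for u v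
  proof -
    have "frechet_derivative (\<lambda>x. nabla (chart_inv c x) (E v (chart_inv c x)) (E w) c) (at z)
        = frechet_derivative (\<lambda>x. christoffel c x v w) (at z)"
      by (simp add: christoffel_def E_def)
    then show ?thesis
      using nabla_chart[OF c C(1) order_refl nabla_smooth[OF C K K] q(1) t] c q
      by (simp add: E_def christoffel_def)
  qed
  have "nabla q (E u q) (\<lambda>q. nabla q (E v q) (E w)) c - nabla q (E v q) (\<lambda>q. nabla q (E u q) (E w)) c
      - nabla q (lie_bracket A (E u) (E v) q) (E w) c = 0"
    using flat[unfolded flat_connection_def, rule_format, of "fst c" "E u" "E v" "E w" q c] C K q by blast
  moreover have "lie_bracket A (E u) (E v) q = (\<lambda>c. 0)"
    unfolding E_def by (rule lie_bracket_const[OF c q(1)])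
  ultimately show ?thesis
    using nabla_zero[OF C K q(1)] by (simp add: n algebra_simps)
qed

end

section \<open>The action in a chart\<close>

lemma linear_imul_C: "linear (imul_C :: complex \<times> (complex^'n) \<Rightarrow> complex \<times> (complex^'n))"
  by (rule linearI)
    (simp_all add: imul_C_def split_beta prod_eq_iff linear_add[OF linear_imul] linear_cmul[OF linear_imul] distrib_left)

text \<open>
  The equation \<open>d\<phi>\<^sub>\<mu> X = \<mu> X\<close> for the fields of a parallel frame, differentiated at \<open>\<mu> = 1\<close>,
  computes the derivative of the generator \<open>\<xi>\<close> of the action: \<open>\<nabla>\<xi> = id\<close> and \<open>\<nabla>(J\<xi>) = J\<close>.
\<close>

lemma generator_derivative:
  fixes \<Phi> :: "complex \<times> (complex^'n) \<Rightarrow> complex^'n" and P :: "complex^'n \<Rightarrow> complex^'n \<Rightarrow> complex^'n"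
  assumes W: "open W" "open B" "z \<in> B" "(1, z) \<in> W"
    and \<Phi>: "holo imul_C imul \<Phi> W"
    and \<Phi>1: "\<Phi> (1, z) = z"
    and P: "\<And>w. ((\<lambda>x. P x w) has_derivative (\<lambda>v. - G v (P z w))) (at z)" and surj: "surj (P z)"
    and eq: "\<And>w. \<forall>\<^sub>F \<mu> in nhds 1. frechet_derivative \<Phi> (at (\<mu>, z)) (0, P z w) = \<mu> *s P (\<Phi> (\<mu>, z)) w"
  defines "\<xi> \<equiv> \<lambda>z. frechet_derivative \<Phi> (at (1, z)) (1, 0)"
  shows "(\<xi> has_derivative (\<lambda>v. v - G (\<xi> z) v)) (at z)"
    and "((\<lambda>z. imul (\<xi> z)) has_derivative (\<lambda>v. imul v - G (imul (\<xi> z)) v)) (at z)"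
proof -
  define H where "H v p = frechet_derivative \<Phi> (at p) v" for v p
  note C = holo_imp_Ck_on[OF W(1) linear_imul_C \<Phi>]
  have hH: "holo imul_C imul (H v) W" for v
    unfolding H_def by (rule holo_frechet_derivative[OF W(1) linear_imul_C \<Phi>])
  define K where "K v u = frechet_derivative (H v) (at (1, z)) u" for v u
  have dH: "(H v has_derivative K v) (at (1, z))" "K v (imul_C u) = imul (K v u)" for v u
    using holoD[OF hH W(4)] by (simp_all add: K_def[abs_def])
  \<comment> \<open>This exchanges the derivatives in \<mu> and z: the z-derivative of the generator
    becomes the \<mu>-derivative of the z-derivative of \<Phi>, which the frame equation
    determines.\<close>
  have sym: "K v u = K u v" for u v
    unfolding K_def H_def by (rule second_derivative_symmetric[OF W(1,4) C])
  have emb: "((\<lambda>z. (1, z)) has_derivative (\<lambda>v. (0, v))) (at z)"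
    by (auto intro!: derivative_eq_intros)
  have d\<xi>: "(\<xi> has_derivative (\<lambda>v. K (0, v) (1, 0))) (at z)"
    using diff_chain_at[OF emb dH(1)[of "(1, 0)"]]
    by (simp add: o_def \<xi>_def H_def sym[of "(1, 0)"])
  have Hi: "H (\<i>, 0) (1, z) = imul (\<xi> z)"
    using holoD(2)[OF \<Phi> W(4), of "(1, 0)"] by (simp add: H_def \<xi>_def imul_C_def)
  have Ki: "K (0, v) (\<i>, 0) = imul (K (0, v) (1, 0))" for v
    using dH(2)[of "(0, v)" "(1, 0)"] by (simp add: imul_C_def)
  \<comment> \<open>Both sides of the frame equation are differentiated at \<mu> = 1 in the complex
    direction h. The choice h = 1 yields the derivative of \<xi>, the choice h = i that of J\<xi>,
    without any assumption that J is parallel.\<close>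
  have key: "K (0, v) (h, 0) = h *s v - G (H (h, 0) (1, z)) v" for v h
  proof -
    obtain w where w: "v = P z w" using surjD[OF surj] by blast
    have e1: "((\<lambda>\<mu>. (\<mu>, z)) has_derivative (\<lambda>h. (h, 0))) (at 1)"
      by (auto intro!: derivative_eq_intros)
    have l: "((\<lambda>\<mu>. H (0, v) (\<mu>, z)) has_derivative (\<lambda>h. K (0, v) (h, 0))) (at 1)"
      using diff_chain_at[OF e1 dH(1)[of "(0, v)"]] by (simp add: o_def)
    have "((\<lambda>\<mu>. \<Phi> (\<mu>, z)) has_derivative (\<lambda>h. H (h, 0) (1, z))) (at 1)"
      using diff_chain_at[OF e1 holoD(1)[OF \<Phi> W(4)]] by (simp add: o_def H_def)
    moreover have "((\<lambda>x. P x w) has_derivative (\<lambda>v. - G v (P z w))) (at (\<Phi> (1, z)))" using P \<Phi>1 by simp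
    ultimately have "((\<lambda>\<mu>. P (\<Phi> (\<mu>, z)) w) has_derivative (\<lambda>h. - G (H (h, 0) (1, z)) v)) (at 1)"
      using diff_chain_at[of "\<lambda>\<mu>. \<Phi> (\<mu>, z)" _ 1 "\<lambda>x. P x w"] by (simp add: o_def w)
    from diff_chain_at[OF has_derivative_Pair[OF has_derivative_ident this] scale_has_derivative]
    have "((\<lambda>\<mu>. \<mu> *s P (\<Phi> (\<mu>, z)) w) has_derivative (\<lambda>h. h *s v + 1 *s (- G (H (h, 0) (1, z)) v))) (at 1)"
      by (simp add: o_def \<Phi>1 w)
    then have "((\<lambda>\<mu>. H (0, v) (\<mu>, z)) has_derivative (\<lambda>h. h *s v + 1 *s (- G (H (h, 0) (1, z)) v))) (at 1)"
    proof (rule has_derivative_transform_eventually)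
      show "\<forall>\<^sub>F \<mu> in at 1. \<mu> *s P (\<Phi> (\<mu>, z)) w = H (0, v) (\<mu>, z)"
        using eq[of w] by (auto simp: eventually_nhds_conv_at H_def w elim: eventually_mono)
      show "1 *s P (\<Phi> (1, z)) w = H (0, v) (1, z)"
        using eventually_nhds_x_imp_x[OF eq[of w]] by (simp add: H_def w)
    qed simp
    from fun_cong[OF has_derivative_unique[OF l this], of h] show ?thesis by simp
  qed
  show "(\<xi> has_derivative (\<lambda>v. v - G (\<xi> z) v)) (at z)"
    using d\<xi> by (simp add: key) (simp add: H_def \<xi>_def)
  have bl: "bounded_linear (imul :: complex^'n \<Rightarrow> _)" using linear_imul linear_conv_bounded_linear by blast
  have "((\<lambda>z. imul (\<xi> z)) has_derivative (\<lambda>v. K (0, v) (\<i>, 0))) (at z)"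
    using bounded_linear.has_derivative[OF bl d\<xi>] by (simp add: Ki)
  then show "((\<lambda>z. imul (\<xi> z)) has_derivative (\<lambda>v. imul v - G (imul (\<xi> z)) v)) (at z)"
    unfolding key Hi by (simp add: imul_def)
qed

section \<open>Affine coordinates of a conic symplectic manifold\<close>

lemma (in flat_torsionfree_atlas) parallel_frame_at:
  assumes c: "c \<in> A" and p: "p \<in> fst c"
  obtains B P where "open B" "connected B" "snd c p \<in> B" "B \<subseteq> snd c ` fst c" "\<And>w. P (snd c p) w = w"
    "\<And>x. x \<in> B \<Longrightarrow> linear (P x)" "\<And>x. x \<in> B \<Longrightarrow> inj (P x)"
    "\<And>x w. x \<in> B \<Longrightarrow> ((\<lambda>x. P x w) has_derivative (\<lambda>v. - christoffel c x v (P x w))) (at x)"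
    "\<And>k w. Ck_on k B (\<lambda>x. P x w)"
proof -
  obtain r P where "r > 0" "ball (snd c p) r \<subseteq> snd c ` fst c" "\<And>w. P (snd c p) w = w"
    "\<And>x. x \<in> ball (snd c p) r \<Longrightarrow> linear (P x)" "\<And>x. x \<in> ball (snd c p) r \<Longrightarrow> inj (P x)"
    "\<And>x w. x \<in> ball (snd c p) r \<Longrightarrow> ((\<lambda>x. P x w) has_derivative (\<lambda>v. - christoffel c x v (P x w))) (at x)"
    "\<And>k w. Ck_on k (ball (snd c p) r) (\<lambda>x. P x w)"
    by (rule parallel_frame_exists[of "snd c ` fst c" "snd c p" "christoffel c"])
      (use p in \<open>auto simp: open_chart[OF c] linear_christoffel1[OF c] linear_christoffel2[OF c]
        christoffel_Ck_on[OF c] christoffel_flat[OF c] simp del: Ck_on.simps\<close>)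
  then show ?thesis by (intro that[of "ball (snd c p) r" P]) simp_all
qed

lemma
  assumes w: "two_form A w" and p: "p \<in> mfd_carrier A"
  shows two_form_alt: "u \<in> tangent_space A p \<Longrightarrow> v \<in> tangent_space A p \<Longrightarrow> w p u v = - w p v u"
    and two_form_linear: "u \<in> tangent_space A p \<Longrightarrow> v \<in> tangent_space A p \<Longrightarrow> x \<in> tangent_space A p \<Longrightarrow>
      w p (\<lambda>c. a *\<^sub>R u c + b *\<^sub>R v c) x = a * w p u x + b * w p v x"
proof -
  note * = w[unfolded two_form_def, THEN conjunct1, rule_format, OF p]
  show "u \<in> tangent_space A p \<Longrightarrow> v \<in> tangent_space A p \<Longrightarrow> w p u v = - w p v u"
    by (rule *[THEN conjunct1])
  show "u \<in> tangent_space A p \<Longrightarrow> v \<in> tangent_space A p \<Longrightarrow> x \<in> tangent_space A p \<Longrightarrow>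
      w p (\<lambda>c. a *\<^sub>R u c + b *\<^sub>R v c) x = a * w p u x + b * w p v x"
    by (rule *[THEN conjunct2])
qed

text \<open>P x w is the value at x of the parallel field labelled by w. B is connected so that
  functions with zero derivative are constant on it.\<close>

locale framed_chart = flat_torsionfree_atlas A nabla
  for A :: "('m::{t2_space, second_countable_topology}, 'n::finite) chart set" and nabla :: "('m, 'n) conn" +
  fixes c :: "('m, 'n) chart" and B :: "(complex^'n) set" and P :: "complex^'n \<Rightarrow> complex^'n \<Rightarrow> complex^'n"
  assumes c: "c \<in> A" and B: "open B" "connected B" "B \<subseteq> snd c ` fst c"
    and linear_P: "\<And>x. x \<in> B \<Longrightarrow> linear (P x)" and inj_P: "\<And>x. x \<in> B \<Longrightarrow> inj (P x)"
    and P_has_derivative: "\<And>x w. x \<in> B \<Longrightarrow> ((\<lambda>x. P x w) has_derivative (\<lambda>v. - christoffel c x v (P x w))) (at x)"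
    and smooth_P: "\<And>k w. Ck_on k B (\<lambda>x. P x w)"
begin

definition "chart_dom = {q \<in> fst c. snd c q \<in> B}"

text \<open>Components of a vector in the parallel frame.\<close>

definition "T x = Hilbert_Choice.inv (P x)"

abbreviation "\<Gamma> \<equiv> christoffel c"

lemma chart_dom: "chart_dom \<subseteq> fst c" "snd c ` chart_dom = B" "open chart_dom" "chart_dom \<subseteq> mfd_carrier A"
proof -
  show 1: "chart_dom \<subseteq> fst c" by (auto simp: chart_dom_def)
  show "snd c ` chart_dom = B" using B(3) by (auto simp: chart_dom_def)
  have "continuous_on (fst c) (snd c)" using chart_homeomorphism[OF c] by (simp add: homeomorphism_def)
  moreover have "chart_dom = fst c \<inter> snd c -` B" by (auto simp: chart_dom_def)
  ultimately show "open chart_dom" using continuous_open_preimage[OF _ open_chart(1)[OF c] B(1)] by simp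
  show "chart_dom \<subseteq> mfd_carrier A" using 1 carrier[OF c] by blast
qed

lemma chart_B: "z \<in> B \<Longrightarrow> chart_inv c z \<in> chart_dom" "z \<in> B \<Longrightarrow> snd c (chart_inv c z) = z" "z \<in> B \<Longrightarrow> chart_inv c z \<in> fst c"
  and dom_chart: "q \<in> chart_dom \<Longrightarrow> snd c q \<in> B" "q \<in> chart_dom \<Longrightarrow> chart_inv c (snd c q) = q" "q \<in> chart_dom \<Longrightarrow> q \<in> fst c"
  using B(3) c by (auto simp: chart_dom_def chart_inv_right)

lemma TP [simp]: "x \<in> B \<Longrightarrow> T x (P x u) = u"
  by (simp add: T_def inv_f_f[OF inj_P])

lemma PT [simp]: "x \<in> B \<Longrightarrow> P x (T x u) = u"
  using linear_injective_imp_surjective[OF linear_P inj_P] by (simp add: T_def surj_f_inv_f)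

lemma linear_T: "x \<in> B \<Longrightarrow> linear (T x)"
  by (rule linear_inverse_fun[OF linear_P TP PT])

lemma Gamma_symmetric: "x \<in> B \<Longrightarrow> \<Gamma> x v w = \<Gamma> x w v"
  using christoffel_symmetric[OF c chart_B(3)] chart_B(2) by metis

lemma T_field_has_derivative:
  "x \<in> B \<Longrightarrow> (\<eta> has_derivative \<eta>') (at x) \<Longrightarrow>
    ((\<lambda>x. T x (\<eta> x)) has_derivative (\<lambda>v. T x (\<Gamma> x v (\<eta> x) + \<eta>' v))) (at x)"
  by (rule frame_components_has_derivative[OF B(1) _ linear_P PT TP P_has_derivative])

definition frame_field :: "complex^'n \<Rightarrow> ('m, 'n) vfield" where
  "frame_field w q = chart_tvec A c q (P (snd c q) w)"

lemma smooth_frame_field: "smooth_vfield A chart_dom (frame_field w)"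
  unfolding frame_field_def by (rule smooth_vfieldI[OF c chart_dom(3,1)]) (simp add: chart_dom smooth_P)

lemma frame_field_tangent: "q \<in> chart_dom \<Longrightarrow> frame_field w q \<in> tangent_space A q"
  using smooth_vfieldD(1)[OF smooth_frame_field] .

lemma frame_field_component: "q \<in> chart_dom \<Longrightarrow> frame_field w q c = P (snd c q) w"
  using chart_dom c by (auto simp: frame_field_def)

lemma nabla_frame_field:
  assumes q: "q \<in> chart_dom" and v: "v \<in> tangent_space A q"
  shows "nabla q v (frame_field w) = (\<lambda>d. 0)"
proof (rule tangent_space_eqI[OF c dom_chart(3)[OF q] nabla_tangent[OF chart_dom(3,4) smooth_frame_field q v] zero_tangent])
  have "frechet_derivative (\<lambda>z. frame_field w (chart_inv c z) c) (at (snd c q))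
      = frechet_derivative (\<lambda>z. P z w) (at (snd c q))"
    by (rule frechet_derivative_cong_open[OF B(1) dom_chart(1)[OF q]])
      (simp add: frame_field_component chart_B)
  then show "nabla q v (frame_field w) c = 0"
    by (simp add: nabla_chart[OF c chart_dom(3,1) smooth_frame_field q v] frame_field_component[OF q]
        frechet_derivative_eq[OF P_has_derivative[OF dom_chart(1)[OF q]]])
qed

lemma parallel_frame_field: "parallel_vfield A nabla chart_dom (frame_field w)"
  unfolding parallel_vfield_def using smooth_frame_field nabla_frame_field by simp

lemma tangent_eq_frame_field:
  assumes q: "q \<in> chart_dom" and u: "u \<in> tangent_space A q"
  shows "u = frame_field (T (snd c q) (u c)) q"
  by (rule tangent_space_eqI[OF c dom_chart(3)[OF q] u frame_field_tangent[OF q]])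
    (simp add: frame_field_component[OF q] dom_chart(1)[OF q])

text \<open>The Christoffel term of \<open>nabla_chart\<close> is the one that arises from
  differentiating T, so in frame components the covariant derivative is the ordinary one.\<close>

lemma nabla_T:
  assumes S: "open S" "S \<subseteq> chart_dom" and X: "smooth_vfield A S X" and q: "q \<in> S" and v: "v \<in> tangent_space A q"
  shows "((\<lambda>z. T z (X (chart_inv c z) c)) has_derivative
      (\<lambda>w. T (snd c q) (\<Gamma> (snd c q) w (X q c) + frechet_derivative (\<lambda>z. X (chart_inv c z) c) (at (snd c q)) w))) (at (snd c q))"
    and "T (snd c q) (nabla q v X c) = T (snd c q) (\<Gamma> (snd c q) (v c) (X q c)
       + frechet_derivative (\<lambda>z. X (chart_inv c z) c) (at (snd c q)) (v c))"
proof -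
  have Sc: "S \<subseteq> fst c" using S chart_dom(1) by blast
  have qd: "q \<in> chart_dom" using q S by blast
  have "((\<lambda>z. X (chart_inv c z) c) has_derivative frechet_derivative (\<lambda>z. X (chart_inv c z) c) (at (snd c q))) (at (snd c q))"
    using Ck_on_imp_has_derivative[OF smooth_vfieldD(2)[OF X c Sc]] q by blast
  from T_field_has_derivative[OF dom_chart(1)[OF qd] this]
  show "((\<lambda>z. T z (X (chart_inv c z) c)) has_derivative
      (\<lambda>w. T (snd c q) (\<Gamma> (snd c q) w (X q c) + frechet_derivative (\<lambda>z. X (chart_inv c z) c) (at (snd c q)) w))) (at (snd c q))"
    by (simp add: dom_chart(2)[OF qd])
  show "T (snd c q) (nabla q v X c) = T (snd c q) (\<Gamma> (snd c q) (v c) (X q c)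
       + frechet_derivative (\<lambda>z. X (chart_inv c z) c) (at (snd c q)) (v c))"
    by (simp add: nabla_chart[OF c S(1) Sc X q v] add.commute)
qed

text \<open>A parallel form evaluated on two parallel fields has zero derivative, and B is
  connected.\<close>

lemma frame_form_constant:
  assumes w: "two_form A \<omega>" "parallel_form A nabla \<omega>" and pq: "p \<in> chart_dom" "q \<in> chart_dom"
  shows "\<omega> p (frame_field u p) (frame_field v p) = \<omega> q (frame_field u q) (frame_field v q)"
proof -
  define h where "h q = \<omega> q (frame_field u q) (frame_field v q)" for q
  have sm: "smooth_fun A chart_dom h"
    unfolding h_def
    using w(1)[unfolded two_form_def, THEN conjunct2, rule_format, OF conjI[OF chart_dom(3)
        conjI[OF chart_dom(4) conjI[OF smooth_frame_field smooth_frame_field]]]] .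
  then have Ck: "Ck_on k B (h \<circ> chart_inv c)" for k
    using c chart_dom by (auto simp: smooth_fun_def smooth_on_def Int_absorb1)
  have zero: "\<omega> q (\<lambda>d. 0) x = 0" "\<omega> q x (\<lambda>d. 0) = 0" if "q \<in> chart_dom" "x \<in> tangent_space A q" for q x
  proof -
    have qA: "q \<in> mfd_carrier A" using that chart_dom(4) by blast
    have "\<omega> q (\<lambda>d. 0 *\<^sub>R x d + 0 *\<^sub>R x d) x = 0 * \<omega> q x x + 0 * \<omega> q x x"
      by (rule two_form_linear[OF w(1) qA that(2) that(2) that(2)])
    then show "\<omega> q (\<lambda>d. 0) x = 0" by simp
    moreover have "\<omega> q x (\<lambda>d. 0) = - \<omega> q (\<lambda>d. 0) x"
      by (rule two_form_alt[OF w(1) qA that(2) zero_tangent])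
    ultimately show "\<omega> q x (\<lambda>d. 0) = 0" by simp
  qed
  have "((h \<circ> chart_inv c) has_derivative (\<lambda>_. 0)) (at z)" if z: "z \<in> B" for z
  proof -
    define q where "q = chart_inv c z"
    have q: "q \<in> chart_dom" "snd c q = z" using chart_B[OF z] by (simp_all add: q_def)
    have d: "((h \<circ> chart_inv c) has_derivative frechet_derivative (h \<circ> chart_inv c) (at z)) (at z)"
      by (rule Ck_on_imp_has_derivative[OF Ck z])
    have "frechet_derivative (h \<circ> chart_inv c) (at z) y = 0" for y
    proof -
      let ?t = "chart_tvec A c q y"
      have t: "?t \<in> tangent_space A q" by (rule chart_tvec_in_tangent_space[OF c dom_chart(3)[OF q(1)]])
      have "deriv_at A q ?t h = frechet_derivative (h \<circ> chart_inv c) (at z) (?t c)"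
        using deriv_at_chart[OF c dom_chart(3)[OF q(1)] t, of h] d q(2) by simp
      moreover have "deriv_at A q ?t h = \<omega> q (nabla q ?t (frame_field u)) (frame_field v q)
          + \<omega> q (frame_field u q) (nabla q ?t (frame_field v))"
        unfolding h_def
        using w(2)[unfolded parallel_form_def, rule_format, OF conjI[OF chart_dom(3)
            conjI[OF chart_dom(4) conjI[OF smooth_frame_field smooth_frame_field]]] q(1) t] .
      ultimately show ?thesis
        using c dom_chart(3)[OF q(1)]
        by (simp add: nabla_frame_field[OF q(1) t] zero[OF q(1) frame_field_tangent[OF q(1)]])
    qed
    then have "frechet_derivative (h \<circ> chart_inv c) (at z) = (\<lambda>_. 0)" by (rule ext)
    with d show ?thesis by simp
  qed
  from has_derivative_zero_unique_connected[OF B(1,2) this dom_chart(1)[OF pq(1)] dom_chart(1)[OF pq(2)]]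
  show ?thesis by (simp add: dom_chart pq h_def)
qed

text \<open>By constancy the single bilinear form \<Omega> at p computes \<omega> at every point of
  \<open>chart_dom\<close> from frame components, so the symplectic linear algebra is done once, at
  p.\<close>

lemma frame_form:
  assumes w: "symplectic_form A \<omega>" "parallel_form A nabla \<omega>" and p: "p \<in> chart_dom"
  defines "\<Omega> \<equiv> \<lambda>u v. \<omega> p (frame_field u p) (frame_field v p)"
  shows "linear (\<Omega> u)" "\<Omega> u v = - \<Omega> v u" "(\<And>v. \<Omega> u v = 0) \<Longrightarrow> u = 0"
    and "q \<in> chart_dom \<Longrightarrow> x \<in> tangent_space A q \<Longrightarrow> y \<in> tangent_space A q \<Longrightarrow>
      \<omega> q x y = \<Omega> (T (snd c q) (x c)) (T (snd c q) (y c))"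
proof -
  have tf: "two_form A \<omega>" using w(1) by (simp add: symplectic_form_def)
  have pA: "p \<in> mfd_carrier A" using p chart_dom(4) by blast
  note t = frame_field_tangent[OF p]
  show alt: "\<Omega> u v = - \<Omega> v u" for u v
    unfolding \<Omega>_def by (rule two_form_alt[OF tf pA t t])
  have ff: "frame_field (a *\<^sub>R u + b *\<^sub>R v) p = (\<lambda>d. a *\<^sub>R frame_field u p d + b *\<^sub>R frame_field v p d)" for a b u v
    using chart_tvec_lincomb[OF c dom_chart(3)[OF p], of a _ b] linear_P[OF dom_chart(1)[OF p]]
    by (simp add: frame_field_def linear_add linear_cmul)
  have l: "\<Omega> (a *\<^sub>R u + b *\<^sub>R v) x = a * \<Omega> u x + b * \<Omega> v x" for a b u v x
    unfolding \<Omega>_def ff by (rule two_form_linear[OF tf pA t t t])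
  have "\<Omega> x (a *\<^sub>R u + b *\<^sub>R v) = a * \<Omega> x u + b * \<Omega> x v" for a b u v x
    using l[of a u b v x] alt[of x] by simp
  from this[of _ 1 _ 1] this[of _ _ _ 0] show "linear (\<Omega> u)" by (intro linearI) simp_all
  show "u = 0" if 0: "\<And>v. \<Omega> u v = 0"
  proof -
    have "\<omega> p (frame_field u p) x = 0" if "x \<in> tangent_space A p" for x
      using 0[of "T (snd c p) (x c)"] tangent_eq_frame_field[OF p that] by (simp add: \<Omega>_def)
    then have "frame_field u p c = 0" using w(1) pA t unfolding symplectic_form_def by blast
    then have "P (snd c p) u = 0" by (simp add: frame_field_component[OF p])
    then show ?thesis
      using linear_injective_0[OF linear_P] inj_P dom_chart(1)[OF p] by blast
  qed
  show "\<omega> q x y = \<Omega> (T (snd c q) (x c)) (T (snd c q) (y c))"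
    if "q \<in> chart_dom" "x \<in> tangent_space A q" "y \<in> tangent_space A q"
    using frame_form_constant[OF tf w(2) p that(1)] tangent_eq_frame_field[OF that(1,2)] tangent_eq_frame_field[OF that(1,3)]
    by (simp add: \<Omega>_def)
qed

end

text \<open>
  If \<open>dv = du \<circ> J\<close> for real functions \<open>u\<close> and \<open>v\<close>, then \<open>u - i v\<close> is holomorphic. Below, \<open>2n\<close> real
  functions are stored as the real and imaginary parts of \<open>n\<close> complex components.
\<close>

definition cpair_Re :: "complex^'n \<Rightarrow> complex^'n \<Rightarrow> complex^'n" where
  "cpair_Re u v = (\<chi> j. Complex (Re (u $ j)) (- Re (v $ j)))"

definition cpair_Im :: "complex^'n \<Rightarrow> complex^'n \<Rightarrow> complex^'n" where
  "cpair_Im u v = (\<chi> j. Complex (Im (u $ j)) (- Im (v $ j)))"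

lemma bounded_linear_cpair:
  "bounded_linear (\<lambda>p :: (complex^'n) \<times> (complex^'n). cpair_Re (fst p) (snd p))"
  "bounded_linear (\<lambda>p :: (complex^'n) \<times> (complex^'n). cpair_Im (fst p) (snd p))"
  by (rule linear_conv_bounded_linear[THEN iffD1], rule linearI,
      simp_all add: cpair_Re_def cpair_Im_def vec_eq_iff complex_eq_iff)+

text \<open>Replacing h by J h turns the pair du(h), du(J h) into du(J h), - du(h). By these
  identities the differential of u - i v is complex linear when dv = du \<circ> J.\<close>

lemma cpair_imul: "cpair_Re v (- u) = imul (cpair_Re u v)" "cpair_Im v (- u) = imul (cpair_Im u v)"
  by (simp_all add: cpair_Re_def cpair_Im_def imul_def vec_eq_iff complex_eq_iff)

lemma cpair_has_derivative:
  assumes "(u has_derivative u') (at z)" "(v has_derivative v') (at z)"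
  shows "((\<lambda>x. cpair_Re (u x) (v x)) has_derivative (\<lambda>h. cpair_Re (u' h) (v' h))) (at z)"
    and "((\<lambda>x. cpair_Im (u x) (v x)) has_derivative (\<lambda>h. cpair_Im (u' h) (v' h))) (at z)"
  using bounded_linear.has_derivative[OF bounded_linear_cpair(1) has_derivative_Pair[OF assms]]
    bounded_linear.has_derivative[OF bounded_linear_cpair(2) has_derivative_Pair[OF assms]] by simp_all

section \<open>The action and its generator in a framed chart\<close>

locale conic_framed_chart = framed_chart A nabla c B P
  for A :: "('m::{t2_space, second_countable_topology}, 'n::finite) chart set" and nabla c B P +
  fixes p :: 'm and \<omega> :: "('m, 'n) form2" and W \<phi>
  assumes p: "p \<in> chart_dom" and P_base: "\<And>w. P (snd c p) w = w"
    and \<omega>: "symplectic_form A \<omega>" "parallel_form A nabla \<omega>"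
    and action: "local_Cstar_action A W \<phi>" and conic_action: "conic_action A nabla W \<phi>"
begin

definition "\<Phi> = (\<lambda>(\<mu>, z). snd c (\<phi> \<mu> (chart_inv c z)))"

text \<open>The image is confined to \<open>chart_dom\<close>, not merely to the chart, so that the
  frame is available at the image point.\<close>

definition "\<Phi>_dom = {(\<mu>, z). z \<in> B \<and> (\<mu>, chart_inv c z) \<in> W \<and> \<phi> \<mu> (chart_inv c z) \<in> chart_dom}"

lemma action_W: "open W" "\<And>q. q \<in> mfd_carrier A \<Longrightarrow> (1, q) \<in> W" "continuous_on W (\<lambda>(\<mu>, p). \<phi> \<mu> p)"
    "\<And>q. q \<in> mfd_carrier A \<Longrightarrow> \<phi> 1 q = q"
  using action by (auto simp: local_Cstar_action_def)

lemma open_\<Phi>_dom: "open \<Phi>_dom"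
proof -
  let ?V = "UNIV \<times> (snd c ` fst c) :: (complex \<times> (complex^'n)) set"
  let ?h = "\<lambda>p :: complex \<times> (complex^'n). (fst p, chart_inv c (snd p))"
  have V: "open ?V" by (intro open_Times open_UNIV open_chart(2)[OF c])
  have "continuous_on (snd c ` fst c) (chart_inv c)"
    using chart_homeomorphism[OF c] by (simp add: homeomorphism_def)
  then have h: "continuous_on ?V ?h"
    by (intro continuous_on_Pair continuous_on_fst continuous_on_id
        continuous_on_compose2[OF _ continuous_on_snd[OF continuous_on_id]]) auto
  have O1: "open (?V \<inter> ?h -` W)" using continuous_open_preimage[OF h V action_W(1)] .
  have "continuous_on (?V \<inter> ?h -` W) (\<lambda>p. (\<lambda>(\<mu>, p). \<phi> \<mu> p) (?h p))"
    by (rule continuous_on_compose2[OF action_W(3) continuous_on_subset[OF h]]) auto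
  from continuous_open_preimage[OF this O1 chart_dom(3)]
  have "open ((?V \<inter> ?h -` W) \<inter> (\<lambda>p. (\<lambda>(\<mu>, p). \<phi> \<mu> p) (?h p)) -` chart_dom)" .
  moreover have "open (UNIV \<times> B :: (complex \<times> (complex^'n)) set)" by (intro open_Times open_UNIV B(1))
  ultimately have "open (((?V \<inter> ?h -` W) \<inter> (\<lambda>p. (\<lambda>(\<mu>, p). \<phi> \<mu> p) (?h p)) -` chart_dom) \<inter> UNIV \<times> B)"
    by (rule open_Int)
  moreover have "((?V \<inter> ?h -` W) \<inter> (\<lambda>p. (\<lambda>(\<mu>, p). \<phi> \<mu> p) (?h p)) -` chart_dom) \<inter> UNIV \<times> B = \<Phi>_dom"
    using B(3) by (auto simp: \<Phi>_dom_def)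
  ultimately show ?thesis by simp
qed

lemma holo_\<Phi>: "holo imul_C imul \<Phi> \<Phi>_dom"
proof -
  have "holo imul_C imul \<Phi> {(\<mu>, z). z \<in> snd c ` fst c \<and> (\<mu>, chart_inv c z) \<in> W \<and> \<phi> \<mu> (chart_inv c z) \<in> fst c}"
    using action c unfolding local_Cstar_action_def \<Phi>_def by blast
  then show ?thesis by (rule holo_subset) (use B(3) chart_dom(1) in \<open>auto simp: \<Phi>_dom_def\<close>)
qed

lemma \<Phi>_one: "z \<in> B \<Longrightarrow> (1, z) \<in> \<Phi>_dom" "z \<in> B \<Longrightarrow> \<Phi> (1, z) = z"
proof -
  assume z: "z \<in> B"
  then have "chart_inv c z \<in> mfd_carrier A" using chart_B(1) chart_dom(4) by blast
  then show "(1, z) \<in> \<Phi>_dom" "\<Phi> (1, z) = z"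
    using action_W(2,4) chart_B(1,2)[OF z] z by (simp_all add: \<Phi>_dom_def \<Phi>_def)
qed

text \<open>The conic equation speaks of points joined by the local orbit inside
  \<open>chart_dom\<close>; a disc of parameters around 1 that stays in \<Phi>_dom is connected and
  provides the joining.\<close>

lemma frame_equation:
  assumes z: "z \<in> B"
  shows "\<forall>\<^sub>F \<mu> in nhds 1. frechet_derivative \<Phi> (at (\<mu>, z)) (0, P z w) = \<mu> *s P (\<Phi> (\<mu>, z)) w"
proof -
  define q where "q = chart_inv c z"
  have q: "q \<in> chart_dom" "snd c q = z" using chart_B[OF z] by (simp_all add: q_def)
  have "open ((\<lambda>\<mu>. (\<mu>, z)) -` \<Phi>_dom)" by (intro open_vimage open_\<Phi>_dom continuous_intros)
  then obtain d where d: "d > 0" "ball 1 d \<subseteq> (\<lambda>\<mu>. (\<mu>, z)) -` \<Phi>_dom"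
    by (rule openE) (use \<Phi>_one(1)[OF z] in simp)
  have "frechet_derivative \<Phi> (at (\<mu>, z)) (0, P z w) = \<mu> *s P (\<Phi> (\<mu>, z)) w" if \<mu>: "\<mu> \<in> ball 1 d" for \<mu>
  proof -
    have mem: "(\<nu>, q) \<in> W" "\<phi> \<nu> q \<in> chart_dom" "(\<nu>, z) \<in> \<Phi>_dom" if "\<nu> \<in> ball 1 d" for \<nu>
      using subsetD[OF d(2) that] by (auto simp: \<Phi>_dom_def q_def)
    have "connected_component {\<nu>. (\<nu>, q) \<in> W \<and> \<phi> \<nu> q \<in> chart_dom} 1 \<mu>"
      unfolding connected_component_def using mem \<mu> d(1)
      by (intro exI[of _ "ball 1 d"]) auto
    then have eq: "tangent_map A A (\<phi> \<mu>) q (frame_field w q)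
        = (\<lambda>c. Re \<mu> *\<^sub>R frame_field w (\<phi> \<mu> q) c + Im \<mu> *\<^sub>R J_op (frame_field w (\<phi> \<mu> q)) c)"
      using conic_action[unfolded conic_action_def, rule_format, OF conjI[OF chart_dom(3)
          conjI[OF chart_dom(4) parallel_frame_field]] q(1)] by blast
    have emb: "((\<lambda>z. (\<mu>, z)) has_derivative (\<lambda>v. (0, v))) (at z)"
      by (auto intro!: derivative_eq_intros)
    have der: "(((snd c \<circ> \<phi> \<mu>) \<circ> chart_inv c) has_derivative (\<lambda>v. frechet_derivative \<Phi> (at (\<mu>, z)) (0, v))) (at (snd c q))"
      using diff_chain_at[OF emb holoD(1)[OF holo_\<Phi> mem(3)[OF \<mu>]]] by (simp add: o_def \<Phi>_def q(2))
    have "frechet_derivative \<Phi> (at (\<mu>, z)) (0, P z w) = deriv_at A q (frame_field w q) (snd c \<circ> \<phi> \<mu>)"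
      using deriv_at_chart[OF c dom_chart(3)[OF q(1)] frame_field_tangent[OF q(1)] der]
      by (simp add: frame_field_component[OF q(1)] q(2))
    also have "\<dots> = tangent_map A A (\<phi> \<mu>) q (frame_field w q) c"
      using c dom_chart(3)[OF mem(2)[OF \<mu>]] by (simp add: tangent_map_def)
    also have "\<dots> = \<mu> *s frame_field w (\<phi> \<mu> q) c"
      by (simp add: eq J_op_def vector_scaleR_decomp)
    also have "\<dots> = \<mu> *s P (\<Phi> (\<mu>, z)) w"
      using frame_field_component[OF mem(2)[OF \<mu>], of w] by (simp add: \<Phi>_def q_def)
    finally show ?thesis .
  qed
  then show ?thesis
    using eventually_nhds_in_open[of "ball 1 d" "1::complex"] d(1) by (auto elim: eventually_mono)
qed

definition "\<xi> z = frechet_derivative \<Phi> (at (1, z)) (1, 0)"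

text \<open>The Christoffel terms of \<open>T_field_has_derivative\<close> and
  \<open>generator_derivative\<close> carry their arguments in opposite order; torsionfreeness
  identifies them and they cancel.\<close>

lemma
  assumes z: "z \<in> B"
  shows T_\<xi>_has_derivative: "((\<lambda>z. T z (\<xi> z)) has_derivative T z) (at z)"
    and T_J\<xi>_has_derivative: "((\<lambda>z. T z (imul (\<xi> z))) has_derivative (\<lambda>v. T z (imul v))) (at z)"
proof -
  have surj: "surj (P z)" using PT[OF z] by (metis surjI)
  note g = generator_derivative[where G="\<Gamma> z", OF open_\<Phi>_dom B(1) z \<Phi>_one(1)[OF z] holo_\<Phi> \<Phi>_one(2)[OF z]
    P_has_derivative[OF z] surj frame_equation[OF z], folded \<xi>_def]
  show "((\<lambda>z. T z (\<xi> z)) has_derivative T z) (at z)"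
    using T_field_has_derivative[OF z g(1)] by (simp add: Gamma_symmetric[OF z])
  show "((\<lambda>z. T z (imul (\<xi> z))) has_derivative (\<lambda>v. T z (imul v))) (at z)"
    using T_field_has_derivative[OF z g(2)] by (simp add: Gamma_symmetric[OF z])
qed

section \<open>The local model\<close>

theorem local_model:
  "\<exists>N U F nabla' f. open N \<and> p \<in> N \<and> N \<subseteq> mfd_carrier A \<and>
     holomorphic_1form U F \<and> regular_1form U F \<and> conic_1form U F \<and>
     induced_connection U (section_of F) nabla' \<and>
     conic_symplectic_iso A nabla \<omega> N (open_atlas U) nabla' (induced_form U (section_of F)) f"
proof -
  define z0 where "z0 = snd c p"
  have z0: "z0 \<in> B" using dom_chart(1)[OF p] by (simp add: z0_def)
  define \<Omega> where "\<Omega> u v = \<omega> p (frame_field u p) (frame_field v p)" for u v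
  note \<Omega> = frame_form[OF \<omega> p, folded \<Omega>_def]
  obtain L :: "complex^'n \<Rightarrow> complex^'n" where L: "linear L"
    and \<Omega>L: "\<And>u v. \<Omega> u v = 2 * (\<Sum>i\<in>UNIV. Re (L u $ i) * Im (L v $ i) - Re (L v $ i) * Im (L u $ i))"
    and L_tr: "\<And>v. (\<And>i. Re (L v $ i) = 0) \<Longrightarrow> (\<And>i. Re (L (imul v) $ i) = 0) \<Longrightarrow> v = 0"
    by (rule adapted_symplectic_coordinates[of \<Omega>]) (blast intro: \<Omega>)+
  note \<Omega>L = \<Omega>L[folded standard_form_def]
  have blL: "bounded_linear L" using L linear_conv_bounded_linear by blast
  have L0: "v = 0" if "L v = 0" for v
  proof (rule \<Omega>(3))
    show "\<Omega> v u = 0" for u using that by (simp add: \<Omega>L standard_form_def)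
  qed
  \<comment> \<open>The frame components of \<xi>, and below those of J\<xi>, in the symplectic
    coordinates L. Real and imaginary part of a will be the affine coordinates x and y of the
    model.\<close>
  define a where "a z = L (T z (\<xi> z))" for z
  define b where "b z = L (T z (imul (\<xi> z)))" for z
  have da: "(a has_derivative (\<lambda>v. L (T z v))) (at z)" and db: "(b has_derivative (\<lambda>v. L (T z (imul v)))) (at z)"
    if "z \<in> B" for z
    unfolding a_def b_def using T_\<xi>_has_derivative[OF that] T_J\<xi>_has_derivative[OF that]
    by (auto intro: bounded_linear.has_derivative[OF blL])
  \<comment> \<open>Z takes up the real parts of a and b and becomes the coordinate z; Y takes up
    the imaginary parts and becomes w.\<close>
  define Z where "Z z = cpair_Re (a z) (b z)" for z
  define Y where "Y z = cpair_Im (a z) (b z)" for z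
  have dZ: "(Z has_derivative (\<lambda>v. cpair_Re (L (T z v)) (L (T z (imul v))))) (at z)"
    and dY: "(Y has_derivative (\<lambda>v. cpair_Im (L (T z v)) (L (T z (imul v))))) (at z)" if "z \<in> B" for z
    unfolding Z_def Y_def by (intro cpair_has_derivative da db that)+
  have neg: "L (T z (- v)) = - L (T z v)" if "z \<in> B" for z v
    by (simp add: linear_neg[OF linear_T[OF that]] linear_neg[OF L])
  have holoZ: "holo imul imul Z B" and holoY: "holo imul imul Y B"
    by (auto intro!: holoI dZ dY simp: neg cpair_imul)
  have DZ: "frechet_derivative Z (at z) v = cpair_Re (L (T z v)) (L (T z (imul v)))"
    and DY: "frechet_derivative Y (at z) v = cpair_Im (L (T z v)) (L (T z (imul v)))" if "z \<in> B" for z v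
    using dZ[OF that] dY[OF that] by (simp_all add: frechet_derivative_eq)
  have T0: "T z0 v = v" for v using TP[OF z0, of v] P_base by (simp add: z0_def)
  \<comment> \<open>The kernel of dZ consists of the v for which Re L v and Re L (J v) vanish, so
    total reality enters here. It is known at the base point only, where T is the identity.\<close>
  have "inj (frechet_derivative Z (at z0))"
    unfolding linear_injective_0[OF has_derivative_linear[OF holoD(1)[OF holoZ z0]]]
  proof (intro allI impI)
    fix v assume "frechet_derivative Z (at z0) v = 0"
    then have "cpair_Re (L v) (L (imul v)) = 0" by (simp add: DZ[OF z0] T0)
    then show "v = 0" by (intro L_tr) (simp_all add: cpair_Re_def vec_eq_iff complex_eq_iff)
  qed
  then obtain M U \<kappa> where M: "open M" "M \<subseteq> B" "z0 \<in> M" and U: "open U" and hom: "homeomorphism M U Z \<kappa>"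
    and \<kappa>: "holo imul imul \<kappa> U"
      "\<And>y v. y \<in> U \<Longrightarrow> frechet_derivative \<kappa> (at y) (frechet_derivative Z (at (\<kappa> y)) v) = v"
      "\<And>y v. y \<in> U \<Longrightarrow> frechet_derivative Z (at (\<kappa> y)) (frechet_derivative \<kappa> (at y) v) = v"
    using holo_inverse_function[OF B(1) z0 holoZ] by metis
  have \<kappa>M: "\<kappa> y \<in> M" "\<kappa> y \<in> B" "Z (\<kappa> y) = y" if "y \<in> U" for y
    using hom M(2) that by (auto simp: homeomorphism_def)
  have ZU: "Z z \<in> U" "\<kappa> (Z z) = z" if "z \<in> M" for z
    using hom that by (auto simp: homeomorphism_def)
  define F where "F = Y \<circ> \<kappa>"
  have holoF: "holo imul imul F U"
    unfolding F_def o_def by (rule holo_compose[OF \<kappa>(1) holoY]) (use \<kappa>M in auto)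
  interpret F: holomorphic_one_form U F
    by unfold_locales (simp add: holomorphic_1form_def U holoF)
  have DF: "F.DF y v = frechet_derivative Y (at (\<kappa> y)) (frechet_derivative \<kappa> (at y) v)" if y: "y \<in> U" for y v
  proof -
    have "(F has_derivative (\<lambda>v. frechet_derivative Y (at (\<kappa> y)) (frechet_derivative \<kappa> (at y) v))) (at y)"
      using diff_chain_at[OF holoD(1)[OF \<kappa>(1) y] holoD(1)[OF holoY \<kappa>M(2)[OF y]]] by (simp add: F_def o_def)
    then show ?thesis by (simp add: frechet_derivative_eq)
  qed
  \<comment> \<open>Re z and Re F recover the real and imaginary parts of a, so F induces the affine
    coordinates a transported by \<kappa>.\<close>
  have g: "F.g y = a (\<kappa> y)" if "y \<in> U" for y
  proof -
    have "Re (y $ i) = Re (a (\<kappa> y) $ i)" for i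
      using \<kappa>M(3)[OF that] by (metis Z_def cpair_Re_def complex.sel(1) vec_lambda_beta)
    then show ?thesis by (simp add: real_coordinates_def F_def Y_def cpair_Im_def vec_eq_iff complex_eq_iff)
  qed
  have Dg: "frechet_derivative F.g (at y) v = L (T (\<kappa> y) (frechet_derivative \<kappa> (at y) v))" if y: "y \<in> U" for y v
  proof -
    have "((\<lambda>y. a (\<kappa> y)) has_derivative (\<lambda>v. L (T (\<kappa> y) (frechet_derivative \<kappa> (at y) v)))) (at y)"
      using diff_chain_at[OF holoD(1)[OF \<kappa>(1) y] da[OF \<kappa>M(2)[OF y]]] by (simp add: o_def)
    then show ?thesis
      using frechet_derivative_cong_open[OF U y g] by (simp add: frechet_derivative_eq)
  qed
  \<comment> \<open>By Dg = L T D\<kappa> this is a composition of injective maps at every point of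
    U, and it amounts to regularity of F.\<close>
  have "inj (frechet_derivative F.g (at y))" if y: "y \<in> U" for y
  proof -
    have l: "linear (frechet_derivative F.g (at y))"
      unfolding frechet_derivative_eq[OF F.real_coordinates_has_derivative[OF y]]
      by (rule has_derivative_linear[OF F.real_coordinates_has_derivative[OF y]])
    have "v = 0" if "frechet_derivative F.g (at y) v = 0" for v
    proof -
      have "T (\<kappa> y) (frechet_derivative \<kappa> (at y) v) = 0" using that L0 by (simp add: Dg[OF y])
      then have "frechet_derivative \<kappa> (at y) v = 0"
        using PT[OF \<kappa>M(2)[OF y]] linear_0[OF linear_P[OF \<kappa>M(2)[OF y]]] by metis
      then show "v = 0"
        using \<kappa>(3)[OF y, of v] linear_0[OF has_derivative_linear[OF holoD(1)[OF holoZ \<kappa>M(2)[OF y]]]] by simp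
    qed
    then show ?thesis using linear_injective_0[OF l] by blast
  qed
  then have regular: "regular_1form U F" by (simp add: F.regular_iff_inj_Dg)
  have conic: "conic_1form U F"
  proof (rule F.Euler_imp_conic)
    fix y assume y: "y \<in> U"
    \<comment> \<open>dZ(\<xi>) = Z and dY(\<xi>) = Y hold by construction, since Z and Y are built
      from L T \<xi> and L T J\<xi>. So \<xi> becomes the radial field in the coordinate z, and
      Euler's equation for F follows.\<close>
    have "frechet_derivative Z (at (\<kappa> y)) (\<xi> (\<kappa> y)) = y"
      using \<kappa>M(3)[OF y] by (simp add: DZ[OF \<kappa>M(2)[OF y]] Z_def a_def b_def)
    then have "frechet_derivative \<kappa> (at y) y = \<xi> (\<kappa> y)" using \<kappa>(2)[OF y, of "\<xi> (\<kappa> y)"] by simp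
    then have "F.DF y y = Y (\<kappa> y)"
      by (simp add: DF[OF y] DY[OF \<kappa>M(2)[OF y]]) (simp add: Y_def a_def b_def)
    then show "F.DF y y = F y" by (simp add: F_def)
  qed
  interpret F: regular_one_form U F by unfold_locales (rule regular)
  obtain nabla' where nabla': "induced_connection U (section_of F) nabla'" using F.induced_connection_exists by blast
  then have n': "coordinate_compatible U F.g nabla'" "connection (open_atlas U) nabla'"
    by (simp_all add: F.induced_connection_iff flat_torsionfree_connection_def)
  interpret F': atlas_connection "open_atlas U" nabla' by unfold_locales (rule n'(2))
  define N where "N = {q \<in> chart_dom. snd c q \<in> M}"
  define f where "f q = Z (snd c q)" for q
  have "continuous_on chart_dom (snd c)"
    using chart_homeomorphism[OF c] chart_dom(1) continuous_on_subset by (auto simp: homeomorphism_def)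
  then have "open (chart_dom \<inter> snd c -` M)" using continuous_open_preimage[OF _ chart_dom(3) M(1)] by blast
  moreover have "N = chart_dom \<inter> snd c -` M" by (auto simp: N_def)
  ultimately have openN: "open N" by simp
  have pN: "p \<in> N" using p M(3) by (simp add: N_def z0_def)
  have Nd: "N \<subseteq> chart_dom" "N \<subseteq> fst c" "N \<subseteq> mfd_carrier A" using chart_dom by (auto simp: N_def)
  have NM: "snd c q \<in> M" if "q \<in> N" for q using that by (simp add: N_def)
  have inv: "chart_inv c (\<kappa> y) \<in> N" "f (chart_inv c (\<kappa> y)) = y" if "y \<in> U" for y
    using \<kappa>M[OF that] chart_B[OF \<kappa>M(2)[OF that]] by (simp_all add: N_def f_def)
  have fN: "f q \<in> U" "\<kappa> (f q) = snd c q" "chart_inv c (\<kappa> (f q)) = q" if "q \<in> N" for q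
    using ZU[OF NM[OF that]] dom_chart(2) Nd that by (auto simp: f_def)
  have bij: "bij_betw f N U"
    by (rule bij_betw_byWitness[where f'="\<lambda>y. chart_inv c (\<kappa> y)"]) (use fN inv in auto)
  have inv_f: "inv_into N f y = chart_inv c (\<kappa> y)" if "y \<in> U" for y
    using inv_into_f_f[OF bij_betw_imp_inj_on[OF bij] inv(1)[OF that]] inv(2)[OF that] by simp
  have U_chart: "(U, id) \<in> open_atlas U" "\<And>d. d \<in> open_atlas U \<Longrightarrow> d = (U, id)" by (simp_all add: open_atlas_def)
  have contci: "continuous_on (snd c ` fst c) (chart_inv c)" "continuous_on (fst c) (snd c)"
    using chart_homeomorphism[OF c] by (simp_all add: homeomorphism_def)
  have holo_f: "holo_map A (open_atlas U) N f"
    unfolding holo_map_def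
  proof (intro conjI ballI)
    have "continuous_on M Z" using hom by (simp add: homeomorphism_def)
    then show "continuous_on N f"
      unfolding f_def by (rule continuous_on_compose2[OF _ continuous_on_subset[OF contci(2) Nd(2)]]) (use NM in auto)
    show "f ` N \<subseteq> mfd_carrier (open_atlas U)" using fN by auto
    fix e d assume e: "e \<in> A" and d: "d \<in> open_atlas U"
    have S: "{q \<in> fst e \<inter> N. f q \<in> fst d} = fst e \<inter> N" using fN U_chart(2)[OF d] by auto
    have oS: "open (snd e ` (fst e \<inter> N))" using openN e by (intro open_chart_image) (auto simp: open_chart)
    have "holo imul imul (\<lambda>x. Z ((snd c \<circ> chart_inv e) x)) (snd e ` (fst e \<inter> N))"
      by (rule holo_compose[OF holo_subset[OF transition_holo[OF e c]] holo_subset[OF holoZ M(2)]])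
        (use Nd NM e in auto)
    then show "holo imul imul (snd d \<circ> f \<circ> chart_inv e) (snd e ` {q \<in> fst e \<inter> N. f q \<in> fst d})"
      unfolding S by (rule holo_cong[OF oS, rotated]) (simp add: f_def U_chart(2)[OF d])
  qed
  have \<kappa>cont: "continuous_on U \<kappa>" using hom by (simp add: homeomorphism_def)
  have holo_inv: "holo_map (open_atlas U) A U (inv_into N f)"
    unfolding holo_map_def
  proof (intro conjI ballI)
    have "continuous_on U (\<lambda>y. chart_inv c (\<kappa> y))"
      by (rule continuous_on_compose2[OF contci(1) \<kappa>cont]) (use \<kappa>M B(3) in auto)
    then show "continuous_on U (inv_into N f)" by (rule continuous_on_eq) (simp add: inv_f)
    show "inv_into N f ` U \<subseteq> mfd_carrier A" using inv(1) inv_f Nd(3) by auto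
    fix e d assume e: "e \<in> open_atlas U" and d: "d \<in> A"
    define S where "S = U \<inter> \<kappa> -` (snd c ` (fst c \<inter> fst d))"
    have S: "snd e ` {y \<in> fst e \<inter> U. inv_into N f y \<in> fst d} = S"
      using U_chart(2)[OF e] inv_f inv(1) Nd(2) c chart_inv_right[OF c] \<kappa>M B(3) by (force simp: S_def)
    have oS: "open S" unfolding S_def by (rule continuous_open_preimage[OF \<kappa>cont U open_overlap[OF c d]])
    have "holo imul imul (\<lambda>y. (snd d \<circ> chart_inv c) (\<kappa> y)) S"
      by (rule holo_compose[OF holo_subset[OF \<kappa>(1)] transition_holo[OF c d]]) (auto simp: S_def)
    then show "holo imul imul (snd d \<circ> inv_into N f \<circ> chart_inv e) (snd e ` {y \<in> fst e \<inter> U. inv_into N f y \<in> fst d})"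
      unfolding S by (rule holo_cong[OF oS, rotated]) (auto simp: S_def U_chart(2)[OF e] inv_f)
  qed
  have tm: "tangent_map A (open_atlas U) f q u (U, id) = frechet_derivative Z (at (snd c q)) (u c)"
    and tm0: "\<And>d. d \<noteq> (U, id) \<Longrightarrow> tangent_map A (open_atlas U) f q u d = 0"
    if q: "q \<in> N" and u: "u \<in> tangent_space A q" for q u
  proof -
    have qc: "q \<in> fst c" "snd c q \<in> B" using q Nd dom_chart by auto
    have "((id \<circ> f \<circ> chart_inv c) has_derivative frechet_derivative Z (at (snd c q))) (at (snd c q))"
      by (rule has_derivative_transform_within_open[OF holoD(1)[OF holoZ qc(2)] B(1) qc(2)])
        (simp add: f_def chart_B)
    from deriv_at_chart[OF c qc(1) u this]
    show "tangent_map A (open_atlas U) f q u (U, id) = frechet_derivative Z (at (snd c q)) (u c)"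
      using fN(1)[OF q] U_chart(1) by (simp add: tangent_map_def)
    show "tangent_map A (open_atlas U) f q u d = 0" if "d \<noteq> (U, id)" for d
      using that U_chart(2)[of d] unfolding tangent_map_def by presburger
  qed
  have tmT: "tangent_map A (open_atlas U) f q u \<in> tangent_space (open_atlas U) (f q)"
    if "q \<in> N" "u \<in> tangent_space A q" for q u
    using tm0[OF that] tangent_space_open_atlas[OF U fN(1)[OF that(1)]] by blast
  \<comment> \<open>The differential of f preserves components: those in the frame, read through L,
    equal those in the affine coordinates of F. The claims on form and connection both reduce to
    this.\<close>
  have Dg_tm: "frechet_derivative F.g (at (f q)) (frechet_derivative Z (at (snd c q)) w) = L (T (snd c q) w)"
    if q: "q \<in> N" for q w
    using \<kappa>(2)[OF fN(1)[OF q], of w] by (simp add: Dg[OF fN(1)[OF q]] fN(2)[OF q])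
  have form: "induced_form U (section_of F) (f q) (tangent_map A (open_atlas U) f q u) (tangent_map A (open_atlas U) f q v) = \<omega> q u v"
    if "q \<in> N" "u \<in> tangent_space A q" "v \<in> tangent_space A q" for q u v
    using \<Omega>(4)[OF subsetD[OF Nd(1) that(1)] that(2,3)]
    by (simp add: F.induced_form_eq[OF fN(1)[OF that(1)]] tm that Dg_tm \<Omega>L)
  \<comment> \<open>Both sides are compared after applying the injective Dg. There the connection of
    the model becomes an ordinary derivative by compatibility, and the given one by
    \<open>nabla_T\<close>.\<close>
  have conn: "tangent_map A (open_atlas U) f q (nabla q v X)
      = nabla' (f q) (tangent_map A (open_atlas U) f q v)
          (\<lambda>y. tangent_map A (open_atlas U) f (inv_into N f y) (X (inv_into N f y)))"
    if S: "open S" "S \<subseteq> N" and X: "smooth_vfield A S X" and q: "q \<in> S" and v: "v \<in> tangent_space A q" for S X q v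
  proof -
    define V where "V y = tangent_map A (open_atlas U) f (inv_into N f y) (X (inv_into N f y))" for y
    define x where "x z = X (chart_inv c z) c" for z
    have qN: "q \<in> N" using q S by blast
    have Sd: "S \<subseteq> chart_dom" "S \<subseteq> fst c" using S Nd by auto
    \<comment> \<open>The image of S under f, written as a preimage so that it is visibly
      open.\<close>
    define S' where "S' = U \<inter> \<kappa> -` (snd c ` S)"
    have oS: "open (snd c ` S)" by (rule open_chart_image[OF c S(1) Sd(2)])
    have S': "open S'" "S' \<subseteq> U"
      unfolding S'_def using continuous_open_preimage[OF \<kappa>cont U oS] by auto
    have inS: "inv_into N f y \<in> S" "snd c (inv_into N f y) = \<kappa> y" if "y \<in> S'" for y
    proof -
      obtain s where s: "s \<in> S" "\<kappa> y = snd c s" using \<open>y \<in> S'\<close> by (auto simp: S'_def)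
      moreover have "y \<in> U" "s \<in> fst c" using s(1) Sd(2) S'(2) \<open>y \<in> S'\<close> by blast+
      ultimately have "inv_into N f y = s" by (simp add: inv_f c)
      then show "inv_into N f y \<in> S" "snd c (inv_into N f y) = \<kappa> y" using s by simp_all
    qed
    have XT: "X s \<in> tangent_space A s" if "s \<in> S" for s using smooth_vfieldD(1)[OF X that] .
    have V: "V y (U, id) = frechet_derivative Z (at (\<kappa> y)) (x (\<kappa> y))" "d \<noteq> (U, id) \<Longrightarrow> V y d = 0" if y: "y \<in> S'" for y d
    proof -
      have i: "inv_into N f y \<in> N" using inS(1)[OF y] S by blast
      have ch: "chart_inv c (\<kappa> y) = inv_into N f y" using inv_f y S' by auto
      show "V y (U, id) = frechet_derivative Z (at (\<kappa> y)) (x (\<kappa> y))"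
        using tm[OF i XT[OF inS(1)[OF y]]] inS(2)[OF y] by (simp add: V_def x_def ch)
      show "V y d = 0" if "d \<noteq> (U, id)" using tm0[OF i XT[OF inS(1)[OF y]] that] by (simp add: V_def)
    qed
    have xC: "Ck_on k (snd c ` S) x" for k
      unfolding x_def by (rule smooth_vfieldD(2)[OF X c Sd(2)])
    have \<kappa>C: "Ck_on k S' \<kappa>" for k
      by (rule Ck_on_subset[OF holo_imp_Ck_on[OF U linear_imul \<kappa>(1)] S'(2)])
    have \<kappa>S': "\<kappa> ` S' \<subseteq> snd c ` S" "\<kappa> ` S' \<subseteq> B" using \<kappa>M by (auto simp: S'_def)
    have VC: "Ck_on k S' (\<lambda>y. frechet_derivative Z (at (\<kappa> y)) (x (\<kappa> y)))" for k
    proof (rule Ck_on_linear_family[where A="\<lambda>y. frechet_derivative Z (at (\<kappa> y))", OF S'(1)])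
      show "linear (frechet_derivative Z (at (\<kappa> y)))" if "y \<in> S'" for y
        using has_derivative_linear[OF holoD(1)[OF holoZ]] \<kappa>S'(2) that by blast
      show "Ck_on k S' (\<lambda>y. frechet_derivative Z (at (\<kappa> y)) b)" for b
        by (rule Ck_on_compose[OF S'(1) B(1) \<kappa>S'(2) \<kappa>C, where f="\<lambda>z. frechet_derivative Z (at z) b"])
          (rule Ck_on_frechet_derivative[OF holo_imp_Ck_on[OF B(1) linear_imul holoZ]])
      show "Ck_on k S' (\<lambda>y. x (\<kappa> y))" by (rule Ck_on_compose[OF S'(1) oS \<kappa>S'(1) \<kappa>C xC])
    qed
    have smV: "smooth_vfield (open_atlas U) S' V"
      unfolding smooth_vfield_open_atlas[OF U S']
    proof (intro conjI ballI allI impI)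
      show "V y d = 0" if "y \<in> S'" "d \<noteq> (U, id)" for y d by (rule V(2)[OF that])
      show "Ck_on k S' (\<lambda>y. V y (U, id))" for k
        by (rule Ck_on_cong[OF S'(1) _ VC]) (simp add: V(1))
    qed
    have fq: "f q \<in> S'" "f q \<in> U" using q fN[OF qN] by (auto simp: S'_def)
    note t = tmT[OF qN v]
    have SA: "S \<subseteq> mfd_carrier A" using S Nd by blast
    have nT: "nabla q v X \<in> tangent_space A q" by (rule nabla_tangent[OF S(1) SA X q v])
    have "frechet_derivative F.g (at (f q)) (tangent_map A (open_atlas U) f q (nabla q v X) (U, id))
        = L (T (snd c q) (nabla q v X c))"
      by (simp add: tm[OF qN nT] Dg_tm[OF qN])
    also have "\<dots> = frechet_derivative F.g (at (f q)) (nabla' (f q) (tangent_map A (open_atlas U) f q v) V (U, id))"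
    proof -
      define D where "D w = T (snd c q) (\<Gamma> (snd c q) w (X q c) + frechet_derivative x (at (snd c q)) w)" for w
      have nT: "((\<lambda>z. T z (x z)) has_derivative D) (at (snd c q))" "T (snd c q) (nabla q v X c) = D (v c)"
        using nabla_T[OF S(1) Sd(1) X q v] by (simp_all add: D_def[abs_def] x_def[abs_def])
      have "((\<lambda>z. L (T z (x z))) has_derivative (\<lambda>w. L (D w))) (at (\<kappa> (f q)))"
        using bounded_linear.has_derivative[OF blL nT(1)] by (simp add: fN(2)[OF qN])
      from diff_chain_at[OF holoD(1)[OF \<kappa>(1) fq(2)] this]
      have "((\<lambda>y. L (T (\<kappa> y) (x (\<kappa> y)))) has_derivative (\<lambda>w. L (D (frechet_derivative \<kappa> (at (f q)) w)))) (at (f q))"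
        by (simp add: o_def)
      then have "((\<lambda>y. frechet_derivative F.g (at y) (V y (U, id))) has_derivative
          (\<lambda>w. L (D (frechet_derivative \<kappa> (at (f q)) w)))) (at (f q))"
      proof (rule has_derivative_transform_within_open[OF _ S'(1) fq(1)])
        show "L (T (\<kappa> y) (x (\<kappa> y))) = frechet_derivative F.g (at y) (V y (U, id))" if "y \<in> S'" for y
          using that S' \<kappa>(2)[of y "x (\<kappa> y)"] by (auto simp: V(1) Dg)
      qed
      moreover have "frechet_derivative F.g (at (f q)) (nabla' (f q) (tangent_map A (open_atlas U) f q v) V (U, id))
          = frechet_derivative (\<lambda>y. frechet_derivative F.g (at y) (V y (U, id))) (at (f q)) (tangent_map A (open_atlas U) f q v (U, id))"
        using n'(1) S' smV fq(1) t unfolding coordinate_compatible_def by blast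
      ultimately show ?thesis
        using \<kappa>(2)[OF fq(2), of "v c"] by (simp add: frechet_derivative_eq tm[OF qN v] nT(2) fN(2)[OF qN])
    qed
    finally have "tangent_map A (open_atlas U) f q (nabla q v X) (U, id) = nabla' (f q) (tangent_map A (open_atlas U) f q v) V (U, id)"
      using F.inj_g[OF fq(2)] by (simp add: inj_eq)
    \<comment> \<open>Equality in the one chart of the model passes to all entries because both
      sides are tangent vectors.\<close>
    then have "tangent_map A (open_atlas U) f q (nabla q v X) = nabla' (f q) (tangent_map A (open_atlas U) f q v) V"
      using F'.nabla_tangent[OF S'(1) _ smV fq(1) t] tmT[OF qN nT] S'(2) fq(2)
      by (intro F.tangent_space_eqI[OF U_chart(1)]) auto
    then show ?thesis by (simp add: V_def[abs_def])
  qed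
  have "conic_symplectic_iso A nabla \<omega> N (open_atlas U) nabla' (induced_form U (section_of F)) f"
    unfolding conic_symplectic_iso_def mfd_carrier_open_atlas
    using bij holo_f holo_inv conn form by blast
  with openN pN Nd(3) F.holomorphic regular conic nabla' show ?thesis by blast
qed

end

section \<open>Both directions combined\<close>

theorem corollary5:
  shows "(\<forall>(U :: (complex^'n::finite) set) F.
            holomorphic_1form U F \<and> regular_1form U F \<and> conic_1form U F \<longrightarrow>
            holomorphic_immersion U (section_of F) \<and> totally_complex U (section_of F) \<and>
            (\<exists>nabla. induced_connection U (section_of F) nabla) \<and>
            (\<forall>nabla. induced_connection U (section_of F) nabla \<longrightarrow>
               conic_symplectic_manifold (open_atlas U) nabla (induced_form U (section_of F))))
       \<and> (\<forall>(A :: ('m::{t2_space, second_countable_topology}, 'n) chart set) nabla \<omega>.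
            conic_symplectic_manifold A nabla \<omega> \<longrightarrow>
            (\<forall>p\<in>mfd_carrier A. \<exists>N U F nabla' f.
               open N \<and> p \<in> N \<and> N \<subseteq> mfd_carrier A \<and>
               holomorphic_1form U F \<and> regular_1form U F \<and> conic_1form U F \<and>
               induced_connection U (section_of F) nabla' \<and>
               conic_symplectic_iso A nabla \<omega> N
                 (open_atlas U) nabla' (induced_form U (section_of F)) f))"
proof (rule conjI; intro allI impI ballI)
  fix U :: "(complex^'n) set" and F
  assume "holomorphic_1form U F \<and> regular_1form U F \<and> conic_1form U F"
  then interpret conic_one_form U F by unfold_locales auto
  show "holomorphic_immersion U (section_of F) \<and> totally_complex U (section_of F) \<and>
      (\<exists>nabla. induced_connection U (section_of F) nabla) \<and>
      (\<forall>nabla. induced_connection U (section_of F) nabla \<longrightarrow>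
         conic_symplectic_manifold (open_atlas U) nabla (induced_form U (section_of F)))"
    using holomorphic_immersion_section totally_complex_section induced_connection_exists
      induced_conic_symplectic_manifold by blast
next
  fix A :: "('m, 'n) chart set" and nabla \<omega> p
  assume conic: "conic_symplectic_manifold A nabla \<omega>" and p: "p \<in> mfd_carrier A"
  then have cm: "complex_manifold A" and ft: "flat_torsionfree_connection A nabla"
    and \<omega>: "symplectic_form A \<omega>" "parallel_form A nabla \<omega>"
    by (simp_all add: conic_symplectic_manifold_def conic_complex_manifold_def)
  obtain W \<phi> where act: "local_Cstar_action A W \<phi>" "conic_action A nabla W \<phi>"
    using conic by (auto simp: conic_symplectic_manifold_def conic_complex_manifold_def)
  interpret flat_torsionfree_atlas A nabla
    by unfold_locales (use cm ft in \<open>simp_all add: flat_torsionfree_connection_def\<close>)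
  obtain c where cp: "c \<in> A" "p \<in> fst c" using p by (auto simp: mfd_carrier_def)
  obtain B P where BP: "open B" "connected B" "snd c p \<in> B" "B \<subseteq> snd c ` fst c" "\<And>w. P (snd c p) w = w"
    "\<And>x. x \<in> B \<Longrightarrow> linear (P x)" "\<And>x. x \<in> B \<Longrightarrow> inj (P x)"
    "\<And>x w. x \<in> B \<Longrightarrow> ((\<lambda>x. P x w) has_derivative (\<lambda>v. - christoffel c x v (P x w))) (at x)"
    "\<And>k w. Ck_on k B (\<lambda>x. P x w)"
    using parallel_frame_at[OF cp] by blast
  interpret framed_chart A nabla c B P
    by (intro framed_chart.intro framed_chart_axioms.intro flat_torsionfree_atlas_axioms cp(1) BP)
  interpret conic_framed_chart A nabla c B P p \<omega> W \<phi>
    by unfold_locales (use cp BP \<omega> act in \<open>simp_all add: chart_dom_def\<close>)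
  show "\<exists>N U F nabla' f. open N \<and> p \<in> N \<and> N \<subseteq> mfd_carrier A \<and>
      holomorphic_1form U F \<and> regular_1form U F \<and> conic_1form U F \<and>
      induced_connection U (section_of F) nabla' \<and>
      conic_symplectic_iso A nabla \<omega> N (open_atlas U) nabla' (induced_form U (section_of F)) f"
    by (rule local_model)
qed

end
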